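(* Suppose that a map $T:\operatorname{S}^{\infty}(\mathbb{D})\to\operatorname{S}^{\infty}(\mathbb{D})$ is pointwise 2-local in $\operatorname{Iso}(\operatorname{S}^{\infty}(\mathbb{D}),\operatorname{S}^{\infty}(\mathbb{D}))$. Then $T \in \operatorname{Iso}(\operatorname{S}^{\infty}(\mathbb{D}),\operatorname{S}^{\infty}(\mathbb{D}))$.
   Context: $\mathbb D$ is the open unit disk in $\mathbb C$. $\operatorname{S}^{\infty}(\mathbb{D})=\{f \in H(\mathbb{D}): f' \in H^{\infty}(\mathbb{D})\}$, where $H(\mathbb{D})$ is the space of all analytic functions on $\mathbb{D}$ and $H^{\infty}(\mathbb{D})$ is the algebra of all bounded analytic functions on $\mathbb{D}$. It is a unital semisimple commutative Banach algebra with the norm $\|f\|_{\Sigma}=\sup_{z \in \mathbb{D}}|f(z)|+\sup_{w \in \mathbb{D}}|f'(w)|$. Each $f\in\operatorname{S}^{\infty}(\mathbb{D})$ extends continuously to $\bar{\mathbb D}$, and elements of $\operatorname{S}^{\infty}(\mathbb{D})$ are regarded as functions on $\bar{\mathbb D}$, which is identified (via point evaluations) with the maximal ideal space of $\operatorname{S}^{\infty}(\mathbb{D})$. $\operatorname{Iso}(\operatorname{S}^{\infty}(\mathbb{D}),\operatorname{S}^{\infty}(\mathbb{D}))$ is the set of all surjective isometries (distance preserving maps for $\|\cdot\|_\Sigma$, not necessarily linear) of $\operatorname{S}^{\infty}(\mathbb{D})$ onto itself. $T$ is pointwise 2-local in $\operatorname{Iso}(\operatorname{S}^{\infty}(\mathbb{D}),\operatorname{S}^{\infty}(\mathbb{D}))$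 if for every $f,g\in\operatorname{S}^{\infty}(\mathbb{D})$ and every $x\in\bar{\mathbb D}$ there is $T_{f,g,x}\in\operatorname{Iso}(\operatorname{S}^{\infty}(\mathbb{D}),\operatorname{S}^{\infty}(\mathbb{D}))$ such that $(T(f))(x)=(T_{f,g,x}(f))(x)$ and $(T(g))(x)=(T_{f,g,x}(g))(x)$. No linearity, continuity or surjectivity of $T$ is assumed. *)

theory Defs
  imports "HOL-Analysis.Analysis"
begin

text \<open>
  An analytic function on the open unit disk is represented by a total function on the complex
  plane that is holomorphic on the disk and takes the dummy value 0 off the open disk. Hence
  equality of representatives is equality of functions on the disk.
\<close>

definition S_inf :: "(complex \<Rightarrow> complex) set" where
  "S_inf = {f. f holomorphic_on ball 0 1 \<and> bounded (deriv f ` ball 0 1) \<and>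
               (\<forall>z. z \<notin> ball 0 1 \<longrightarrow> f z = 0)}"

definition norm_Sigma :: "(complex \<Rightarrow> complex) \<Rightarrow> real" where
  "norm_Sigma f = (SUP z\<in>ball 0 1. cmod (f z)) + (SUP w\<in>ball 0 1. cmod (deriv f w))"

text \<open>
  The continuous extension of a function on the disk to the closed disk. Values of elements of
  the space at points of the closed disk must be taken through \<open>disk_ext\<close>: on the unit circle
  the representative itself has the dummy value 0.
\<close>

definition disk_ext :: "(complex \<Rightarrow> complex) \<Rightarrow> complex \<Rightarrow> complex" where
  "disk_ext f x = Lim (at x within ball 0 1) f"

definition Iso_S_inf :: "((complex \<Rightarrow> complex) \<Rightarrow> (complex \<Rightarrow> complex)) set" where
  "Iso_S_inf = {U. U ` S_inf = S_inf \<and>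
     (\<forall>f\<in>S_inf. \<forall>g\<in>S_inf. norm_Sigma (\<lambda>z. U f z - U g z) = norm_Sigma (\<lambda>z. f z - g z))}"

definition pointwise_2_local ::
  "((complex \<Rightarrow> complex) \<Rightarrow> (complex \<Rightarrow> complex)) \<Rightarrow>
   ((complex \<Rightarrow> complex) \<Rightarrow> (complex \<Rightarrow> complex)) set \<Rightarrow> bool" where
  "pointwise_2_local T \<S> \<longleftrightarrow>
     (\<forall>f\<in>S_inf. \<forall>g\<in>S_inf. \<forall>x\<in>cball 0 1. \<exists>U\<in>\<S>.
        disk_ext (T f) x = disk_ext (U f) x \<and> disk_ext (T g) x = disk_ext (U g) x)"

text \<open>
  The suprema in \<open>norm_Sigma\<close> are over bounded sets, and the limits in \<open>disk_ext\<close> exist and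
  form the continuous extension.
\<close>

lemma S_inf_lipschitz:
  assumes "f \<in> S_inf"
  obtains B where "B \<ge> 0"
    "\<And>x y. x \<in> ball 0 1 \<Longrightarrow> y \<in> ball 0 1 \<Longrightarrow> cmod (f x - f y) \<le> B * cmod (x - y)"
proof -
  have hol: "f holomorphic_on ball 0 1" and "bounded (deriv f ` ball 0 1)"
    using assms by (auto simp: S_inf_def)
  then obtain B where B: "\<And>z. z \<in> ball 0 1 \<Longrightarrow> cmod (deriv f z) \<le> B"
    unfolding bounded_iff by blast
  have "cmod (deriv f 0) \<le> B" by (rule B) simp
  then have "B \<ge> 0" using norm_ge_zero[of "deriv f 0"] by linarith
  moreover have "cmod (f x - f y) \<le> B * cmod (x - y)"
    if "x \<in> ball 0 1" "y \<in> ball 0 1" for x y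
  proof (rule field_differentiable_bound[where S = "ball 0 1" and f' = "deriv f"])
    show "(f has_field_derivative deriv f z) (at z within ball 0 1)" if "z \<in> ball 0 1" for z
      using that hol holomorphic_derivI[OF hol open_ball] by blast
  qed (use that B in auto)
  ultimately show thesis using that by blast
qed

lemma S_inf_bounded:
  assumes "f \<in> S_inf"
  shows "bdd_above ((\<lambda>z. cmod (f z)) ` ball 0 1)"
    and "bdd_above ((\<lambda>z. cmod (deriv f z)) ` ball 0 1)"
proof -
  obtain B where B: "B \<ge> 0"
    "\<And>x y. x \<in> ball 0 1 \<Longrightarrow> y \<in> ball 0 1 \<Longrightarrow> cmod (f x - f y) \<le> B * cmod (x - y)"
    using S_inf_lipschitz[OF assms] by metis
  show "bdd_above ((\<lambda>z. cmod (f z)) ` ball 0 1)"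
  proof (rule bdd_aboveI2)
    fix z :: complex assume z: "z \<in> ball 0 1"
    have "cmod (f z - f 0) \<le> B * cmod z" using B(2)[of z 0] z by simp
    also have "\<dots> \<le> B" using z B(1) by (simp add: mult_left_le)
    finally show "cmod (f z) \<le> cmod (f 0) + B"
      using norm_triangle_sub[of "f z" "f 0"] by linarith
  qed
  show "bdd_above ((\<lambda>z. cmod (deriv f z)) ` ball 0 1)"
    using assms by (auto simp: S_inf_def bounded_iff bdd_above_def)
qed

lemma disk_ext_props:
  assumes "f \<in> S_inf"
  shows disk_ext_eq: "\<And>z. z \<in> ball 0 1 \<Longrightarrow> disk_ext f z = f z"
    and disk_ext_continuous: "continuous_on (cball 0 1) (disk_ext f)"
proof -
  obtain B where B: "B \<ge> 0"
    "\<And>x y. x \<in> ball 0 1 \<Longrightarrow> y \<in> ball 0 1 \<Longrightarrow> cmod (f x - f y) \<le> B * cmod (x - y)"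
    using S_inf_lipschitz[OF assms] by metis
  have "B-lipschitz_on (ball 0 1) f"
    using B by (auto simp: lipschitz_on_def dist_norm)
  then have "uniformly_continuous_on (ball 0 1) f"
    by (rule lipschitz_on_uniformly_continuous)
  then obtain g where g: "uniformly_continuous_on (closure (ball 0 1)) g"
    "\<And>x. x \<in> ball 0 1 \<Longrightarrow> f x = g x"
    by (rule uniformly_continuous_on_extension_on_closure) blast
  have cont: "continuous_on (cball 0 1) g"
    using uniformly_continuous_imp_continuous[OF g(1)] by simp
  have eq: "disk_ext f x = g x" if x: "x \<in> cball 0 1" for x
    unfolding disk_ext_def
  proof (rule tendsto_Lim)
    show "\<not> trivial_limit (at x within ball 0 1)"
      using x by (simp add: trivial_limit_within islimpt_ball)
    have "(g \<longlongrightarrow> g x) (at x within cball 0 1)"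
      using cont x by (simp add: continuous_on)
    then have "(g \<longlongrightarrow> g x) (at x within ball 0 1)"
      by (rule tendsto_within_subset) auto
    moreover have "\<forall>\<^sub>F z in at x within ball 0 1. g z = f z"
      using g(2) by (simp add: eventually_at_filter)
    ultimately show "(f \<longlongrightarrow> g x) (at x within ball 0 1)"
      using tendsto_cong by blast
  qed
  show "disk_ext f z = f z" if "z \<in> ball 0 1" for z
    using eq[of z] g(2) that by auto
  show "continuous_on (cball 0 1) (disk_ext f)"
    using cont eq continuous_on_cong by metis
qed

end

theory Submission
  imports Defs "HOL-Complex_Analysis.Complex_Analysis"
begin

text \<open>
  Every surjective isometry is, up to a translation, one of the maps taking \<open>f\<close> to
  \<open>c f(l z)\<close> or \<open>c cnj (f (l (cnj z)))\<close> with unimodular \<open>c\<close> and \<open>l\<close>. By Mazur--Ulam it is real-linear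
  after the translation. Constants are the only two-dimensional real subspace containing, for every
  \<open>f\<close>, a unit vector \<open>v\<close> with \<open>norm (v + f) = 1 + norm f\<close>, so they are preserved and may be
  assumed fixed. Comparing \<open>norm (f + n a)\<close> for large constants \<open>n a\<close> then shows that the supremum
  of \<open>Re (cnj a f)\<close> plus the supremum of the modulus of the derivative is invariant, and perturbing
  large multiples of \<open>b z\<close> shows that the image \<open>F\<close> of \<open>b z\<close> has constant modulus on the circle and
  is injective there. By reflection \<open>F\<close> is analytic across the circle, and the points where its
  derivative peaks either are finite in number, which allows too many functions with affine
  preimage, or force \<open>z F'(z) = k F(z)\<close>; hence \<open>F\<close> is a multiple of \<open>z\<close>.

  For a pointwise 2-local map \<open>T\<close> this gives: \<open>\<bar>T f(x) - T g(x)\<bar> = \<bar>f(y) - g(y)\<bar>\<close> for some \<open>y\<close> with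
  \<open>\<bar>y\<bar> = \<bar>x\<bar>\<close>. After normalising \<open>T\<close> on constants and on \<open>z\<close>, comparison of \<open>f\<close> with the
  functions \<open>a + b z\<close> as \<open>b\<close> tends to infinity in all directions determines \<open>T f(x)\<close>.
\<close>

section \<open>The normed space\<close>

text \<open>The norm adds two suprema, and an isometry might trade one against the other. The remedy
  throughout is to add a large multiple of a test function: in the limit each supremum is taken only
  over the points where the test function peaks. On the derivative side this needs boundary values,
  which the bounded derivative of a general element may fail to have. They are available for
  polynomials and, by reflection, for functions of constant positive modulus on the circle; hence
  constant modulus is always proved before the boundary derivative is used. Constants and multiples
  of \<open>z\<close> could a priori be conjugated independently of each other. The mixed case is
  excluded by the function \<open>z^2\<close> and an eighth root of unity, once for isometries and
  once for maps with the modulus property of \<open>T\<close>. In that property the point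
  \<open>y\<close> depends on both functions and on \<open>x\<close>, so neither linearity nor
  surjectivity of \<open>T\<close> is available before its explicit form is known.\<close>

lemma S_infI:
  assumes "\<And>z. z \<in> ball 0 1 \<Longrightarrow> (f has_field_derivative f' z) (at z)"
    and "\<And>z. z \<in> ball 0 1 \<Longrightarrow> cmod (f' z) \<le> B"
    and "\<And>z. z \<notin> ball 0 1 \<Longrightarrow> f z = 0"
  shows "f \<in> S_inf"
proof -
  have "f holomorphic_on ball 0 1"
    using assms(1) by (metis holomorphic_onI field_differentiable_at_within field_differentiable_def)
  moreover have "deriv f z = f' z" if "z \<in> ball 0 1" for z
    using assms(1)[OF that] by (rule DERIV_imp_deriv)
  ultimately show ?thesis
    using assms(2,3) unfolding S_inf_def bounded_iff by (auto intro!: exI[of _ B])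
qed

lemma S_inf_deriv:
  assumes "f \<in> S_inf" "z \<in> ball 0 1"
  shows "(f has_field_derivative deriv f z) (at z)"
  using assms holomorphic_derivI[of f "ball 0 1" z] by (auto simp: S_inf_def)

lemma S_inf_deriv_bound:
  assumes "f \<in> S_inf"
  obtains B where "\<And>z. z \<in> ball 0 1 \<Longrightarrow> cmod (deriv f z) \<le> B"
proof -
  have "bounded (deriv f ` ball 0 1)" using assms by (simp add: S_inf_def)
  then show ?thesis using that unfolding bounded_iff by blast
qed

lemma S_inf_zero_off: "f \<in> S_inf \<Longrightarrow> z \<notin> ball 0 1 \<Longrightarrow> f z = 0"
  by (simp add: S_inf_def)

lemma S_inf_add:
  assumes f: "f \<in> S_inf" and g: "g \<in> S_inf"
  shows "(\<lambda>z. f z + g z) \<in> S_inf"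
proof -
  obtain B C where B: "\<And>z. z \<in> ball 0 1 \<Longrightarrow> cmod (deriv f z) \<le> B"
    and C: "\<And>z. z \<in> ball 0 1 \<Longrightarrow> cmod (deriv g z) \<le> C"
    using f g S_inf_deriv_bound by metis
  show ?thesis
  proof (rule S_infI)
    show "((\<lambda>z. f z + g z) has_field_derivative deriv f z + deriv g z) (at z)" if "z \<in> ball 0 1" for z
      by (intro DERIV_add S_inf_deriv f g that)
    show "cmod (deriv f z + deriv g z) \<le> B + C" if "z \<in> ball 0 1" for z
      using B[OF that] C[OF that] by (rule norm_triangle_mono)
  qed (use f g in \<open>simp add: S_inf_zero_off\<close>)
qed

lemma S_inf_cmult:
  assumes f: "f \<in> S_inf"
  shows "(\<lambda>z. c * f z) \<in> S_inf"
proof -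
  obtain B where B: "\<And>z. z \<in> ball 0 1 \<Longrightarrow> cmod (deriv f z) \<le> B"
    using f S_inf_deriv_bound by metis
  show ?thesis
  proof (rule S_infI)
    show "((\<lambda>z. c * f z) has_field_derivative c * deriv f z) (at z)" if "z \<in> ball 0 1" for z
      by (intro DERIV_cmult S_inf_deriv f that)
    show "cmod (c * deriv f z) \<le> cmod c * B" if "z \<in> ball 0 1" for z
      using B[OF that] by (simp add: norm_mult mult_left_mono)
  qed (use f in \<open>simp add: S_inf_zero_off\<close>)
qed

lemma S_inf_zero: "(\<lambda>z. 0) \<in> S_inf"
  by (rule S_infI[where f' = "\<lambda>_. 0" and B = 0]) auto

lemma S_inf_diff:
  assumes f: "f \<in> S_inf" and g: "g \<in> S_inf"
  shows "(\<lambda>z. f z - g z) \<in> S_inf"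
  using S_inf_add[OF f S_inf_cmult[OF g, of "-1"]] by simp

text \<open>A type is introduced because \<open>mazur_ulam\<close> speaks about instances of
  \<open>real_normed_vector\<close>. The zero value off the disk makes representatives unique, so
  equality in the type is equality on the disk.\<close>

typedef sinf = S_inf morphisms fn Abs_sinf
  using S_inf_zero by blast

setup_lifting type_definition_sinf

lemma sinf_eqI: "(\<And>z. z \<in> ball 0 1 \<Longrightarrow> fn f z = fn g z) \<Longrightarrow> f = g"
  using S_inf_zero_off[OF fn] by (metis ext fn_inject)

instantiation sinf :: real_vector
begin

lift_definition zero_sinf :: sinf is "\<lambda>z. 0" by (rule S_inf_zero)
lift_definition plus_sinf :: "sinf \<Rightarrow> sinf \<Rightarrow> sinf" is "\<lambda>f g z. f z + g z" by (rule S_inf_add)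
lift_definition minus_sinf :: "sinf \<Rightarrow> sinf \<Rightarrow> sinf" is "\<lambda>f g z. f z - g z" by (rule S_inf_diff)
lift_definition uminus_sinf :: "sinf \<Rightarrow> sinf" is "\<lambda>f z. - f z"
  using S_inf_cmult[of _ "-1"] by simp
lift_definition scaleR_sinf :: "real \<Rightarrow> sinf \<Rightarrow> sinf" is "\<lambda>r f z. of_real r * f z"
  by (rule S_inf_cmult)

instance
  by standard (rule sinf_eqI, simp add: plus_sinf.rep_eq minus_sinf.rep_eq uminus_sinf.rep_eq zero_sinf.rep_eq scaleR_sinf.rep_eq algebra_simps)+

end

lift_definition cmul :: "complex \<Rightarrow> sinf \<Rightarrow> sinf" is "\<lambda>c f z. c * f z"
  by (rule S_inf_cmult)

lemma fn_simps [simp]: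
  "fn 0 z = 0" "fn (f + g) z = fn f z + fn g z" "fn (f - g) z = fn f z - fn g z"
  "fn (- f) z = - fn f z" "fn (r *\<^sub>R f) z = of_real r * fn f z" "fn (cmul c f) z = c * fn f z"
  by (simp_all add: plus_sinf.rep_eq minus_sinf.rep_eq uminus_sinf.rep_eq zero_sinf.rep_eq scaleR_sinf.rep_eq cmul.rep_eq)

definition dv :: "sinf \<Rightarrow> complex \<Rightarrow> complex" where
  "dv f z = deriv (fn f) z"

lemma has_dv: "z \<in> ball 0 1 \<Longrightarrow> (fn f has_field_derivative dv f z) (at z)"
  unfolding dv_def by (rule S_inf_deriv[OF fn])

lemma dvI: "(fn f has_field_derivative d) (at z) \<Longrightarrow> dv f z = d"
  unfolding dv_def by (rule DERIV_imp_deriv)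

lemma fn_holomorphic: "fn f holomorphic_on ball 0 1"
  using fn[of f] by (simp add: S_inf_def)

lemma dv_holomorphic: "dv f holomorphic_on ball 0 1"
proof -
  have "dv f = deriv (fn f)" by (simp add: dv_def fun_eq_iff)
  then show ?thesis using holomorphic_deriv[OF fn_holomorphic open_ball, of f] by simp
qed

lemma dv_simps:
  assumes "z \<in> ball 0 1"
  shows "dv 0 z = 0" "dv (f + g) z = dv f z + dv g z" "dv (f - g) z = dv f z - dv g z"
    "dv (- f) z = - dv f z" "dv (r *\<^sub>R f) z = of_real r * dv f z" "dv (cmul c f) z = c * dv f z"
proof -
  note h = has_dv[OF assms]
  show "dv 0 z = 0"
    using DERIV_const[of 0 "at z"] by (intro dvI) (simp add: zero_sinf.rep_eq)
  show "dv (f + g) z = dv f z + dv g z"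
    using DERIV_add[OF h[of f] h[of g]] by (intro dvI) (simp add: plus_sinf.rep_eq)
  show "dv (f - g) z = dv f z - dv g z"
    using DERIV_diff[OF h[of f] h[of g]] by (intro dvI) (simp add: minus_sinf.rep_eq)
  show "dv (- f) z = - dv f z"
    using DERIV_minus[OF h[of f]] by (intro dvI) (simp add: uminus_sinf.rep_eq)
  show "dv (r *\<^sub>R f) z = of_real r * dv f z"
    using DERIV_cmult[OF h[of f], of "of_real r"] by (intro dvI) (simp add: scaleR_sinf.rep_eq)
  show "dv (cmul c f) z = c * dv f z"
    using DERIV_cmult[OF h[of f], of c] by (intro dvI) (simp add: cmul.rep_eq)
qed

definition sn :: "sinf \<Rightarrow> real" where
  "sn f = (SUP z\<in>ball 0 1. cmod (fn f z))"

definition dn :: "sinf \<Rightarrow> real" where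
  "dn f = (SUP z\<in>ball 0 1. cmod (dv f z))"

lemma sn_ge: "z \<in> ball 0 1 \<Longrightarrow> cmod (fn f z) \<le> sn f"
  unfolding sn_def by (rule cSUP_upper[OF _ S_inf_bounded(1)[OF fn]])

lemma dn_ge: "z \<in> ball 0 1 \<Longrightarrow> cmod (dv f z) \<le> dn f"
  unfolding dn_def dv_def by (rule cSUP_upper[OF _ S_inf_bounded(2)[OF fn]])

lemma sn_le: "(\<And>z. z \<in> ball 0 1 \<Longrightarrow> cmod (fn f z) \<le> B) \<Longrightarrow> sn f \<le> B"
  unfolding sn_def by (rule cSUP_least) auto

lemma dn_le: "(\<And>z. z \<in> ball 0 1 \<Longrightarrow> cmod (dv f z) \<le> B) \<Longrightarrow> dn f \<le> B"
  unfolding dn_def by (rule cSUP_least) auto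

lemma sn_nonneg: "0 \<le> sn f" and dn_nonneg: "0 \<le> dn f"
  using order_trans[OF norm_ge_zero sn_ge[of 0 f]] order_trans[OF norm_ge_zero dn_ge[of 0 f]]
  by simp_all

lemma sn_triangle: "sn (f + g) \<le> sn f + sn g"
  by (rule sn_le) (simp add: norm_triangle_mono[OF sn_ge sn_ge])

lemma dn_triangle: "dn (f + g) \<le> dn f + dn g"
  by (rule dn_le) (simp add: dv_simps norm_triangle_mono[OF dn_ge dn_ge])

lemma sn_cmul: "sn (cmul c f) = cmod c * sn f"
proof (rule antisym)
  show "sn (cmul c f) \<le> cmod c * sn f"
    by (rule sn_le) (simp add: norm_mult mult_left_mono sn_ge)
  show "cmod c * sn f \<le> sn (cmul c f)"
  proof (cases "c = 0")
    case False
    have "sn f \<le> sn (cmul c f) / cmod c"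
      using False sn_ge[of _ "cmul c f"] by (intro sn_le) (simp add: norm_mult field_simps)
    then show ?thesis using False by (simp add: field_simps)
  qed (use sn_nonneg in simp)
qed

lemma dn_cmul: "dn (cmul c f) = cmod c * dn f"
proof (rule antisym)
  show "dn (cmul c f) \<le> cmod c * dn f"
    by (rule dn_le) (simp add: dv_simps norm_mult mult_left_mono dn_ge)
  show "cmod c * dn f \<le> dn (cmul c f)"
  proof (cases "c = 0")
    case False
    have "dn f \<le> dn (cmul c f) / cmod c"
      using False dn_ge[of _ "cmul c f"] by (intro dn_le) (simp add: dv_simps norm_mult field_simps)
    then show ?thesis using False by (simp add: field_simps)
  qed (use dn_nonneg in simp)
qed

lemma scaleR_cmul: "r *\<^sub>R f = cmul (of_real r) f"
  by (rule sinf_eqI) simp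

lemma sn_eq_0: "sn f = 0 \<Longrightarrow> f = 0"
  using sn_ge[of _ f] by (intro sinf_eqI) auto

instantiation sinf :: real_normed_vector
begin

lift_definition norm_sinf :: "sinf \<Rightarrow> real" is norm_Sigma .

definition dist_sinf :: "sinf \<Rightarrow> sinf \<Rightarrow> real" where
  "dist_sinf f g = norm (f - g)"

definition sgn_sinf :: "sinf \<Rightarrow> sinf" where
  "sgn_sinf f = inverse (norm f) *\<^sub>R f"

definition uniformity_sinf :: "(sinf \<times> sinf) filter" where
  "uniformity_sinf = (INF e\<in>{0<..}. principal {(x, y). dist x y < e})"

definition open_sinf :: "sinf set \<Rightarrow> bool" where
  "open_sinf U \<longleftrightarrow> (\<forall>x\<in>U. eventually (\<lambda>(x', y). x' = x \<longrightarrow> y \<in> U) uniformity)"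

lemma norm_sinf: "norm f = sn f + dn f"
  by (simp add: norm_sinf.rep_eq norm_Sigma_def sn_def dn_def dv_def)

instance
proof
  fix f g :: sinf and r :: real
  show "dist f g = norm (f - g)" by (rule dist_sinf_def)
  show "sgn f = inverse (norm f) *\<^sub>R f" by (rule sgn_sinf_def)
  show "(uniformity :: (sinf \<times> sinf) filter) = (INF e\<in>{0<..}. principal {(x, y). dist x y < e})"
    by (rule uniformity_sinf_def)
  show "open U = (\<forall>x\<in>U. \<forall>\<^sub>F (x', y) in uniformity. x' = x \<longrightarrow> y \<in> U)" for U :: "sinf set"
    by (rule open_sinf_def)
  have "cmul 0 0 = 0" by (rule sinf_eqI) simp
  then have "sn 0 = 0" "dn 0 = 0"
    using sn_cmul[of 0 0] dn_cmul[of 0 0] by simp_all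
  then show "norm f = 0 \<longleftrightarrow> f = 0"
    using sn_nonneg[of f] dn_nonneg[of f] sn_eq_0[of f] by (auto simp: norm_sinf)
  show "norm (f + g) \<le> norm f + norm g"
    using sn_triangle[of f g] dn_triangle[of f g] by (simp add: norm_sinf)
  show "norm (r *\<^sub>R f) = \<bar>r\<bar> * norm f"
    by (simp add: norm_sinf scaleR_cmul sn_cmul dn_cmul distrib_left)
qed

end

section \<open>Continuous boundary values\<close>

definition ev :: "sinf \<Rightarrow> complex \<Rightarrow> complex" where
  "ev f = disk_ext (fn f)"

lemma ev_ball: "z \<in> ball 0 1 \<Longrightarrow> ev f z = fn f z"
  unfolding ev_def by (rule disk_ext_eq[OF fn])

lemma ev_continuous: "continuous_on (cball 0 1) (ev f)"
  unfolding ev_def by (rule disk_ext_continuous[OF fn])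

lemma ev_sphere_continuous: "continuous_on (sphere 0 1) (ev f)"
  by (rule continuous_on_subset[OF ev_continuous]) auto

text \<open>The open disk is dense in the closed one, so any continuous candidate that agrees with
  \<open>f\<close> inside is the extension; the rules for \<open>ev\<close> below follow by
  exhibiting candidates.\<close>

lemma ev_unique:
  assumes g: "continuous_on (cball 0 1) g" "\<And>z. z \<in> ball 0 1 \<Longrightarrow> fn f z = g z" and x: "x \<in> cball 0 1"
  shows "ev f x = g x"
proof -
  have "continuous_on (cball 0 1) (\<lambda>x. ev f x - g x)"
    by (rule continuous_on_diff[OF ev_continuous g(1)])
  then have "ev f x - g x = 0"
    using continuous_constant_on_closure[of "ball 0 1" "\<lambda>x. ev f x - g x" 0 x] x g(2) ev_ball[of _ f]
    by (metis (no_types, lifting) closure_ball eq_iff_diff_eq_0 zero_less_one)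
  then show ?thesis by simp
qed

lemma ev_simps [simp]:
  assumes x: "x \<in> cball 0 1"
  shows "ev 0 x = 0" "ev (f + g) x = ev f x + ev g x" "ev (f - g) x = ev f x - ev g x"
    "ev (- f) x = - ev f x" "ev (r *\<^sub>R f) x = of_real r * ev f x" "ev (cmul c f) x = c * ev f x"
proof -
  note c = continuous_intros ev_continuous
  show "ev 0 x = 0"
    by (rule ev_unique[OF _ _ x, where g = "\<lambda>x. 0"]) (intro c | simp add: ev_ball)+
  show "ev (f + g) x = ev f x + ev g x"
    by (rule ev_unique[OF _ _ x, where g = "\<lambda>x. ev f x + ev g x"]) (intro c | simp add: ev_ball)+
  show "ev (f - g) x = ev f x - ev g x"
    by (rule ev_unique[OF _ _ x, where g = "\<lambda>x. ev f x - ev g x"]) (intro c | simp add: ev_ball)+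
  show "ev (- f) x = - ev f x"
    by (rule ev_unique[OF _ _ x, where g = "\<lambda>x. - ev f x"]) (intro c | simp add: ev_ball)+
  show "ev (r *\<^sub>R f) x = of_real r * ev f x"
    by (rule ev_unique[OF _ _ x, where g = "\<lambda>x. of_real r * ev f x"]) (intro c | simp add: ev_ball)+
  show "ev (cmul c f) x = c * ev f x"
    by (rule ev_unique[OF _ _ x, where g = "\<lambda>x. c * ev f x"]) (intro c | simp add: ev_ball)+
qed

lemma ev_le_sn:
  assumes "x \<in> cball 0 1"
  shows "cmod (ev f x) \<le> sn f"
proof (rule continuous_le_on_closure[where S = "ball 0 1" and f = "\<lambda>x. cmod (ev f x)"])
  show "continuous_on (closure (ball 0 1)) (\<lambda>x. cmod (ev f x))"
    using continuous_on_norm[OF ev_continuous] by simp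
  show "x \<in> closure (ball 0 1)" using assms by simp
  show "cmod (ev f z) \<le> sn f" if "z \<in> ball 0 1" for z
    using that by (simp only: ev_ball sn_ge)
qed

text \<open>The maximum modulus principle: from here on \<open>sn\<close> can be computed on the
  circle, where it is attained.\<close>

lemma sn_le_sphere:
  assumes "\<And>x. x \<in> sphere 0 1 \<Longrightarrow> cmod (ev f x) \<le> B"
  shows "sn f \<le> B"
proof (rule sn_le)
  fix z :: complex assume z: "z \<in> ball 0 1"
  have "ev f holomorphic_on ball 0 1"
    by (rule holomorphic_transform[OF fn_holomorphic]) (simp only: ev_ball)
  have "cmod (ev f z) \<le> B"
    by (rule maximum_modulus_frontier[of "ev f" "cball 0 1"]) (use \<open>ev f holomorphic_on ball 0 1\<close> assms z ev_continuous in simp_all)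
  then show "cmod (fn f z) \<le> B" using z by (simp only: ev_ball)
qed

lemma sn_attained:
  obtains x where "x \<in> sphere 0 1" "cmod (ev f x) = sn f"
proof -
  have "compact (sphere (0::complex) 1)" "sphere (0::complex) 1 \<noteq> {}" by auto
  moreover have "continuous_on (sphere 0 1) (\<lambda>x. cmod (ev f x))"
    by (intro continuous_intros ev_sphere_continuous)
  ultimately obtain x where x: "x \<in> sphere 0 1" "\<And>y. y \<in> sphere 0 1 \<Longrightarrow> cmod (ev f y) \<le> cmod (ev f x)"
    using continuous_attains_sup[of "sphere 0 1" "\<lambda>x. cmod (ev f x)"] by blast
  have "sn f = cmod (ev f x)"
    using x(2) ev_le_sn[of x f] x(1) by (intro antisym sn_le_sphere) simp_all
  then show ?thesis using that x by simp
qed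

lemma sinf_eq_sphere:
  assumes "\<And>x. x \<in> sphere 0 1 \<Longrightarrow> ev f x = ev g x"
  shows "f = g"
proof -
  have "sn (f - g) \<le> 0" using assms by (intro sn_le_sphere) simp
  then have "f - g = 0" using sn_nonneg[of "f - g"] by (intro sn_eq_0) simp
  then show ?thesis by simp
qed

text \<open>The support function, in the direction \<open>a\<close>, of the image of the circle. It
  is what survives of \<open>sn\<close> when a large constant in the direction \<open>a\<close> is
  added.\<close>

definition sr :: "complex \<Rightarrow> sinf \<Rightarrow> real" where
  "sr a f = (SUP x\<in>sphere 0 1. Re (cnj a * ev f x))"

section \<open>Entire and affine elements\<close>

definition mk :: "(complex \<Rightarrow> complex) \<Rightarrow> sinf" where
  "mk h = Abs_sinf (\<lambda>z. if z \<in> ball 0 1 then h z else 0)"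

lemma mk_S_inf:
  assumes "h holomorphic_on UNIV"
  shows "(\<lambda>z. if z \<in> ball 0 1 then h z else 0) \<in> S_inf"
    and "z \<in> ball 0 1 \<Longrightarrow> ((\<lambda>z. if z \<in> ball 0 1 then h z else 0) has_field_derivative deriv h z) (at z)"
proof -
  have *: "((\<lambda>z. if z \<in> ball 0 1 then h z else 0) has_field_derivative deriv h z) (at z)"
    if "z \<in> ball 0 1" for z
    by (rule has_field_derivative_transform_within_open[where f = h and S = "ball 0 1"])
       (use assms that holomorphic_derivI[OF assms] in auto)
  then show "z \<in> ball 0 1 \<Longrightarrow> ((\<lambda>z. if z \<in> ball 0 1 then h z else 0) has_field_derivative deriv h z) (at z)" .
  have "continuous_on (cball 0 1) (deriv h)"
    using assms by (meson holomorphic_deriv holomorphic_on_imp_continuous_on continuous_on_subset open_UNIV subset_UNIV)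
  then have "bounded (deriv h ` cball 0 1)"
    by (simp add: compact_continuous_image compact_imp_bounded)
  then obtain B where "\<And>z. z \<in> cball 0 1 \<Longrightarrow> cmod (deriv h z) \<le> B"
    unfolding bounded_iff by blast
  then show "(\<lambda>z. if z \<in> ball 0 1 then h z else 0) \<in> S_inf"
    using * by (intro S_infI[where f' = "deriv h" and B = B]) auto
qed

lemma mk:
  assumes "h holomorphic_on UNIV"
  shows fn_mk: "\<And>z. z \<in> ball 0 1 \<Longrightarrow> fn (mk h) z = h z"
    and dv_mk: "\<And>z. z \<in> ball 0 1 \<Longrightarrow> dv (mk h) z = deriv h z"
    and ev_mk: "\<And>z. z \<in> cball 0 1 \<Longrightarrow> ev (mk h) z = h z"
proof -
  have eq: "fn (mk h) = (\<lambda>z. if z \<in> ball 0 1 then h z else 0)"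
    unfolding mk_def by (rule Abs_sinf_inverse[OF mk_S_inf(1)[OF assms]])
  show "fn (mk h) z = h z" if "z \<in> ball 0 1" for z
    using that by (simp add: eq)
  show "dv (mk h) z = deriv h z" if "z \<in> ball 0 1" for z
    by (rule dvI) (use mk_S_inf(2)[OF assms] that in \<open>simp add: eq\<close>)
  show "ev (mk h) z = h z" if "z \<in> cball 0 1" for z
  proof (rule ev_unique[OF _ _ that, where g = h])
    show "continuous_on (cball 0 1) h"
      using holomorphic_on_imp_continuous_on[OF assms] by (rule continuous_on_subset) simp
  qed (simp add: eq)
qed

definition lin :: "complex \<Rightarrow> complex \<Rightarrow> sinf" where
  "lin a b = mk (\<lambda>z. a + b * z)"

lemma lin:
  shows fn_lin: "\<And>z. z \<in> ball 0 1 \<Longrightarrow> fn (lin a b) z = a + b * z"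
    and dv_lin: "\<And>z. z \<in> ball 0 1 \<Longrightarrow> dv (lin a b) z = b"
    and ev_lin: "\<And>z. z \<in> cball 0 1 \<Longrightarrow> ev (lin a b) z = a + b * z"
proof -
  have h: "(\<lambda>z. a + b * z) holomorphic_on UNIV" by (intro holomorphic_intros)
  have "deriv (\<lambda>z. a + b * z) z = b" for z
    by (rule DERIV_imp_deriv) (auto intro!: derivative_eq_intros)
  then show "z \<in> ball 0 1 \<Longrightarrow> dv (lin a b) z = b" for z
    unfolding lin_def by (simp only: dv_mk[OF h])
  show "z \<in> ball 0 1 \<Longrightarrow> fn (lin a b) z = a + b * z" for z
    unfolding lin_def by (rule fn_mk[OF h])
  show "z \<in> cball 0 1 \<Longrightarrow> ev (lin a b) z = a + b * z" for z
    unfolding lin_def by (rule ev_mk[OF h])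
qed

lemma lin_simps:
  "lin a b + lin a' b' = lin (a + a') (b + b')" "lin a b - lin a' b' = lin (a - a') (b - b')"
  "r *\<^sub>R lin a b = lin (of_real r * a) (of_real r * b)" "cmul c (lin a b) = lin (c * a) (c * b)"
  "lin 0 0 = 0"
  by (rule sinf_eqI; simp add: fn_lin algebra_simps)+

lemma lin_inject [simp]: "lin a b = lin a' b' \<longleftrightarrow> a = a' \<and> b = b'"
  using fn_lin[of 0 a b] fn_lin[of 0 a' b'] dv_lin[of 0 a b] dv_lin[of 0 a' b'] by auto

lemma lin_eq_0 [simp]: "lin a b = 0 \<longleftrightarrow> a = 0 \<and> b = 0"
  using lin_inject[of a b 0 0] by (simp add: lin_simps)

lemma dn_lin [simp]: "dn (lin a b) = cmod b"
  unfolding dn_def by (simp add: dv_lin)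

lemma sn_lin_const [simp]: "sn (lin a 0) = cmod a"
  unfolding sn_def by (simp add: fn_lin)

lemma lin_if_dv_const:
  assumes "\<And>z. z \<in> ball 0 1 \<Longrightarrow> dv f z = b"
  shows "f = lin (fn f 0) b"
proof (rule sinf_eqI)
  fix z :: complex assume z: "z \<in> ball 0 1"
  have "\<exists>c. \<forall>z\<in>ball 0 1. fn f z - b * z = c"
  proof (rule has_field_derivative_zero_constant)
    fix z :: complex assume z: "z \<in> ball 0 1"
    have "((\<lambda>z. fn f z - b * z) has_field_derivative dv f z - b * 1) (at z)"
      by (intro DERIV_diff DERIV_cmult DERIV_ident has_dv z)
    then have "((\<lambda>z. fn f z - b * z) has_field_derivative 0) (at z)"
      using assms[OF z] by simp
    then show "((\<lambda>z. fn f z - b * z) has_field_derivative 0) (at z within ball 0 1)"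
      by (rule has_field_derivative_at_within)
  qed simp
  then have "fn f z - b * z = fn f 0 - b * 0" using z by (metis centre_in_ball zero_less_one)
  then show "fn f z = fn (lin (fn f 0) b) z" using z by (simp add: fn_lin algebra_simps)
qed

section \<open>Isometries and perturbed suprema\<close>

text \<open>Vaisala's proof of the Mazur--Ulam theorem: an isometry that fixes two points fixes their
  midpoint, because composing it with the reflection in the midpoint would double its displacement.\<close>

lemma midpoint_fixed_by_isometry:
  fixes g0 :: "'a::real_normed_vector \<Rightarrow> 'a"
  assumes "bij g0" "\<And>x y. norm (g0 x - g0 y) = norm (x - y)" "g0 a = a" "g0 b = b"
  shows "g0 ((1/2) *\<^sub>R (a + b)) = (1/2) *\<^sub>R (a + b)"
proof -
  define z where "z = (1/2) *\<^sub>R (a + b)"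
  define W where "W = {g :: 'a \<Rightarrow> 'a. bij g \<and> (\<forall>x y. norm (g x - g y) = norm (x - y)) \<and> g a = a \<and> g b = b}"
  define \<psi> where "\<psi> x = 2 *\<^sub>R z - x" for x :: 'a
  have \<psi>: "\<psi> (\<psi> x) = x" "norm (\<psi> x - \<psi> y) = norm (x - y)" "\<psi> z = z" for x y
    by (simp_all add: \<psi>_def norm_minus_commute scaleR_2)
  have \<psi>ab: "\<psi> a = b" "\<psi> b = a" by (simp_all add: \<psi>_def z_def)
  have "bij \<psi>" using \<psi>(1) by (metis bijI')
  have bdd: "norm (g z - z) \<le> 2 * norm (a - z)" if "g \<in> W" for g
  proof -
    have g: "g a = a" "norm (g z - g a) = norm (z - a)" using that unfolding W_def by blast+
    have "norm (g z - z) \<le> norm (g z - g a) + norm (a - z)"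
      using norm_triangle_ineq[of "g z - a" "a - z"] by (simp add: g(1))
    then show ?thesis using g(2) by (simp add: norm_minus_commute)
  qed
  then have bdd': "bdd_above ((\<lambda>g. norm (g z - z)) ` W)" by (intro bdd_aboveI2)
  define l where "l = (SUP g\<in>W. norm (g z - z))"
  have "norm (g z - z) \<le> l / 2" if g: "g \<in> W" for g
  proof -
    define h where "h = inv g"
    have "bij g" using g by (simp add: W_def)
    then have h: "bij h" "\<And>x. g (h x) = x" "\<And>x. h (g x) = x"
      by (simp_all add: h_def bij_imp_bij_inv bij_is_surj surj_f_inv_f bij_is_inj)
    have hn: "norm (h x - h y) = norm (x - y)" for x y
      using g h(2) by (metis (mono_tags, lifting) W_def mem_Collect_eq)
    have hab: "h a = a" "h b = b" using g h(3) by (simp_all add: W_def) metis+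
    \<comment> \<open>Two reflections are used because \<open>\<psi>\<close> swaps \<open>a\<close>
      and \<open>b\<close>: only then does \<open>k\<close> fix both points and lie in
      \<open>W\<close> again.\<close>
    define k where "k = \<psi> \<circ> h \<circ> \<psi> \<circ> g"
    have "k \<in> W"
      using g hn hab \<psi> \<psi>ab \<open>bij \<psi>\<close> h(1) \<open>bij g\<close> by (auto simp: W_def k_def intro!: bij_comp)
    then have "norm (k z - z) \<le> l" unfolding l_def by (rule cSUP_upper[OF _ bdd'])
    moreover have "norm (k z - z) = norm (h (\<psi> (g z)) - z)"
      using \<psi>(2)[of "h (\<psi> (g z))" z] \<psi>(3) by (simp add: k_def)
    moreover have "\<dots> = norm (\<psi> (g z) - g z)"
      using hn[of "\<psi> (g z)" "g z"] h(3) by simp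
    moreover have "\<psi> (g z) - g z = 2 *\<^sub>R (z - g z)" by (simp add: \<psi>_def scaleR_2 algebra_simps)
    ultimately show ?thesis by (simp add: norm_minus_commute)
  qed
  moreover have "g0 \<in> W" using assms by (simp add: W_def)
  ultimately have "l \<le> l / 2" unfolding l_def by (intro cSUP_least) auto
  moreover have "norm (g0 z - z) \<le> l" unfolding l_def by (rule cSUP_upper[OF \<open>g0 \<in> W\<close> bdd'])
  ultimately have "norm (g0 z - z) \<le> 0" by linarith
  then show ?thesis by (simp add: z_def)
qed

text \<open>The map \<open>h\<close>, built from \<open>T\<close> and the reflections in the
  midpoints \<open>z\<close> and \<open>w\<close>, is an isometry fixing \<open>a\<close> and
  \<open>b\<close>; it fixes \<open>z\<close> exactly when \<open>T z = w\<close>. Preservation of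
  midpoints gives additivity and rational homogeneity, and an isometry is continuous enough to pass
  to real scalars.\<close>

theorem mazur_ulam:
  fixes T :: "'a::real_normed_vector \<Rightarrow> 'a"
  assumes "bij T" and iso: "\<And>x y. norm (T x - T y) = norm (x - y)" and "T 0 = 0"
  shows "linear T"
proof -
  have mid: "T ((1/2) *\<^sub>R (a + b)) = (1/2) *\<^sub>R (T a + T b)" for a b
  proof -
    define z where "z = (1/2) *\<^sub>R (a + b)"
    define w where "w = (1/2) *\<^sub>R (T a + T b)"
    define h where "h = (\<lambda>x. 2 *\<^sub>R z - x) \<circ> inv T \<circ> (\<lambda>x. 2 *\<^sub>R w - x) \<circ> T"
    have i: "T (inv T x) = x" "inv T (T x) = x" for x
      using \<open>bij T\<close> by (simp_all add: bij_is_surj surj_f_inv_f bij_is_inj)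
    have refl: "bij (\<lambda>x. c - x)" for c :: 'a
      by (rule bijI[OF injI surjI[where f = "\<lambda>x. c - x"]]) auto
    have "h z = z" unfolding z_def
    proof (rule midpoint_fixed_by_isometry)
      show "bij h" unfolding h_def by (intro bij_comp refl bij_imp_bij_inv \<open>bij T\<close>)
      have inv: "norm (inv T x - inv T y) = norm (x - y)" for x y
        using iso[of "inv T x" "inv T y"] by (simp add: i)
      show "norm (h x - h y) = norm (x - y)" for x y
        using iso[of x y] inv[of "2 *\<^sub>R w - T x" "2 *\<^sub>R w - T y"]
        by (simp add: h_def norm_minus_commute)
      show "h a = a" "h b = b" by (simp_all add: h_def w_def z_def i)
    qed
    then have "inv T (2 *\<^sub>R w - T z) = z" by (simp add: h_def scaleR_2 algebra_simps)
    then have "2 *\<^sub>R w - T z = T z" using i by metis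
    then have "2 *\<^sub>R (T z) = 2 *\<^sub>R w" by (simp add: scaleR_2 algebra_simps)
    then have "T z = w" by simp
    then show ?thesis by (simp add: z_def w_def)
  qed
  have half: "T ((1/2) *\<^sub>R a) = (1/2) *\<^sub>R T a" for a using mid[of a 0] \<open>T 0 = 0\<close> by simp
  have add: "T (a + b) = T a + T b" for a b
    using mid[of a b] half[of "a + b"] by simp
  have neg: "T (- a) = - T a" for a
    using add[of a "- a"] \<open>T 0 = 0\<close> by (simp add: eq_neg_iff_add_eq_0 add.commute)
  have nat: "T (real n *\<^sub>R x) = real n *\<^sub>R T x" for n x
    by (induction n) (simp_all add: \<open>T 0 = 0\<close> add scaleR_left_distrib)
  have int: "T (of_int k *\<^sub>R x) = of_int k *\<^sub>R T x" for k x
    using nat neg by (cases k rule: int_cases2) (simp_all add: neg)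
  have rat: "T (q *\<^sub>R x) = q *\<^sub>R T x" if Q: "q \<in> \<rat>" for q x
  proof -
    obtain m n where q: "q = of_int m / of_int n" "n \<noteq> 0"
      using Rats_cases'[OF Q] by (metis less_irrefl)
    have "of_int n *\<^sub>R T (q *\<^sub>R x) = of_int m *\<^sub>R T x"
      using int[of n "q *\<^sub>R x"] int[of m x] q by simp
    then have "(inverse (of_int n) * of_int n) *\<^sub>R T (q *\<^sub>R x) = (inverse (of_int n) * of_int m) *\<^sub>R T x"
      by (simp only: scaleR_scaleR[symmetric])
    then show ?thesis using q(2) by (simp add: q(1) divide_inverse mult.commute)
  qed
  have real: "T (r *\<^sub>R x) = r *\<^sub>R T x" for r x
  proof -
    have "T (r *\<^sub>R x) - r *\<^sub>R T x = 0"
    proof (rule ccontr)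
      assume ne: "\<not> ?thesis"
      define e where "e = norm (T (r *\<^sub>R x) - r *\<^sub>R T x)"
      have "e > 0" using ne by (simp add: e_def)
      have x: "norm x > 0" using ne \<open>T 0 = 0\<close> by (cases "x = 0") auto
      obtain q where q: "q \<in> \<rat>" "r < q" "q < r + e / (2 * norm x)"
        using Rats_dense_in_real[of r "r + e / (2 * norm x)"] \<open>e > 0\<close> x by auto
      have "e \<le> norm (T (r *\<^sub>R x) - T (q *\<^sub>R x)) + norm (q *\<^sub>R T x - r *\<^sub>R T x)"
        unfolding e_def rat[OF q(1)]
        using norm_triangle_ineq[of "T (r *\<^sub>R x) - q *\<^sub>R T x" "q *\<^sub>R T x - r *\<^sub>R T x"] by simp
      also have "\<dots> = \<bar>r - q\<bar> * norm x + \<bar>q - r\<bar> * norm (T x)"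
        unfolding iso by (simp only: scaleR_left_diff_distrib[symmetric] norm_scaleR)
      also have "norm (T x) = norm x" using iso[of x 0] \<open>T 0 = 0\<close> by simp
      also have "\<bar>r - q\<bar> * norm x + \<bar>q - r\<bar> * norm x < e"
        using q x by (simp add: field_simps)
      finally show False by simp
    qed
    then show ?thesis by simp
  qed
  show ?thesis by (rule linearI) (simp_all add: add real)
qed

text \<open>For large \<open>n\<close> only points close to the maximum set \<open>A\<close> of
  \<open>u\<close> can compete, so after subtracting \<open>n M\<close> the supremum sees
  \<open>v\<close> on \<open>A\<close> alone.\<close>

lemma perturbed_sup_limit:
  fixes u v :: "'a::t2_space \<Rightarrow> real"
  assumes X: "compact X" and u: "continuous_on X u" and v: "continuous_on X v"
    and M: "\<And>x. x \<in> X \<Longrightarrow> u x \<le> M" and A: "A = {x\<in>X. u x = M}" "A \<noteq> {}"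
  shows "(\<lambda>n. (SUP x\<in>X. v x + real n * u x) - real n * M) \<longlonglongrightarrow> (SUP x\<in>A. v x)"
proof (rule LIMSEQ_I)
  fix e :: real assume "e > 0"
  define S where "S = (SUP x\<in>A. v x)"
  have bdd: "bdd_above (f ` X)" if "continuous_on X f" for f :: "'a \<Rightarrow> real"
    using that X by (simp add: compact_continuous_image compact_imp_bounded bounded_imp_bdd_above)
  have vS: "v x \<le> S" if "x \<in> A" for x
    unfolding S_def using that bdd[OF v] by (intro cSUP_upper bdd_above_mono[OF bdd[OF v]]) (auto simp: A)
  have bddn: "bdd_above ((\<lambda>x. v x + real n * u x) ` X)" for n
    by (rule bdd) (intro continuous_intros u v)
  have lower: "S \<le> (SUP x\<in>X. v x + real n * u x) - real n * M" for n
    unfolding S_def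
  proof (rule cSUP_least[OF A(2)])
    fix x assume "x \<in> A"
    then show "v x \<le> (SUP x\<in>X. v x + real n * u x) - real n * M"
      using cSUP_upper[OF _ bddn, of x n] by (simp add: A)
  qed
  \<comment> \<open>This compact set misses \<open>A\<close>, hence \<open>u\<close> stays below
    \<open>M\<close> on it by a fixed \<open>\<delta>\<close>; once \<open>n \<delta>\<close>
    reaches \<open>C - S\<close>, its points can no longer exceed \<open>S\<close>.\<close>
  define Y where "Y = {x\<in>X. S + e / 2 \<le> v x}"
  have "compact Y"
  proof -
    have "Y = X \<inter> v -` {S + e / 2..}" by (auto simp: Y_def)
    moreover have "closedin (top_of_set X) (X \<inter> v -` {S + e / 2..})"
      by (rule continuous_closedin_preimage[OF v]) simp
    ultimately show ?thesis using closedin_compact[OF X] by metis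
  qed
  obtain \<delta> where \<delta>: "\<delta> > 0" "\<And>x. x \<in> Y \<Longrightarrow> u x \<le> M - \<delta>"
  proof (cases "Y = {}")
    case False
    have "continuous_on Y u" by (rule continuous_on_subset[OF u]) (auto simp: Y_def)
    then obtain y where y: "y \<in> Y" "\<And>x. x \<in> Y \<Longrightarrow> u x \<le> u y"
      using continuous_attains_sup[OF \<open>compact Y\<close> False] by blast
    have "u y \<noteq> M" using y(1) vS[of y] \<open>e > 0\<close> by (auto simp: Y_def A)
    then have "u y < M" using M[of y] y(1) by (auto simp: Y_def)
    then show thesis using y(2) that[of "M - u y"] by auto
  qed (use that[of 1] in auto)
  obtain C where C: "\<And>x. x \<in> X \<Longrightarrow> v x \<le> C"
    using bdd[OF v] by (auto simp: bdd_above_def)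
  obtain N :: nat where N: "C - S \<le> real N * \<delta>"
    using reals_Archimedean3[OF \<delta>(1)] less_imp_le by blast
  have "norm ((SUP x\<in>X. v x + real n * u x) - real n * M - (SUP x\<in>A. v x)) < e" if "n \<ge> N" for n
  proof -
    have "(SUP x\<in>X. v x + real n * u x) \<le> S + e / 2 + real n * M"
    proof (rule cSUP_least)
      show "X \<noteq> {}" using A by auto
      fix x assume x: "x \<in> X"
      show "v x + real n * u x \<le> S + e / 2 + real n * M"
      proof (cases "x \<in> Y")
        case True
        have "real n * u x \<le> real n * (M - \<delta>)" using \<delta>(2)[OF True] by (simp add: mult_left_mono)
        moreover have "C - S \<le> real n * \<delta>"
          using N that \<delta>(1) by (meson less_eq_real_def mult_right_mono of_nat_mono order_trans)
        ultimately show ?thesis using C[OF x] \<open>e > 0\<close> by (simp add: algebra_simps)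
      next
        case False
        have "real n * u x \<le> real n * M" using M[OF x] by (simp add: mult_left_mono)
        then show ?thesis using False x by (simp add: Y_def)
      qed
    qed
    then show ?thesis using lower[of n] \<open>e > 0\<close> by (simp add: S_def[symmetric])
  qed
  then show "\<exists>no. \<forall>n\<ge>no. norm ((SUP x\<in>X. v x + real n * u x) - real n * M - (SUP x\<in>A. v x)) < e"
    by blast
qed

text \<open>Distances to \<open>0\<close> and \<open>1\<close> determine the real part and the
  absolute value of the imaginary part. After the rotation by \<open>cnj c\<close> the only
  remaining choice is the sign in the image of \<open>\<i>\<close>, and distances to
  \<open>\<i>\<close> carry it over to every point.\<close>

lemma plane_isometry:
  fixes \<phi> :: "complex \<Rightarrow> complex"
  assumes iso: "\<And>a b. cmod (\<phi> a - \<phi> b) = cmod (a - b)" and 0: "\<phi> 0 = 0"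
  obtains c where "cmod c = 1" "\<And>a. \<phi> a = c * a" | c where "cmod c = 1" "\<And>a. \<phi> a = c * cnj a"
proof -
  define c where "c = \<phi> 1"
  define \<psi> where "\<psi> a = cnj c * \<phi> a" for a
  have c: "cmod c = 1" using iso[of 1 0] 0 by (simp add: c_def)
  then have cc: "c * cnj c = 1" by (simp add: complex_norm_square[symmetric])
  have \<phi>: "\<phi> a = c * \<psi> a" for a using cc by (simp add: \<psi>_def mult.assoc[symmetric])
  have \<psi>: "cmod (\<psi> a - \<psi> b) = cmod (a - b)" for a b
    unfolding \<psi>_def right_diff_distrib[symmetric] norm_mult using iso c by simp
  have \<psi>1: "\<psi> 1 = 1" "\<psi> 0 = 0" using cc 0 by (simp_all add: \<psi>_def c_def mult.commute)
  have sq: "(Re w)\<^sup>2 + (Im w)\<^sup>2 = (Re z)\<^sup>2 + (Im z)\<^sup>2" if "cmod w = cmod z" for w z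
    using that by (simp add: cmod_power2[symmetric])
  have re: "Re (\<psi> a) = Re a" for a
    using sq[OF \<psi>[of a 0]] sq[OF \<psi>[of a 1]] by (simp add: \<psi>1 power2_diff)
  have im2: "(Im (\<psi> a))\<^sup>2 = (Im a)\<^sup>2" for a
    using sq[OF \<psi>[of a 0]] by (simp add: \<psi>1 re)
  have "Im (\<psi> \<i>) = 1 \<or> Im (\<psi> \<i>) = -1" using im2[of \<i>] by (simp add: power2_eq_1_iff)
  then consider "\<psi> \<i> = \<i>" | "\<psi> \<i> = - \<i>" using re[of \<i>] by (auto simp: complex_eq_iff)
  then show thesis
  proof cases
    case 1
    have "\<psi> a = a" for a
      using sq[OF \<psi>[of a \<i>]] 1 re[of a] im2[of a] by (simp add: complex_eq_iff power2_diff)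
    then show thesis using that(1)[OF c] \<phi> by simp
  next
    case 2
    have "\<psi> a = cnj a" for a
      using sq[OF \<psi>[of a \<i>]] 2 re[of a] im2[of a] by (simp add: complex_eq_iff power2_diff power2_sum)
    then show thesis using that(2)[OF c] \<phi> by simp
  qed
qed

section \<open>Boundary regularity of functions of constant boundary modulus\<close>

lemma exp_i_ball: "0 < Im w \<Longrightarrow> exp (\<i> * w) \<in> ball 0 1"
  by (simp add: norm_exp_eq_Re)

lemma sphere_cis:
  assumes "x \<in> sphere 0 1"
  obtains t where "x = cis t"
  using assms rcis_cmod_Arg[of x] by (simp add: rcis_def) metis

text \<open>The coordinate \<open>w\<close> with \<open>z = exp (\<i> * w)\<close> turns the circle
  into the real line. Constant modulus makes \<open>- \<i> * Ln (F w / c)\<close> real there, so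
  Schwarz reflection continues it across, and \<open>e\<close> is its derivative, that is, the
  logarithmic derivative \<open>z f' / f\<close>.\<close>

lemma log_derivative_reflection:
  assumes "r > 0" and r: "\<And>x. x \<in> sphere 0 1 \<Longrightarrow> cmod (ev f x) = r"
  obtains \<epsilon> e where "\<epsilon> > 0" "e holomorphic_on ball (complex_of_real t) \<epsilon>"
    "\<And>w. w \<in> ball (complex_of_real t) \<epsilon> \<Longrightarrow> 0 < Im w \<Longrightarrow>
       dv f (exp (\<i> * w)) * exp (\<i> * w) = e w * fn f (exp (\<i> * w))"
    "\<And>s. complex_of_real s \<in> ball (complex_of_real t) \<epsilon> \<Longrightarrow> e (complex_of_real s) \<in> \<real>"
proof -
  define F where "F w = ev f (exp (\<i> * w))" for w
  define c where "c = F (complex_of_real t)"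
  have Fr: "cmod (F (complex_of_real s)) = r" for s
    unfolding F_def by (rule r) (simp add: norm_exp_eq_Re)
  then have "c \<noteq> 0" using \<open>r > 0\<close> unfolding c_def by (metis less_irrefl norm_zero)
  have contF: "continuous_on {w. 0 \<le> Im w} F"
    unfolding F_def
    by (rule continuous_on_compose2[OF ev_continuous]) (auto intro!: continuous_intros simp: norm_exp_eq_Re)
  \<comment> \<open>Within this radius \<open>F w / c\<close> has distance less than 1 from 1; it
    stays in the right half plane, away from the branch cut of \<open>Ln\<close>.\<close>
  then obtain \<epsilon> where \<epsilon>: "\<epsilon> > 0"
    "\<And>w. 0 \<le> Im w \<Longrightarrow> dist w (complex_of_real t) < \<epsilon> \<Longrightarrow> dist (F w) c < cmod c"
    unfolding continuous_on_iff c_def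
    using \<open>c \<noteq> 0\<close> c_def by (metis Im_complex_of_real mem_Collect_eq order_refl zero_less_norm_iff)
  define B where "B = ball (complex_of_real t) \<epsilon>"
  have re: "Re (F w / c) > 0" if "w \<in> B" "0 \<le> Im w" for w
  proof -
    have "F w / c - 1 = (F w - c) / c" using \<open>c \<noteq> 0\<close> by (simp add: diff_divide_distrib)
    moreover have "cmod (F w - c) < cmod c"
      using \<epsilon>(2)[of w] that by (simp add: B_def dist_norm norm_minus_commute[of w])
    ultimately have "cmod (F w / c - 1) < 1"
      using \<open>c \<noteq> 0\<close> by (simp only: norm_divide) (simp add: divide_less_eq)
    moreover have "\<bar>Re (F w / c - 1)\<bar> \<le> cmod (F w / c - 1)" by (rule abs_Re_le_cmod)
    ultimately show ?thesis by simp
  qed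
  then have nonpos: "F w / c \<notin> \<real>\<^sub>\<le>\<^sub>0" if "w \<in> B" "0 \<le> Im w" for w
    using that complex_nonpos_Reals_iff by force
  define u where "u w = - \<i> * Ln (F w / c)" for w
  have derF: "(F has_field_derivative dv f (exp (\<i> * w)) * (\<i> * exp (\<i> * w))) (at w)" if "0 < Im w" for w
  proof -
    have "((\<lambda>w. fn f (exp (\<i> * w))) has_field_derivative dv f (exp (\<i> * w)) * (exp (\<i> * w) * \<i>)) (at w)"
    proof (rule DERIV_chain2[where f = "fn f" and g = "\<lambda>w. exp (\<i> * w)"])
      show "(fn f has_field_derivative dv f (exp (\<i> * w))) (at (exp (\<i> * w)))"
        by (rule has_dv[OF exp_i_ball[OF that]])
      show "((\<lambda>w. exp (\<i> * w)) has_field_derivative exp (\<i> * w) * \<i>) (at w)"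
        by (auto intro!: derivative_eq_intros)
    qed
    then have "((\<lambda>w. fn f (exp (\<i> * w))) has_field_derivative dv f (exp (\<i> * w)) * (\<i> * exp (\<i> * w))) (at w)"
      by (simp add: mult_ac)
    then show ?thesis
    proof (rule has_field_derivative_transform_within_open)
      show "open {w. 0 < Im w}" by (rule open_halfspace_Im_gt)
      show "fn f (exp (\<i> * w)) = F w" if "w \<in> {w. 0 < Im w}" for w
        using that exp_i_ball[of w] by (simp only: F_def ev_ball mem_Collect_eq)
    qed (use that in simp)
  qed
  have deru: "(u has_field_derivative dv f (exp (\<i> * w)) * exp (\<i> * w) / F w) (at w)"
    if "w \<in> B" "0 < Im w" for w
  proof -
    have "F w \<noteq> 0" using re[of w] that by auto
    have "((\<lambda>w. Ln (F w / c)) has_field_derivative inverse (F w / c) * (dv f (exp (\<i> * w)) * (\<i> * exp (\<i> * w)) / c)) (at w)"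
    proof (rule DERIV_chain2[where f = Ln and g = "\<lambda>w. F w / c"])
      show "(Ln has_field_derivative inverse (F w / c)) (at (F w / c))"
        using nonpos[of w] that by (intro has_field_derivative_Ln) simp
      show "((\<lambda>w. F w / c) has_field_derivative dv f (exp (\<i> * w)) * (\<i> * exp (\<i> * w)) / c) (at w)"
        by (intro DERIV_cdivide derF that)
    qed
    then have "(u has_field_derivative - \<i> * (inverse (F w / c) * (dv f (exp (\<i> * w)) * (\<i> * exp (\<i> * w)) / c))) (at w)"
      unfolding u_def by (rule DERIV_cmult)
    moreover have "- \<i> * (inverse (F w / c) * (dv f (exp (\<i> * w)) * (\<i> * exp (\<i> * w)) / c))
      = dv f (exp (\<i> * w)) * exp (\<i> * w) / F w"
      using \<open>F w \<noteq> 0\<close> \<open>c \<noteq> 0\<close> by (simp add: field_simps)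
    ultimately show ?thesis by simp
  qed
  have ureal: "u z \<in> \<real>" if "z \<in> B" "z \<in> \<real>" for z
  proof -
    obtain s where s: "z = complex_of_real s" using \<open>z \<in> \<real>\<close> by (auto elim: Reals_cases)
    have "cmod (F z / c) = 1" using Fr[of s] Fr[of t] \<open>r > 0\<close> by (simp add: s c_def norm_divide)
    moreover have "F z / c \<noteq> 0" using calculation by auto
    ultimately have "Re (Ln (F z / c)) = 0" by simp
    then show ?thesis by (simp add: u_def complex_is_Real_iff)
  qed
  define U where "U = (\<lambda>z. if 0 \<le> Im z then u z else cnj (u (cnj z)))"
  have holU: "U holomorphic_on B"
    unfolding U_def
  proof (rule Schwarz_reflection)
    show "open B" by (simp add: B_def)
    have "dist (cnj z) (complex_of_real t) = dist z (complex_of_real t)" for z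
      using complex_mod_cnj[of "z - complex_of_real t"] by (simp add: dist_norm del: complex_mod_cnj)
    then show "cnj ` B \<subseteq> B" by (auto simp: B_def dist_commute)
    show "u holomorphic_on B \<inter> {z. 0 < Im z}"
    proof (rule holomorphic_onI)
      fix z assume "z \<in> B \<inter> {z. 0 < Im z}"
      then have "u field_differentiable at z"
        using deru[of z] unfolding field_differentiable_def by blast
      then show "u field_differentiable at z within B \<inter> {z. 0 < Im z}"
        by (rule field_differentiable_at_within)
    qed
    show "continuous_on (B \<inter> {z. 0 \<le> Im z}) u"
    proof -
      have "continuous_on (B \<inter> {z. 0 \<le> Im z}) F" by (rule continuous_on_subset[OF contF]) auto
      then have "continuous_on (B \<inter> {z. 0 \<le> Im z}) (\<lambda>z. F z / c)"
        by (intro continuous_on_divide continuous_on_const) (simp_all add: \<open>c \<noteq> 0\<close>)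
      then have "continuous_on (B \<inter> {z. 0 \<le> Im z}) (\<lambda>z. Ln (F z / c))"
        using nonpos by (intro continuous_on_Ln') auto
      then show ?thesis
        unfolding u_def by (intro continuous_on_mult continuous_on_const)
    qed
  qed (rule ureal)
  have "deriv U holomorphic_on B" using holU by (simp add: B_def holomorphic_deriv)
  moreover have "dv f (exp (\<i> * w)) * exp (\<i> * w) = deriv U w * fn f (exp (\<i> * w))"
    if "w \<in> B" "0 < Im w" for w
  proof -
    have "(U has_field_derivative dv f (exp (\<i> * w)) * exp (\<i> * w) / F w) (at w)"
      by (rule has_field_derivative_transform_within_open[OF deru open_halfspace_Im_gt[of 0]])
        (use that in \<open>auto simp: U_def\<close>)
    then have "deriv U w = dv f (exp (\<i> * w)) * exp (\<i> * w) / F w" by (rule DERIV_imp_deriv)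
    moreover have "F w \<noteq> 0" using re[of w] that by auto
    moreover have "F w = fn f (exp (\<i> * w))" using exp_i_ball[OF that(2)] by (simp only: F_def ev_ball)
    ultimately show ?thesis by simp
  qed
  moreover have "deriv U (complex_of_real s) \<in> \<real>" if s: "complex_of_real s \<in> B" for s
  proof -
    \<comment> \<open>\<open>U\<close> commutes with conjugation, so its derivative at a real point
      equals its own conjugate.\<close>
    have d: "(U has_field_derivative deriv U (complex_of_real s)) (at (cnj (complex_of_real s)))"
      using holomorphic_derivI[OF holU _ s] by (simp add: B_def)
    have "(U has_field_derivative cnj (deriv U (complex_of_real s))) (at (complex_of_real s))"
    proof (rule has_field_derivative_transform_within_open[OF has_field_derivative_cnj_cnj[OF d]])
      show "open B" by (simp add: B_def)
      show "(cnj \<circ> U \<circ> cnj) w = U w" if "w \<in> B" for w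
      proof (cases "Im w = 0")
        case True
        then have w: "cnj w = w" "w \<in> \<real>" by (simp_all add: complex_eq_iff complex_is_Real_iff)
        then show ?thesis using ureal[OF that w(2)] True by (simp add: U_def Reals_cnj_iff)
      qed (auto simp: U_def)
    qed (rule s)
    then have "cnj (deriv U (complex_of_real s)) = deriv U (complex_of_real s)"
      using d by (metis DERIV_unique complex_cnj_complex_of_real)
    then show ?thesis by (simp add: Reals_cnj_iff)
  qed
  ultimately show thesis using that[OF \<epsilon>(1), of "deriv U"] by (simp add: B_def)
qed

text \<open>A distance estimate that holds for the values inside near \<open>x\<close> passes to the
  limits at all neighbouring boundary points. Thus limits at the single points already give joint
  continuity.\<close>

lemma continuous_on_cball_boundary_limits:
  fixes g :: "complex \<Rightarrow> complex"
  assumes g: "continuous_on (ball 0 1) g"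
    and lim: "\<And>x. x \<in> sphere 0 1 \<Longrightarrow> \<exists>l. (g \<longlongrightarrow> l) (at x within ball 0 1)"
  shows "continuous_on (cball 0 1) (disk_ext g)"
    and "\<And>z. z \<in> ball 0 1 \<Longrightarrow> disk_ext g z = g z"
    and "\<And>x l. x \<in> sphere 0 1 \<Longrightarrow> (g \<longlongrightarrow> l) (at x within ball 0 1) \<Longrightarrow> disk_ext g x = l"
proof -
  define G where "G = disk_ext g"
  have ntriv: "at x within ball 0 1 \<noteq> bot" if "x \<in> cball (0::complex) 1" for x
    using that by (simp add: trivial_limit_within islimpt_ball)
  have "\<exists>l. (g \<longlongrightarrow> l) (at x within ball 0 1)" if "x \<in> cball 0 1" for x
    using lim[of x] g that by (cases "x \<in> ball 0 1") (auto simp: continuous_on)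
  then have limG: "(g \<longlongrightarrow> G x) (at x within ball 0 1)" if "x \<in> cball 0 1" for x
    unfolding G_def disk_ext_def using that tendsto_Lim[OF ntriv] by metis
  show *: "disk_ext g z = g z" if "z \<in> ball 0 1" for z
    unfolding disk_ext_def using that g by (intro tendsto_Lim ntriv) (auto simp: continuous_on)
  show "disk_ext g x = l" if "x \<in> sphere 0 1" "(g \<longlongrightarrow> l) (at x within ball 0 1)" for x l
    unfolding disk_ext_def using that by (intro tendsto_Lim ntriv) auto
  have "continuous (at x within cball 0 1) G" if x: "x \<in> cball 0 1" for x
    unfolding continuous_within_eps_delta
  proof (intro allI impI)
    fix e :: real assume "e > 0"
    then obtain d where d: "d > 0"
      "\<And>z. z \<in> ball 0 1 \<Longrightarrow> z \<noteq> x \<Longrightarrow> dist z x < d \<Longrightarrow> dist (g z) (G x) < e / 2"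
      using limG[OF x] unfolding Lim_within by (metis dist_nz half_gt_zero)
    have dx: "dist (g z) (G x) \<le> e / 2" if "z \<in> ball 0 1" "dist z x < d" for z
      using d(2)[OF that(1)] that \<open>e > 0\<close> *[of x] by (cases "z = x") (auto simp: G_def less_imp_le)
    have "dist (G y) (G x) < e" if y: "y \<in> cball 0 1" "dist y x < d" for y
    proof -
      have "dist (G y) (G x) \<le> e / 2"
      proof (rule tendsto_upperbound[OF tendsto_dist[OF limG[OF y(1)] tendsto_const] _ ntriv[OF y(1)]])
        have "\<forall>\<^sub>F z in at y within ball 0 1. dist z x < d"
          using y(2) by (intro order_tendstoD(2)[OF tendsto_dist[OF tendsto_ident_at tendsto_const]])
        moreover have "\<forall>\<^sub>F z in at y within ball 0 1. z \<in> ball 0 1"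
          by (simp add: eventually_at_filter)
        ultimately show "\<forall>\<^sub>F z in at y within ball 0 1. dist (g z) (G x) \<le> e / 2"
          by eventually_elim (rule dx)
      qed
      then show ?thesis using \<open>e > 0\<close> by simp
    qed
    then show "\<exists>d>0. \<forall>x'\<in>cball 0 1. dist x' x < d \<longrightarrow> dist (G x') (G x) < e" using d(1) by blast
  qed
  then show "continuous_on (cball 0 1) (disk_ext g)"
    by (simp add: continuous_on_eq_continuous_within G_def)
qed

text \<open>Boundary values of the derivative. They are meaningful only where the limit exists;
  \<open>dx_continuous\<close> provides this for constant positive boundary modulus.\<close>

definition dx :: "sinf \<Rightarrow> complex \<Rightarrow> complex" where
  "dx f = disk_ext (dv f)"

text \<open>Solving the equation for the derivative gives \<open>e (w z) * f z / z\<close>, in which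
  every factor has a limit at \<open>cis t\<close>.\<close>

lemma log_derivative_boundary_limit:
  assumes \<epsilon>: "\<epsilon> > 0" and e: "e holomorphic_on ball (complex_of_real t) \<epsilon>"
    and eq: "\<And>w. w \<in> ball (complex_of_real t) \<epsilon> \<Longrightarrow> 0 < Im w \<Longrightarrow>
       dv f (exp (\<i> * w)) * exp (\<i> * w) = e w * fn f (exp (\<i> * w))"
  shows "(dv f \<longlongrightarrow> e (complex_of_real t) * ev f (cis t) / cis t) (at (cis t) within ball 0 1)"
proof -
  \<comment> \<open>The branch of the inverse of \<open>exp (\<i> * w)\<close> that sends
    \<open>cis t\<close> to \<open>t\<close>.\<close>
  define w where "w z = complex_of_real t - \<i> * Ln (z / cis t)" for z
  have cis: "cis t \<noteq> 0" "cmod (cis t) = 1" by auto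
  have "((\<lambda>z. z / cis t) \<longlongrightarrow> cis t / cis t) (at (cis t) within ball 0 1)"
    by (intro tendsto_intros) auto
  then have "((\<lambda>z. Ln (z / cis t)) \<longlongrightarrow> Ln 1) (at (cis t) within ball 0 1)"
    by (intro tendsto_Ln) auto
  from tendsto_diff[OF tendsto_const[of "complex_of_real t"] tendsto_mult[OF tendsto_const[of "\<i>"] this]]
  have lw: "(w \<longlongrightarrow> complex_of_real t) (at (cis t) within ball 0 1)"
    by (simp add: w_def[abs_def])
  have "isCont e (complex_of_real t)"
    using holomorphic_on_imp_continuous_on[OF e] \<epsilon> by (simp add: continuous_on_eq_continuous_at)
  then have le: "((\<lambda>z. e (w z)) \<longlongrightarrow> e (complex_of_real t)) (at (cis t) within ball 0 1)"
    using lw by (rule isCont_tendsto_compose)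
  have lf: "(ev f \<longlongrightarrow> ev f (cis t)) (at (cis t) within ball 0 1)"
  proof (rule tendsto_within_subset[of _ _ _ "cball 0 1"])
    show "(ev f \<longlongrightarrow> ev f (cis t)) (at (cis t) within cball 0 1)"
      using ev_continuous[of f] unfolding continuous_on by (simp del: mem_cball add: mem_cball_0)
  qed auto
  have lim: "((\<lambda>z. e (w z) * ev f z / z) \<longlongrightarrow> e (complex_of_real t) * ev f (cis t) / cis t) (at (cis t) within ball 0 1)"
    by (intro tendsto_intros le lf cis)
  have "\<forall>\<^sub>F z in at (cis t) within ball 0 1. w z \<in> ball (complex_of_real t) \<epsilon>"
    using lw \<epsilon> by (intro topological_tendstoD) auto
  moreover have "\<forall>\<^sub>F z in at (cis t) within ball 0 1. z \<in> ball 0 1"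
    by (simp add: eventually_at_filter)
  moreover have "\<forall>\<^sub>F z in at (cis t) within ball 0 1. z \<noteq> 0"
    using cis by (intro tendsto_imp_eventually_ne[OF tendsto_ident_at]) auto
  ultimately have "\<forall>\<^sub>F z in at (cis t) within ball 0 1. e (w z) * ev f z / z = dv f z"
  proof eventually_elim
    case (elim z)
    have "exp (\<i> * w z) = exp (\<i> * complex_of_real t) * exp (Ln (z / cis t))"
      by (simp add: w_def algebra_simps exp_add[symmetric])
    also have "\<dots> = z" using elim(3) cis by (simp add: cis_conv_exp)
    finally have ew: "exp (\<i> * w z) = z" .
    have "cmod (z / cis t) = cmod z" by (simp add: norm_divide)
    then have "Im (w z) = - ln (cmod z)" using elim(3) by (simp add: w_def)
    then have "Im (w z) > 0" using elim(2,3) by simp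
    from eq[OF elim(1) this] show ?case
      using elim(2,3) unfolding ew by (simp only: ev_ball) (simp add: field_simps)
  qed
  then show ?thesis using lim by (rule Lim_transform_eventually[rotated])
qed

text \<open>Reflection works near each point of the circle separately, which suffices for a
  continuous extension of the derivative. The last part keeps the local function \<open>e\<close>,
  because it is real on the real line and the identity theorem will be applied to it.\<close>

lemma unimodular_boundary:
  assumes "r > 0" "\<And>x. x \<in> sphere 0 1 \<Longrightarrow> cmod (ev f x) = r"
  shows dx_continuous: "continuous_on (cball 0 1) (dx f)"
    and dx_ball: "\<And>z. z \<in> ball 0 1 \<Longrightarrow> dx f z = dv f z"
    and dx_log_derivative: "\<exists>\<epsilon>>0. \<exists>e. e holomorphic_on ball (complex_of_real t) \<epsilon> \<and>
      (\<forall>w\<in>ball (complex_of_real t) \<epsilon>. 0 < Im w \<longrightarrow>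
         dv f (exp (\<i> * w)) * exp (\<i> * w) = e w * fn f (exp (\<i> * w))) \<and>
      (\<forall>s. complex_of_real s \<in> ball (complex_of_real t) \<epsilon> \<longrightarrow>
         e (complex_of_real s) \<in> \<real> \<and> dx f (cis s) * cis s = e (complex_of_real s) * ev f (cis s))"
proof -
  have lim: "\<exists>l. (dv f \<longlongrightarrow> l) (at x within ball 0 1)" if "x \<in> sphere 0 1" for x
  proof -
    obtain t where t: "x = cis t" using sphere_cis[OF \<open>x \<in> sphere 0 1\<close>] .
    show ?thesis
      using log_derivative_reflection[OF assms, of t] log_derivative_boundary_limit unfolding t by metis
  qed
  have cont: "continuous_on (ball 0 1) (dv f)"
    by (rule holomorphic_on_imp_continuous_on[OF dv_holomorphic])
  note ext = continuous_on_cball_boundary_limits[of "dv f"]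
  show "continuous_on (cball 0 1) (dx f)"
    unfolding dx_def using cont lim by (rule ext(1))
  show "\<And>z. z \<in> ball 0 1 \<Longrightarrow> dx f z = dv f z"
    unfolding dx_def using cont lim by (rule ext(2))
  obtain \<epsilon> e where e: "\<epsilon> > 0" "e holomorphic_on ball (complex_of_real t) \<epsilon>"
    "\<And>w. w \<in> ball (complex_of_real t) \<epsilon> \<Longrightarrow> 0 < Im w \<Longrightarrow>
       dv f (exp (\<i> * w)) * exp (\<i> * w) = e w * fn f (exp (\<i> * w))"
    "\<And>s. complex_of_real s \<in> ball (complex_of_real t) \<epsilon> \<Longrightarrow> e (complex_of_real s) \<in> \<real>"
    using log_derivative_reflection[OF assms, of t] by metis
  have "dx f (cis s) * cis s = e (complex_of_real s) * ev f (cis s)"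
    if s: "complex_of_real s \<in> ball (complex_of_real t) \<epsilon>" for s
  proof -
    \<comment> \<open>The same \<open>e\<close>, restricted to a smaller disk around
      \<open>s\<close>, gives the limit at the neighbouring point \<open>cis s\<close>.\<close>
    obtain \<eta> where \<eta>: "\<eta> > 0" "ball (complex_of_real s) \<eta> \<subseteq> ball (complex_of_real t) \<epsilon>"
      using openE[OF open_ball s] by blast
    have "(dv f \<longlongrightarrow> e (complex_of_real s) * ev f (cis s) / cis s) (at (cis s) within ball 0 1)"
      by (rule log_derivative_boundary_limit[OF \<eta>(1) holomorphic_on_subset[OF e(2) \<eta>(2)]])
        (use \<eta>(2) e(3) in blast)
    moreover have "cis s \<in> sphere 0 1" by (simp only: mem_sphere_0 norm_cis)
    ultimately have "dx f (cis s) = e (complex_of_real s) * ev f (cis s) / cis s"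
      unfolding dx_def by (intro ext(3)[OF cont lim])
    then show ?thesis by simp
  qed
  then show "\<exists>\<epsilon>>0. \<exists>e. e holomorphic_on ball (complex_of_real t) \<epsilon> \<and>
      (\<forall>w\<in>ball (complex_of_real t) \<epsilon>. 0 < Im w \<longrightarrow>
         dv f (exp (\<i> * w)) * exp (\<i> * w) = e w * fn f (exp (\<i> * w))) \<and>
      (\<forall>s. complex_of_real s \<in> ball (complex_of_real t) \<epsilon> \<longrightarrow>
         e (complex_of_real s) \<in> \<real> \<and> dx f (cis s) * cis s = e (complex_of_real s) * ev f (cis s))"
    using e by blast
qed

section \<open>Isometries preserve the constants\<close>

lemma norm_lin_const [simp]: "norm (lin a 0) = cmod a"
  by (simp add: norm_sinf)

lemma dn_add_const [simp]: "dn (lin a 0 + f) = dn f"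
  unfolding dn_def by (intro SUP_cong refl) (simp add: dv_simps dv_lin)

text \<open>A constant leaves \<open>dn\<close> unchanged, so it is enough to point it in the
  direction of a value of \<open>f\<close> of maximal modulus. This is the metric trait of the
  constants that their images inherit.\<close>

lemma norm_add_const_attained:
  obtains c where "cmod c = 1" "norm (lin c 0 + f) = 1 + norm f"
proof -
  obtain x where x: "x \<in> sphere 0 1" "cmod (ev f x) = sn f" by (rule sn_attained)
  \<comment> \<open>The default 1 concerns only \<open>f = 0\<close>, where every unit constant
    works.\<close>
  define c where "c = (if ev f x = 0 then 1 else ev f x / cmod (ev f x))"
  have c: "cmod c = 1" by (simp add: c_def norm_divide)
  have "c + ev f x = c * complex_of_real (1 + sn f)"
    unfolding x(2)[symmetric] by (simp add: c_def field_simps)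
  then have "cmod (c + ev f x) = 1 + sn f"
    using sn_nonneg[of f] c by (simp add: norm_mult del: of_real_add)
  moreover have "cmod (ev (lin c 0 + f) x) \<le> sn (lin c 0 + f)"
    using x(1) by (intro ev_le_sn) simp
  ultimately have "1 + norm f \<le> norm (lin c 0 + f)"
    using x(1) by (simp add: norm_sinf ev_lin)
  moreover have "norm (lin c 0 + f) \<le> 1 + norm f"
    using norm_triangle_ineq[of "lin c 0" f] c by simp
  ultimately show thesis using that[OF c] by simp
qed

lemma norm_add_eq_split:
  assumes "norm (f + g) = norm f + norm g"
  shows "sn (f + g) = sn f + sn g" "dn (f + g) = dn f + dn g"
  using assms sn_triangle[of f g] dn_triangle[of f g] by (simp_all add: norm_sinf)

text \<open>Where \<open>f + g\<close> attains its supremum both moduli are maximal and the two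
  values are parallel. A unique peak of \<open>g\<close> tells where this happens and which phase
  \<open>f\<close> has there.\<close>

lemma aligned_at_peak:
  assumes "sn (f + g) = sn f + sn g"
    and "\<And>y. y \<in> sphere 0 1 \<Longrightarrow> cmod (ev g y) = sn g \<Longrightarrow> y = x" "ev g x = of_real (sn g) * a" "sn g > 0"
  shows "ev f x = of_real (sn f) * a"
proof -
  obtain y where y: "y \<in> sphere 0 1" "cmod (ev (f + g) y) = sn (f + g)" by (rule sn_attained)
  have yc: "y \<in> cball 0 1" using y(1) by simp
  have "cmod (ev f y + ev g y) = sn f + sn g" using y assms(1) yc by (simp del: mem_cball)
  then have *: "cmod (ev f y) = sn f" "cmod (ev g y) = sn g"
    "cmod (ev f y + ev g y) = cmod (ev f y) + cmod (ev g y)"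
    using norm_triangle_ineq[of "ev f y" "ev g y"] ev_le_sn[OF yc, of f] ev_le_sn[OF yc, of g] by linarith+
  then have "y = x" using assms(2)[OF y(1)] by simp
  moreover have "cmod (ev f y) *\<^sub>R ev g y = cmod (ev g y) *\<^sub>R ev f y"
    using *(3) by (simp only: norm_triangle_eq)
  ultimately have "sn f *\<^sub>R ev g x = sn g *\<^sub>R ev f x" using * by simp
  then show ?thesis using assms(3,4) by (simp add: scaleR_conv_of_real)
qed

text \<open>The maximum modulus principle for the derivative. The extension \<open>D\<close> is kept
  abstract since it is sometimes \<open>dx f\<close>, sometimes a polynomial and sometimes a sum of
  both.\<close>

lemma dn_extension:
  assumes "continuous_on (cball 0 1) D" "\<And>z. z \<in> ball 0 1 \<Longrightarrow> D z = dv f z"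
  shows dn_extension_le: "\<And>z. z \<in> cball 0 1 \<Longrightarrow> cmod (D z) \<le> dn f"
    and dn_extension_attained: "\<exists>x\<in>sphere 0 1. cmod (D x) = dn f"
proof -
  show le: "cmod (D z) \<le> dn f" if "z \<in> cball 0 1" for z
  proof (rule continuous_le_on_closure[of "ball 0 1" "\<lambda>z. cmod (D z)"])
    show "continuous_on (closure (ball 0 1)) (\<lambda>z. cmod (D z))"
      using continuous_on_norm[OF assms(1)] by simp
    show "z \<in> closure (ball 0 1)" using that by simp
    show "cmod (D z) \<le> dn f" if "z \<in> ball 0 1" for z
      using dn_ge[OF that, of f] by (simp only: assms(2)[OF that])
  qed
  have "continuous_on (sphere 0 1) (\<lambda>z. cmod (D z))"
    by (rule continuous_on_norm[OF continuous_on_subset[OF assms(1)]]) auto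
  then obtain x where x: "x \<in> sphere 0 1" "\<And>y. y \<in> sphere 0 1 \<Longrightarrow> cmod (D y) \<le> cmod (D x)"
    using continuous_attains_sup[of "sphere 0 1" "\<lambda>z. cmod (D z)"] by auto
  have "dn f \<le> cmod (D x)"
  proof (rule dn_le)
    fix z :: complex assume z: "z \<in> ball 0 1"
    have "D holomorphic_on ball 0 1"
      by (rule holomorphic_transform[OF dv_holomorphic[of f]]) (simp only: assms(2))
    have "cmod (D z) \<le> cmod (D x)"
      by (rule maximum_modulus_frontier[of D "cball 0 1"])
        (use \<open>D holomorphic_on ball 0 1\<close> assms(1) x z in simp_all)
    then show "cmod (dv f z) \<le> cmod (D x)" using z by (simp only: assms(2))
  qed
  then have "cmod (D x) = dn f" using le[of x] x(1) by simp
  then show "\<exists>x\<in>sphere 0 1. cmod (D x) = dn f" using x(1) by blast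
qed

text \<open>The argument of \<open>aligned_at_peak\<close>, with the extended derivatives
  \<open>D\<close> and \<open>P\<close> in place of boundary values.\<close>

lemma derivative_aligned_at_peak:
  assumes D: "continuous_on (cball 0 1) D" "\<And>z. z \<in> ball 0 1 \<Longrightarrow> D z = dv f z"
    and P: "continuous_on (cball 0 1) P" "\<And>z. z \<in> ball 0 1 \<Longrightarrow> P z = dv g z"
    and "dn (f + g) = dn f + dn g"
    and "\<And>y. y \<in> cball 0 1 \<Longrightarrow> cmod (P y) = dn g \<Longrightarrow> y = x" "P x = of_real (dn g) * a" "dn g > 0"
  shows "D x = of_real (dn f) * a"
proof -
  have "continuous_on (cball 0 1) (\<lambda>z. D z + P z)" by (intro continuous_on_add D P)
  moreover have "\<And>z. z \<in> ball 0 1 \<Longrightarrow> D z + P z = dv (f + g) z" using D(2) P(2) by (simp only: dv_simps)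
  ultimately obtain y where y: "y \<in> sphere 0 1" "cmod (D y + P y) = dn (f + g)"
    using dn_extension_attained[of "\<lambda>z. D z + P z" "f + g"] by blast
  have yc: "y \<in> cball 0 1" using y(1) by simp
  have *: "cmod (D y) = dn f" "cmod (P y) = dn g" "cmod (D y + P y) = cmod (D y) + cmod (P y)"
    using y(2) assms(5) norm_triangle_ineq[of "D y" "P y"] dn_extension_le[OF D yc] dn_extension_le[OF P yc]
    by linarith+
  then have "y = x" using assms(6)[OF yc] by simp
  moreover have "cmod (D y) *\<^sub>R P y = cmod (P y) *\<^sub>R D y"
    using *(3) by (simp only: norm_triangle_eq)
  ultimately have "dn f *\<^sub>R P x = dn g *\<^sub>R D x" using * by simp
  then show ?thesis using assms(7,8) by (simp add: scaleR_conv_of_real)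
qed

section \<open>Linear isometries and their action on the constants\<close>

definition lin_iso :: "(sinf \<Rightarrow> sinf) \<Rightarrow> bool" where
  "lin_iso L \<longleftrightarrow> linear L \<and> surj L \<and> (\<forall>f. norm (L f) = norm f)"

lemma lin_isoD:
  assumes "lin_iso L"
  shows "linear L" "surj L" "norm (L f) = norm f" "L (f + g) = L f + L g" "L (f - g) = L f - L g"
    "L (r *\<^sub>R f) = r *\<^sub>R L f" "L 0 = 0" "L (- f) = - L f" "L f = L g \<longleftrightarrow> f = g"
proof -
  show l: "linear L" and "surj L" and n: "\<And>f. norm (L f) = norm f" using assms by (auto simp: lin_iso_def)
  show "L (f + g) = L f + L g" "L (r *\<^sub>R f) = r *\<^sub>R L f" "L 0 = 0" "L (- f) = - L f"
    using l by (simp_all add: linear_add linear_scale linear_0 linear_neg)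
  show d: "L (f - g) = L f - L g" by (rule linear_diff[OF l])
  show "L f = L g \<longleftrightarrow> f = g" using n[of "f - g"] d by auto
qed

text \<open>The function \<open>peak_poly d\<close> has a unique peak at 1, while its derivative has a unique peak at
  \<open>- 1\<close>, with an arbitrary phase \<open>d\<close>. On the closed disk both bounds follow from
  \<open>u\<^sup>2 + v\<^sup>2 \<le> 1\<close> for \<open>u = \<bar>1 - z\<bar> / 2\<close> and \<open>v = \<bar>1 + z\<bar> / 2\<close>.\<close>

definition peak_poly :: "complex \<Rightarrow> sinf" where
  "peak_poly d = mk (\<lambda>z. - (d / 2) * ((1 - z) / 2) ^ 4 + (1 + z) ^ 3 / 14)"

lemma parallelogram_half:
  assumes "cmod z \<le> 1"
  shows "(cmod (1 - z) / 2)\<^sup>2 + (cmod (1 + z) / 2)\<^sup>2 \<le> 1"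
proof -
  have "(cmod (1 - z))\<^sup>2 + (cmod (1 + z))\<^sup>2 = 2 + 2 * (cmod z)\<^sup>2"
    unfolding cmod_power2 by (simp add: power2_eq_square algebra_simps)
  moreover have "(cmod z)\<^sup>2 \<le> 1" using assms by (simp add: power_le_one)
  ultimately show ?thesis by (simp add: power_divide)
qed

lemma power_le_square:
  fixes u :: real
  assumes "0 \<le> u" "u\<^sup>2 \<le> 1" "n \<ge> 2"
  shows "u ^ n \<le> u\<^sup>2"
  using assms by (intro power_decreasing) (auto simp: power2_le_iff_abs_le abs_square_le_1)

lemma peak_poly:
  assumes d: "cmod d = 1"
  shows sn_peak_poly: "sn (peak_poly d) = 4 / 7" and ev_peak_poly_1: "ev (peak_poly d) 1 = 4 / 7"
    and peak_poly_unique: "\<And>x. x \<in> sphere 0 1 \<Longrightarrow> cmod (ev (peak_poly d) x) = 4 / 7 \<Longrightarrow> x = 1"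
    and dn_peak_poly: "dn (peak_poly d) = 1"
    and dv_peak_poly: "\<And>z. z \<in> ball 0 1 \<Longrightarrow> dv (peak_poly d) z = d * ((1 - z) / 2) ^ 3 + 3 * (1 + z)\<^sup>2 / 14"
    and dv_peak_poly_unique: "\<And>z. z \<in> cball 0 1 \<Longrightarrow> cmod (d * ((1 - z) / 2) ^ 3 + 3 * (1 + z)\<^sup>2 / 14) = 1 \<Longrightarrow> z = - 1"
proof -
  let ?h = "\<lambda>z. - (d / 2) * ((1 - z) / 2) ^ 4 + (1 + z) ^ 3 / 14"
  let ?h' = "\<lambda>z. d * ((1 - z) / 2) ^ 3 + 3 * (1 + z)\<^sup>2 / 14"
  have hol: "?h holomorphic_on UNIV" by (intro holomorphic_intros) auto
  have der: "(?h has_field_derivative ?h' z) (at z)" for z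
    by (rule derivative_eq_intros refl | simp)+
  note ev = ev_mk[OF hol, folded peak_poly_def]
  define u where "u z = cmod (1 - z) / 2" for z
  define v where "v z = cmod (1 + z) / 2" for z
  have uv: "(u z)\<^sup>2 + (v z)\<^sup>2 \<le> 1" "0 \<le> u z" "0 \<le> v z" if "z \<in> cball 0 1" for z
    using parallelogram_half[of z] that by (simp_all add: u_def v_def)
  have uv2: "(u z)\<^sup>2 \<le> 1" "(v z)\<^sup>2 \<le> 1" if "z \<in> cball 0 1" for z
    using uv(1)[OF that] zero_le_power2[of "u z"] zero_le_power2[of "v z"] by linarith+
  \<comment> \<open>The coefficient 1/14 lies between 1/16 and 1/12. Above 1/16, the value
    \<open>8/14\<close> at 1 beats the \<open>1/2\<close> of the first term; below 1/12, the
    contribution \<open>12/14\<close> to the derivative stays under 1, its modulus at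
    \<open>- 1\<close>.\<close>
  have bh: "cmod (?h z) \<le> 4 / 7 - (u z)\<^sup>2 / 14" if z: "z \<in> cball 0 1" for z
  proof -
    have "cmod (?h z) \<le> u z ^ 4 / 2 + 4 / 7 * v z ^ 3"
      using norm_triangle_ineq[of "- (d / 2) * ((1 - z) / 2) ^ 4" "(1 + z) ^ 3 / 14"]
      by (simp add: norm_mult norm_power norm_divide d u_def v_def power_divide)
    also have "\<dots> \<le> (u z)\<^sup>2 / 2 + 4 / 7 * (v z)\<^sup>2"
      using power_le_square[of "u z" 4] power_le_square[of "v z" 3] uv[OF z] uv2[OF z] by simp
    finally show ?thesis using uv(1)[OF z] by simp
  qed
  have bh': "cmod (?h' z) \<le> 1 - (v z)\<^sup>2 / 7" if z: "z \<in> cball 0 1" for z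
  proof -
    have "cmod (?h' z) \<le> u z ^ 3 + 6 / 7 * (v z)\<^sup>2"
      using norm_triangle_ineq[of "d * ((1 - z) / 2) ^ 3" "3 * (1 + z)\<^sup>2 / 14"]
      by (simp add: norm_mult norm_power norm_divide d u_def v_def power_divide)
    also have "\<dots> \<le> (u z)\<^sup>2 + 6 / 7 * (v z)\<^sup>2"
      using power_le_square[of "u z" 3] uv[OF z] uv2[OF z] by simp
    finally show ?thesis using uv(1)[OF z] by simp
  qed
  show ev1: "ev (peak_poly d) 1 = 4 / 7" by (subst ev) simp_all
  show "sn (peak_poly d) = 4 / 7"
  proof (rule antisym)
    show "sn (peak_poly d) \<le> 4 / 7"
    proof (rule sn_le_sphere)
      fix x :: complex assume "x \<in> sphere 0 1"
      then have x: "x \<in> cball 0 1" by simp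
      have "cmod (?h x) \<le> 4 / 7" using bh[OF x] zero_le_power2[of "u x"] by linarith
      then show "cmod (ev (peak_poly d) x) \<le> 4 / 7" by (simp only: ev[OF x])
    qed
    show "4 / 7 \<le> sn (peak_poly d)" using ev_le_sn[of 1 "peak_poly d"] by (simp add: ev1)
  qed
  show "x = 1" if "x \<in> sphere 0 1" "cmod (ev (peak_poly d) x) = 4 / 7" for x
  proof -
    have x: "x \<in> cball 0 1" using that(1) by simp
    have "cmod (?h x) = 4 / 7" using that(2) by (simp only: ev[OF x])
    then have "(u x)\<^sup>2 \<le> 0" using bh[OF x] by linarith
    then show ?thesis by (simp add: u_def)
  qed
  show dv: "dv (peak_poly d) z = ?h' z" if "z \<in> ball 0 1" for z
    unfolding peak_poly_def dv_mk[OF hol that] by (rule DERIV_imp_deriv[OF der])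
  show "z = - 1" if "z \<in> cball 0 1" "cmod (?h' z) = 1" for z
  proof -
    have "(v z)\<^sup>2 \<le> 0" using bh'[OF that(1)] that(2) by linarith
    then have "1 + z = 0" by (simp add: v_def)
    then show ?thesis by (simp add: add_eq_0_iff)
  qed
  have cont: "continuous_on (cball 0 1) ?h'" by (intro continuous_intros) auto
  show "dn (peak_poly d) = 1"
  proof (rule antisym)
    show "dn (peak_poly d) \<le> 1"
    proof (rule dn_le)
      fix z :: complex assume z: "z \<in> ball 0 1"
      then have "z \<in> cball 0 1" by simp
      then have "cmod (?h' z) \<le> 1" using bh'[of z] zero_le_power2[of "v z"] by linarith
      then show "cmod (dv (peak_poly d) z) \<le> 1" by (simp only: dv[OF z])
    qed
    show "1 \<le> dn (peak_poly d)"
      using dn_extension_le[OF cont dv[symmetric], of "- 1"] d by simp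
  qed
qed

context
  fixes L
  assumes L: "lin_iso L"
begin

text \<open>Every \<open>g\<close> is an image, since \<open>L\<close> is onto; so
  \<open>norm_add_const_attained\<close> transfers to the images of unit constants, and equality of
  the norms splits into equality of both parts.\<close>

lemma aligned_constant:
  obtains c where "cmod c = 1" "sn (L (lin c 0) + g) = sn (L (lin c 0)) + sn g"
    "dn (L (lin c 0) + g) = dn (L (lin c 0)) + dn g"
proof -
  obtain f where g: "g = L f" using lin_isoD(2)[OF L] by (meson surjE)
  obtain c where c: "cmod c = 1" "norm (lin c 0 + f) = 1 + norm f" by (rule norm_add_const_attained)
  have "norm (L (lin c 0) + g) = norm (L (lin c 0)) + norm g"
    using c by (simp add: g lin_isoD(3)[OF L] flip: lin_isoD(4)[OF L])
  from norm_add_eq_split[OF this] show thesis using that[OF c(1)] by simp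
qed

lemma const_image_pos:
  assumes "cmod c = 1"
  shows "sn (L (lin c 0)) > 0"
proof -
  have "c \<noteq> 0" using assms by auto
  then have "L (lin c 0) \<noteq> L 0" by (simp add: lin_isoD(9)[OF L])
  then show ?thesis using sn_nonneg[of "L (lin c 0)"] sn_eq_0[of "L (lin c 0)"] lin_isoD(7)[OF L] by force
qed

text \<open>The test function \<open>a * (1 + cnj x * z)\<close> peaks on the circle only at
  \<open>x\<close>, with value \<open>2 * a\<close>. A constant whose image is aligned with it must
  have maximal modulus and phase \<open>a\<close> there.\<close>

lemma const_image_hits:
  assumes x: "x \<in> sphere 0 1" and a: "cmod a = 1"
  obtains c where "cmod c = 1" "ev (L (lin c 0)) x = of_real (sn (L (lin c 0))) * a"
proof -
  define g where "g = lin a (a * cnj x)"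
  have xc: "x \<in> cball 0 1" "cnj x * x = 1" using x by (simp_all add: complex_norm_square[symmetric] mult.commute)
  have evg: "cmod (ev g y) = cmod (1 + cnj x * y)" if "y \<in> sphere 0 1" for y
  proof -
    have "ev g y = a * (1 + cnj x * y)"
      unfolding g_def using that by (subst ev_lin) (simp_all add: algebra_simps)
    then show ?thesis using a by (simp add: norm_mult)
  qed
  have evx: "ev g x = 2 * a" unfolding g_def using xc by (subst ev_lin) (simp_all add: mult.assoc)
  have sng: "sn g = 2"
  proof (rule antisym)
    show "sn g \<le> 2"
    proof (rule sn_le_sphere)
      fix y :: complex assume y: "y \<in> sphere 0 1"
      show "cmod (ev g y) \<le> 2"
        using norm_triangle_ineq[of 1 "cnj x * y"] x y unfolding evg[OF y] by (simp add: norm_mult)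
    qed
    show "2 \<le> sn g" using ev_le_sn[OF xc(1), of g] a by (simp add: evx norm_mult)
  qed
  have peak: "y = x" if y: "y \<in> sphere 0 1" "cmod (ev g y) = sn g" for y
  proof -
    have "cmod (1 + cnj x * y) = cmod 1 + cmod (cnj x * y)"
      using y x unfolding evg[OF y(1)] sng by (simp add: norm_mult)
    then have "cmod 1 *\<^sub>R (cnj x * y) = cmod (cnj x * y) *\<^sub>R 1" by (simp only: norm_triangle_eq)
    then have "cnj x * y = 1" using x y by (simp add: norm_mult)
    then have "x * (cnj x * y) = x" by simp
    moreover have "x * (cnj x * y) = cnj x * x * y" by (simp only: mult_ac)
    ultimately show ?thesis using xc(2) by simp
  qed
  obtain c where c: "cmod c = 1" "sn (L (lin c 0) + g) = sn (L (lin c 0)) + sn g"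
    by (rule aligned_constant)
  have "ev (L (lin c 0)) x = of_real (sn (L (lin c 0))) * a"
    by (rule aligned_at_peak[OF c(2) peak]) (simp_all add: evx sng)
  then show thesis using that c(1) by blast
qed

lemma const_image_linear:
  assumes "x \<in> sphere 0 1"
  shows "linear (\<lambda>c. ev (L (lin c 0)) x)"
proof (rule linearI)
  have x: "x \<in> cball 0 1" using assms by simp
  show "ev (L (lin (b + c) 0)) x = ev (L (lin b 0)) x + ev (L (lin c 0)) x" for b c
    using lin_simps(1)[of b 0 c 0] lin_isoD(4)[OF L, of "lin b 0" "lin c 0"] ev_simps(2)[OF x] by simp
  show "ev (L (lin (r *\<^sub>R c) 0)) x = r *\<^sub>R ev (L (lin c 0)) x" for r c
    using lin_simps(3)[of r c 0] lin_isoD(6)[OF L, of r "lin c 0"] ev_simps(5)[OF x]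
    by (simp add: scaleR_conv_of_real)
qed

text \<open>Evaluation at \<open>x\<close> gives a real-linear map of the plane that reaches every
  phase; it is onto, hence injective by dimension.\<close>

lemma const_image_inj:
  assumes x: "x \<in> sphere 0 1"
  shows "inj (\<lambda>c. ev (L (lin c 0)) x)"
proof (rule linear_surj_imp_inj[OF const_image_linear[OF x]])
  let ?m = "\<lambda>c. ev (L (lin c 0)) x"
  note lin = const_image_linear[OF x]
  have "\<exists>c. w = ?m c" for w
  proof (cases "w = 0")
    case True
    then show ?thesis using linear_0[OF lin] by metis
  next
    case False
    define a where "a = w / cmod w"
    have "cmod a = 1" using False by (simp add: a_def norm_divide)
    then obtain c where c: "cmod c = 1" "?m c = of_real (sn (L (lin c 0))) * a"
      using const_image_hits[OF x] by blast
    have s: "sn (L (lin c 0)) > 0" by (rule const_image_pos[OF c(1)])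
    have "?m ((cmod w / sn (L (lin c 0))) *\<^sub>R c) = (cmod w / sn (L (lin c 0))) *\<^sub>R ?m c"
      by (rule linear_scale[OF lin])
    also have "\<dots> = w" using s False unfolding c(2) by (simp add: a_def scaleR_conv_of_real)
    finally show ?thesis by metis
  qed
  then show "surj ?m" by blast
qed

text \<open>An alignment only asserts that some constant exists. By injectivity the phase of its
  image at one point identifies it.\<close>

lemma const_image_same_phase:
  assumes x: "x \<in> sphere 0 1" and "cmod b = 1" "cmod c = 1" "s > 0"
    and "ev (L (lin b 0)) x = s *\<^sub>R ev (L (lin c 0)) x"
  shows "b = c"
proof -
  have "ev (L (lin b 0)) x = ev (L (lin (s *\<^sub>R c) 0)) x"
    using assms(5) linear_scale[OF const_image_linear[OF x], of s c] by simp
  then have "b = s *\<^sub>R c" using injD[OF const_image_inj[OF x]] by blast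
  moreover from this have "s = 1" using assms by simp
  ultimately show ?thesis by simp
qed

text \<open>By \<open>const_image_hits\<close> the phase of the value at \<open>x\<close> is reached
  with full modulus by some unit constant, and that constant can only be \<open>c\<close>
  itself.\<close>

lemma const_image_phase:
  assumes x: "x \<in> sphere 0 1" and c: "cmod c = 1"
  obtains a where "cmod a = 1" "ev (L (lin c 0)) x = of_real (sn (L (lin c 0))) * a"
proof -
  let ?m = "\<lambda>c. ev (L (lin c 0)) x"
  have "c \<noteq> 0" using c by auto
  then have "?m c \<noteq> ?m 0" using const_image_inj[OF x] by (metis injD)
  then have m: "?m c \<noteq> 0" using linear_0[OF const_image_linear[OF x]] by simp
  define a where "a = ?m c / cmod (?m c)"
  have a: "cmod a = 1" using m by (simp add: a_def norm_divide)
  then obtain b where b: "cmod b = 1" "?m b = of_real (sn (L (lin b 0))) * a"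
    using const_image_hits[OF x] by blast
  have "sn (L (lin b 0)) > 0" by (rule const_image_pos[OF b(1)])
  then have "b = c"
    using m b by (intro const_image_same_phase[OF x b(1) c, of "sn (L (lin b 0)) / cmod (?m c)"])
      (simp_all add: a_def scaleR_conv_of_real)
  then show thesis using that[OF a] b(2) by simp
qed

text \<open>Constant modulus on the circle is what the reflection argument asks for, so the
  derivative of the image of a constant has boundary values.\<close>

lemma const_image_unimodular:
  assumes "x \<in> sphere 0 1" "cmod c = 1"
  shows "cmod (ev (L (lin c 0)) x) = sn (L (lin c 0))"
  using const_image_phase[OF assms] sn_nonneg[of "L (lin c 0)"] by (metis abs_of_nonneg mult.right_neutral norm_mult norm_of_real)

text \<open>The value peak of \<open>a * peak_poly d\<close> at 1 determines the aligned constant as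
  \<open>c\<close>, whatever \<open>d\<close> is, while the derivative peak at \<open>- 1\<close>
  prescribes the phase \<open>a * d\<close>. One and the same boundary derivative would have to
  point in every direction.\<close>

lemma const_image_dn:
  assumes c: "cmod c = 1"
  shows "dn (L (lin c 0)) = 0"
proof -
  have one: "(1::complex) \<in> sphere 0 1" by simp
  obtain a where a: "cmod a = 1" "ev (L (lin c 0)) 1 = of_real (sn (L (lin c 0))) * a"
    using const_image_phase[OF one c] by blast
  have sc: "sn (L (lin c 0)) > 0" by (rule const_image_pos[OF c])
  have "dx (L (lin c 0)) (- 1) = of_real (dn (L (lin c 0))) * (a * d)" if d: "cmod d = 1" for d
  proof -
    define g where "g = cmul a (peak_poly d)"
    have sng: "sn g = 4 / 7" "dn g = 1"
      by (simp_all add: g_def sn_cmul dn_cmul a sn_peak_poly[OF d] dn_peak_poly[OF d])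
    have evg: "ev g x = a * ev (peak_poly d) x" if "x \<in> sphere 0 1" for x
      unfolding g_def using that by (intro ev_simps) simp
    obtain b where b: "cmod b = 1" "sn (L (lin b 0) + g) = sn (L (lin b 0)) + sn g"
      "dn (L (lin b 0) + g) = dn (L (lin b 0)) + dn g"
      by (rule aligned_constant)
    have sb: "sn (L (lin b 0)) > 0" by (rule const_image_pos[OF b(1)])
    have "ev (L (lin b 0)) 1 = of_real (sn (L (lin b 0))) * a"
    proof (rule aligned_at_peak[OF b(2)])
      show "y = 1" if "y \<in> sphere 0 1" "cmod (ev g y) = sn g" for y
        using that a peak_poly_unique[OF d, of y] by (simp add: evg sng norm_mult)
      show "ev g 1 = complex_of_real (sn g) * a" by (simp add: evg sng ev_peak_poly_1[OF d])
    qed (simp add: sng)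
    then have "b = c"
      using a sc sb by (intro const_image_same_phase[OF one b(1) c, of "sn (L (lin b 0)) / sn (L (lin c 0))"])
        (simp_all add: scaleR_conv_of_real)
    define P where "P z = a * (d * ((1 - z) / 2) ^ 3 + 3 * (1 + z)\<^sup>2 / 14)" for z
    have P: "continuous_on (cball 0 1) P" unfolding P_def by (intro continuous_intros) auto
    have Pd: "P z = dv g z" if "z \<in> ball 0 1" for z
      using dv_peak_poly[OF d that] dv_simps(6)[OF that] by (simp only: P_def g_def)
    show ?thesis
    proof (rule derivative_aligned_at_peak[where D = "dx (L (lin c 0))" and x = "- 1" and P = P,
          OF _ _ P Pd b(3)[unfolded \<open>b = c\<close>]])
      show "continuous_on (cball 0 1) (dx (L (lin c 0)))"
        using sc const_image_unimodular[OF _ c] by (rule dx_continuous)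
      show "dx (L (lin c 0)) z = dv (L (lin c 0)) z" if "z \<in> ball 0 1" for z
        using sc const_image_unimodular[OF _ c] that by (rule dx_ball)
      show "y = - 1" if "y \<in> cball 0 1" "cmod (P y) = dn g" for y
        using dv_peak_poly_unique[OF d that(1)] that(2) a(1) by (simp add: P_def norm_mult sng)
    qed (simp_all add: P_def sng)
  qed
  \<comment> \<open>Two opposite phases at the same point are compatible only with
    \<open>dn = 0\<close>.\<close>
  from this[of 1] this[of "- 1"] show ?thesis using a(1) by auto
qed

end

text \<open>Images of unit constants have zero derivative, and real homogeneity covers the other
  constants. On constants the norm is the modulus, so \<open>L\<close> acts there as a plane
  isometry.\<close>

theorem lin_iso_constants:
  assumes L: "lin_iso L"
  obtains c where "cmod c = 1" "\<And>a. L (lin a 0) = lin (c * a) 0"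
    | c where "cmod c = 1" "\<And>a. L (lin a 0) = lin (c * cnj a) 0"
proof -
  define \<phi> where "\<phi> a = fn (L (lin a 0)) 0" for a
  have unit: "L (lin a 0) = lin (\<phi> a) 0" if "cmod a = 1" for a
  proof -
    have "dv (L (lin a 0)) z = 0" if "z \<in> ball 0 1" for z
      using dn_ge[OF that, of "L (lin a 0)"] const_image_dn[OF L \<open>cmod a = 1\<close>] by simp
    then show ?thesis unfolding \<phi>_def by (rule lin_if_dv_const)
  qed
  have all: "L (lin a 0) = lin (\<phi> a) 0" for a
  proof (cases "a = 0")
    case True
    then show ?thesis using lin_isoD(7)[OF L] by (simp add: \<phi>_def lin_simps)
  next
    case False
    define b where "b = a / cmod a"
    have "cmod b = 1" using False by (simp add: b_def norm_divide)
    have "lin a 0 = cmod a *\<^sub>R lin b 0" using False by (simp add: lin_simps b_def)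
    then have "L (lin a 0) = cmod a *\<^sub>R lin (\<phi> b) 0"
      using unit[OF \<open>cmod b = 1\<close>] lin_isoD(6)[OF L] by simp
    then have "L (lin a 0) = lin (of_real (cmod a) * \<phi> b) 0" by (simp add: lin_simps)
    then show ?thesis by (simp add: \<phi>_def fn_lin)
  qed
  have "cmod (\<phi> a - \<phi> b) = cmod (a - b)" for a b
  proof -
    have "cmod (\<phi> a - \<phi> b) = norm (L (lin a 0) - L (lin b 0))" unfolding all by (simp add: lin_simps)
    also have "\<dots> = norm (L (lin a 0 - lin b 0))" by (simp only: lin_isoD(5)[OF L])
    also have "\<dots> = cmod (a - b)" unfolding lin_isoD(3)[OF L] by (simp add: lin_simps)
    finally show ?thesis .
  qed
  moreover have "\<phi> 0 = 0" using lin_isoD(7)[OF L] by (simp add: \<phi>_def lin_simps)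
  ultimately show thesis
    using plane_isometry[of \<phi>] that all by metis
qed

section \<open>Images of the linear functions\<close>

lemma ev_sphere [simp]:
  assumes "cmod x = 1"
  shows "ev (f + g) x = ev f x + ev g x" "ev (f - g) x = ev f x - ev g x" "ev (- f) x = - ev f x"
    "ev (r *\<^sub>R f) x = of_real r * ev f x" "ev (cmul c f) x = c * ev f x" "ev (lin a b) x = a + b * x"
  using assms by (simp_all add: ev_lin)

section \<open>Support functions of the boundary values\<close>

lemma Re_ev_continuous: "continuous_on (sphere 0 1) (\<lambda>x. Re (cnj a * ev f x))"
  by (intro continuous_intros ev_sphere_continuous)

lemma sr_bdd: "bdd_above ((\<lambda>x. Re (cnj a * ev f x)) ` sphere 0 1)"
  by (intro bounded_imp_bdd_above compact_imp_bounded compact_continuous_image Re_ev_continuous) simp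

lemma sr_ge: "cmod x = 1 \<Longrightarrow> Re (cnj a * ev f x) \<le> sr a f"
  unfolding sr_def by (rule cSUP_upper[OF _ sr_bdd]) simp

lemma sr_le: "(\<And>x. cmod x = 1 \<Longrightarrow> Re (cnj a * ev f x) \<le> B) \<Longrightarrow> sr a f \<le> B"
  unfolding sr_def by (rule cSUP_least) auto

lemma sr_attained:
  obtains x where "cmod x = 1" "Re (cnj a * ev f x) = sr a f"
proof -
  obtain x where x: "x \<in> sphere 0 1" "\<And>y. y \<in> sphere 0 1 \<Longrightarrow> Re (cnj a * ev f y) \<le> Re (cnj a * ev f x)"
    using continuous_attains_sup[OF _ _ Re_ev_continuous[of a f]] by auto
  then have "sr a f = Re (cnj a * ev f x)" by (intro antisym sr_le sr_ge) simp_all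
  then show thesis using that x(1) by simp
qed

text \<open>First-order expansion of the modulus far out in the direction \<open>a\<close>, with an
  error of order \<open>1 / n\<close>.\<close>

lemma cmod_add_large:
  assumes a: "cmod a = 1" and "n > 0"
  shows "n + Re (cnj a * w) \<le> cmod (w + of_real n * a)"
    and "cmod (w + of_real n * a) \<le> n + Re (cnj a * w) + (cmod w)\<^sup>2 / (2 * n)"
proof -
  define v where "v = cnj a * w"
  have "cnj a * a = 1" using a by (simp add: complex_norm_square[symmetric] mult.commute)
  then have "cnj a * (w + of_real n * a) = v + of_real n" by (simp add: v_def algebra_simps)
  then have eq: "cmod (w + of_real n * a) = cmod (v + of_real n)"
    using a by (metis complex_mod_cnj mult_1 norm_mult)
  have cv: "cmod v = cmod w" using a by (simp add: v_def norm_mult)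
  show "n + Re (cnj a * w) \<le> cmod (w + of_real n * a)"
    using complex_Re_le_cmod[of "v + of_real n"] unfolding eq by (simp add: v_def)
  define m where "m = cmod (v + of_real n)"
  have "m\<^sup>2 = n\<^sup>2 + 2 * n * Re v + (cmod v)\<^sup>2"
    unfolding m_def cmod_power2 by (simp add: power2_eq_square algebra_simps)
  \<comment> \<open>Linearises the square \<open>m^2\<close>, so the upper bound is obtained without
    a square root.\<close>
  moreover have "2 * n * m \<le> n\<^sup>2 + m\<^sup>2" using sum_squares_bound[of n m] by simp
  ultimately have "m * (2 * n) \<le> (n + Re v) * (2 * n) + (cmod w)\<^sup>2"
    by (simp add: cv power2_eq_square algebra_simps)
  then have "m \<le> ((n + Re v) * (2 * n) + (cmod w)\<^sup>2) / (2 * n)"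
    using \<open>n > 0\<close> by (simp add: pos_le_divide_eq)
  also have "\<dots> = n + Re v + (cmod w)\<^sup>2 / (2 * n)" using \<open>n > 0\<close> by (simp add: add_divide_distrib)
  finally show "cmod (w + of_real n * a) \<le> n + Re (cnj a * w) + (cmod w)\<^sup>2 / (2 * n)"
    unfolding eq by (simp add: m_def v_def)
qed

text \<open>The error in \<open>cmod_add_large\<close> is uniform on the circle because
  \<open>cmod (ev f x)\<close> is at most \<open>sn f\<close>.\<close>

lemma sn_large_constant:
  assumes a: "cmod a = 1"
  shows "(\<lambda>n. sn (f + lin (of_nat n * a) 0) - real n) \<longlonglongrightarrow> sr a f"
proof (rule tendsto_sandwich[OF _ _ tendsto_const])
  have lower: "sr a f \<le> sn (f + lin (of_nat n * a) 0) - real n" if "n > 0" for n :: nat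
  proof (rule sr_le)
    fix x :: complex assume x: "cmod x = 1"
    have "cmod (ev f x + of_nat n * a) \<le> sn (f + lin (of_nat n * a) 0)"
      using ev_le_sn[of x "f + lin (of_nat n * a) 0"] x by simp
    then show "Re (cnj a * ev f x) \<le> sn (f + lin (of_nat n * a) 0) - real n"
      using cmod_add_large(1)[OF a, of n "ev f x"] that by simp
  qed
  have upper: "sn (f + lin (of_nat n * a) 0) - real n \<le> sr a f + (sn f)\<^sup>2 / 2 * inverse (real n)" if "n > 0" for n :: nat
  proof -
    have "sn (f + lin (of_nat n * a) 0) \<le> n + sr a f + (sn f)\<^sup>2 / (2 * n)"
    proof (rule sn_le_sphere)
      fix x :: complex assume "x \<in> sphere 0 1"
      then have x: "cmod x = 1" by simp
      have "(cmod (ev f x))\<^sup>2 / (2 * n) \<le> (sn f)\<^sup>2 / (2 * n)"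
        using ev_le_sn[of x f] x by (intro divide_right_mono power_mono) simp_all
      then show "cmod (ev (f + lin (of_nat n * a) 0) x) \<le> n + sr a f + (sn f)\<^sup>2 / (2 * n)"
        using cmod_add_large(2)[OF a, of n "ev f x"] sr_ge[OF x, of a f] that x by simp
    qed
    then show ?thesis by (simp add: field_simps)
  qed
  show "\<forall>\<^sub>F n in sequentially. sr a f \<le> sn (f + lin (of_nat n * a) 0) - real n"
    using eventually_gt_at_top[of 0] by eventually_elim (rule lower)
  show "\<forall>\<^sub>F n in sequentially. sn (f + lin (of_nat n * a) 0) - real n \<le> sr a f + (sn f)\<^sup>2 / 2 * inverse (real n)"
    using eventually_gt_at_top[of 0] by eventually_elim (rule upper)
  show "(\<lambda>n. sr a f + (sn f)\<^sup>2 / 2 * inverse (real n)) \<longlonglongrightarrow> sr a f"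
    using tendsto_add[OF tendsto_const tendsto_mult[OF tendsto_const LIMSEQ_inverse_real_of_nat], of "sr a f" "(sn f)\<^sup>2 / 2"]
    by (subst filterlim_sequentially_Suc[symmetric]) simp
qed

text \<open>The half sum has value 1 at \<open>x\<close> and smaller modulus elsewhere on the
  circle; a high power makes it small on compact sets avoiding \<open>x\<close>.\<close>

definition peak :: "complex \<Rightarrow> nat \<Rightarrow> sinf" where
  "peak x n = mk (\<lambda>z. ((1 + cnj x * z) / 2) ^ n)"

lemma ev_peak: "cmod y = 1 \<Longrightarrow> ev (peak x n) y = ((1 + cnj x * y) / 2) ^ n"
  unfolding peak_def by (rule ev_mk) (auto intro!: holomorphic_intros)

lemma cmod_cnj_self: "cmod x = 1 \<Longrightarrow> cnj x * x = 1" "cmod x = 1 \<Longrightarrow> x * cnj x = 1"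
  by (simp_all add: complex_norm_square[symmetric] mult.commute)

lemma cmod_half_sum_less:
  assumes "cmod x = 1" "cmod y = 1" "y \<noteq> x"
  shows "cmod ((1 + cnj x * y) / 2) < 1"
proof (rule ccontr)
  assume "\<not> ?thesis"
  moreover have "cmod (1 + cnj x * y) \<le> cmod 1 + cmod (cnj x * y)" by (rule norm_triangle_ineq)
  ultimately have "cmod (1 + cnj x * y) = cmod 1 + cmod (cnj x * y)"
    using assms by (simp add: norm_mult norm_divide)
  then have "cmod 1 *\<^sub>R (cnj x * y) = cmod (cnj x * y) *\<^sub>R 1" by (simp only: norm_triangle_eq)
  then have "cnj x * y = 1" using assms by (simp add: norm_mult)
  then have "x * cnj x * y = x" by (simp add: mult.assoc)
  then show False using assms by (simp add: cmod_cnj_self)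
qed

text \<open>The one-dimensional Borsuk--Ulam argument: omitting a point yields a continuous angle on
  the circle, and such an angle agrees at some pair of antipodes.\<close>

lemma circle_injection_surj:
  fixes \<tau> :: "complex \<Rightarrow> complex"
  assumes cont: "continuous_on (sphere 0 1) \<tau>" and inj: "inj_on \<tau> (sphere 0 1)"
    and \<tau>: "\<And>a. a \<in> sphere 0 1 \<Longrightarrow> \<tau> a \<in> sphere 0 1"
  shows "\<tau> ` sphere 0 1 = sphere 0 1"
proof (rule ccontr)
  assume "\<not> ?thesis"
  then obtain x0 where x0: "cmod x0 = 1" "\<And>a. cmod a = 1 \<Longrightarrow> \<tau> a \<noteq> x0" using \<tau> by force
  then have "x0 \<noteq> 0" by auto
  have norm1: "cmod (- \<tau> a / x0) = 1" if "cmod a = 1" for a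
    using \<tau>[of a] that x0(1) by (simp add: norm_divide)
  \<comment> \<open>The minus sign places the omitted value \<open>x0\<close> on the branch cut of
    \<open>Ln\<close>.\<close>
  have np: "- \<tau> a / x0 \<notin> \<real>\<^sub>\<le>\<^sub>0" if a: "cmod a = 1" for a
  proof
    assume "- \<tau> a / x0 \<in> \<real>\<^sub>\<le>\<^sub>0"
    then obtain r where r: "- \<tau> a / x0 = of_real r" "r \<le> 0" by (rule nonpos_Reals_cases)
    then have "r = - 1" using norm1[OF a] by simp
    then have "\<tau> a = x0" using r(1) \<open>x0 \<noteq> 0\<close> by (simp add: field_simps)
    then show False using x0(2)[OF a] by simp
  qed
  define h where "h a = Im (Ln (- \<tau> a / x0))" for a
  have conth: "continuous_on (sphere 0 1) h"
    unfolding h_def using np \<open>x0 \<noteq> 0\<close> cont by (auto intro!: continuous_intros)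
  \<comment> \<open>An odd function on the connected circle, so it has a zero.\<close>
  define k where "k a = h a - h (- a)" for a
  have "continuous_on (sphere 0 1) k"
    unfolding k_def by (intro continuous_on_diff conth continuous_on_compose2[OF conth]) (auto intro!: continuous_intros)
  then have "connected (k ` sphere 0 1)"
    by (intro connected_continuous_image connected_sphere) simp_all
  moreover have "k 1 \<in> k ` sphere 0 1" "k (- 1) \<in> k ` sphere 0 1" by auto
  moreover have "k (- 1) = - k 1" by (simp add: k_def)
  ultimately have "0 \<in> k ` sphere 0 1"
    using connectedD_interval[of "k ` sphere 0 1" "k 1" "k (- 1)" 0]
      connectedD_interval[of "k ` sphere 0 1" "k (- 1)" "k 1" 0] by linarith
  then obtain a where a: "cmod a = 1" "h a = h (- a)" by (auto simp: k_def)
  have n0: "- \<tau> b / x0 \<noteq> 0" if "cmod b = 1" for b using norm1[OF that] by auto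
  have "Ln (- \<tau> a / x0) = Ln (- \<tau> (- a) / x0)"
    using a n0[of a] n0[of "- a"] norm1[of a] norm1[of "- a"] by (simp add: complex_eq_iff h_def)
  then have "- \<tau> a / x0 = - \<tau> (- a) / x0"
    using n0[of a] n0[of "- a"] a(1) by (metis exp_Ln norm_minus_cancel)
  then have "\<tau> a = \<tau> (- a)" using \<open>x0 \<noteq> 0\<close> by simp
  then have "a = - a" using inj a(1) by (auto dest: inj_onD)
  then show False using a(1) by simp
qed

section \<open>Isometries fixing the constants\<close>

locale const_iso =
  fixes L :: "sinf \<Rightarrow> sinf"
  assumes L: "lin_iso L" and const: "\<And>a. L (lin a 0) = lin a 0"
begin

lemmas iso = lin_isoD[OF L]

lemma sr_dn:
  assumes "cmod a = 1"
  shows "sr a (L f) + dn (L f) = sr a f + dn f"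
proof -
  have "sn (L f + lin (of_nat n * a) 0) + dn (L f) = sn (f + lin (of_nat n * a) 0) + dn f" for n :: nat
  proof -
    have "norm (L f + lin (of_nat n * a) 0) = norm (f + lin (of_nat n * a) 0)"
      using iso(3)[of "f + lin (of_nat n * a) 0"] by (simp add: iso(4) const)
    then show ?thesis by (simp add: norm_sinf add.commute[of f] add.commute[of "L f"])
  qed
  then have "(\<lambda>n. sn (L f + lin (of_nat n * a) 0) - real n) = (\<lambda>n. sn (f + lin (of_nat n * a) 0) - real n + (dn f - dn (L f)))"
    by (auto simp: fun_eq_iff algebra_simps)
  then have "(\<lambda>n. sn (f + lin (of_nat n * a) 0) - real n + (dn f - dn (L f))) \<longlonglongrightarrow> sr a (L f)"
    using sn_large_constant[OF assms, of "L f"] by simp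
  moreover have "(\<lambda>n. sn (f + lin (of_nat n * a) 0) - real n + (dn f - dn (L f))) \<longlonglongrightarrow> sr a f + (dn f - dn (L f))"
    by (intro tendsto_intros sn_large_constant assms)
  ultimately show ?thesis using LIMSEQ_unique by fastforce
qed

text \<open>The derivative term in \<open>sr_dn\<close> does not depend on the direction.
  Differences between directions therefore isolate the boundary values, and all later information on
  them is drawn from such differences.\<close>

lemma sr_diff:
  assumes "cmod a = 1" "cmod a' = 1"
  shows "sr a (L f) - sr a' (L f) = sr a f - sr a' f"
  using sr_dn[OF assms(1), of f] sr_dn[OF assms(2), of f] by simp

end

lemma sr_add_large:
  assumes R: "\<And>x. cmod x = 1 \<Longrightarrow> Re (cnj a * ev F x) \<le> R" and A: "A = {x. cmod x = 1 \<and> Re (cnj a * ev F x) = R}" "A \<noteq> {}"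
  shows "(\<lambda>n. sr a (g + real n *\<^sub>R F) - real n * R) \<longlonglongrightarrow> (SUP x\<in>A. Re (cnj a * ev g x))"
proof -
  have "sr a (g + real n *\<^sub>R F) = (SUP x\<in>sphere 0 1. Re (cnj a * ev g x) + real n * Re (cnj a * ev F x))" for n
    unfolding sr_def by (intro SUP_cong refl) (simp add: algebra_simps)
  moreover have "(\<lambda>n. (SUP x\<in>sphere 0 1. Re (cnj a * ev g x) + real n * Re (cnj a * ev F x)) - real n * R)
      \<longlonglongrightarrow> (SUP x\<in>A. Re (cnj a * ev g x))"
    by (rule perturbed_sup_limit[OF _ Re_ev_continuous Re_ev_continuous]) (use R A in auto)
  ultimately show ?thesis by simp
qed

lemma Re_eq_cmod_bound:
  assumes "cmod a = 1" "cmod w \<le> R" "Re (cnj a * w) = R"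
  shows "w = of_real R * a"
proof -
  have "cmod (cnj a * w) \<le> R" using assms by (simp add: norm_mult)
  then have "(Re (cnj a * w))\<^sup>2 + (Im (cnj a * w))\<^sup>2 \<le> R\<^sup>2"
    unfolding cmod_power2[symmetric] by (intro power_mono) simp_all
  then have "Im (cnj a * w) = 0" using assms(3) by simp
  then have "cnj a * w = of_real R" using assms(3) by (simp add: complex_eq_iff)
  then have "a * cnj a * w = a * of_real R" by (simp add: mult.assoc)
  then show ?thesis using assms(1) by (simp add: cmod_cnj_self mult.commute)
qed

text \<open>In the direction \<open>a\<close> the function \<open>b z\<close> peaks at the single
  point \<open>a * cnj b\<close>, so the limit reads off one value of \<open>f\<close>.\<close>

lemma sr_add_large_linear:
  assumes a: "cmod a = 1" and b: "cmod b = 1"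
  shows "(\<lambda>n. sr a (f + real n *\<^sub>R lin 0 b) - real n) \<longlonglongrightarrow> Re (cnj a * ev f (a * cnj b))"
proof -
  have "{x. cmod x = 1 \<and> Re (cnj a * ev (lin 0 b) x) = 1} = {a * cnj b}"
  proof (intro equalityI subsetI)
    fix x assume "x \<in> {x. cmod x = 1 \<and> Re (cnj a * ev (lin 0 b) x) = 1}"
    then have x: "cmod x = 1" "Re (cnj a * (b * x)) = 1" by auto
    then have "b * x = of_real 1 * a" using a b by (intro Re_eq_cmod_bound) (simp_all add: norm_mult)
    then have "cnj b * b * x = a * cnj b" by (simp add: mult_ac)
    then show "x \<in> {a * cnj b}" using b by (simp add: cmod_cnj_self)
  next
    fix x assume "x \<in> {a * cnj b}"
    then have x: "x = a * cnj b" "cmod x = 1" using a b by (simp_all add: norm_mult)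
    have "cnj a * ev (lin 0 b) x = (cnj a * a) * (cnj b * b)"
      unfolding ev_sphere(6)[OF x(2)] unfolding x(1) by (simp add: mult_ac)
    then have "cnj a * ev (lin 0 b) x = 1" using a b by (simp add: cmod_cnj_self)
    then have "Re (cnj a * ev (lin 0 b) x) = 1" by (simp only: one_complex.sel)
    then show "x \<in> {x. cmod x = 1 \<and> Re (cnj a * ev (lin 0 b) x) = 1}" using x(2) by blast
  qed
  moreover have "Re (cnj a * ev (lin 0 b) x) \<le> 1" if "cmod x = 1" for x
    using complex_Re_le_cmod[of "cnj a * (b * x)"] that a b by (simp add: norm_mult)
  ultimately show ?thesis
    using sr_add_large[of a "lin 0 b" 1 "{a * cnj b}" f] by simp
qed

lemma sr_linear:
  assumes "cmod a = 1" "cmod b = 1"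
  shows "sr a (lin 0 b) = 1"
proof (rule antisym)
  show "sr a (lin 0 b) \<le> 1"
  proof (rule sr_le)
    fix x :: complex assume "cmod x = 1"
    then show "Re (cnj a * ev (lin 0 b) x) \<le> 1"
      using complex_Re_le_cmod[of "cnj a * (b * x)"] assms by (simp add: norm_mult)
  qed
  have "cnj a * (b * (a * cnj b)) = (cnj a * a) * (cnj b * b)" by (simp only: mult_ac)
  then show "1 \<le> sr a (lin 0 b)"
    using sr_ge[of "a * cnj b" a "lin 0 b"] assms by (simp add: norm_mult cmod_cnj_self)
qed

section \<open>Constant boundary modulus of the image of a linear function\<close>

locale linear_image = const_iso +
  fixes b :: complex and F :: sinf and R :: real
  assumes b: "cmod b = 1" and F: "F = L (lin 0 b)" and R: "R = sr 1 F"
begin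

text \<open>The support function of \<open>lin 0 b\<close> is 1 in every direction and
  \<open>L\<close> preserves differences between directions.\<close>

lemma sr_F: "cmod a = 1 \<Longrightarrow> sr a F = R"
  using sr_diff[of a 1 "lin 0 b"] by (simp add: F R sr_linear b)

lemma cmod_F_le:
  assumes x: "cmod x = 1"
  shows "cmod (ev F x) \<le> R"
proof (cases "ev F x = 0")
  case True
  then show ?thesis using sr_ge[OF x, of 1 F] R by simp
next
  case False
  define a where "a = ev F x / cmod (ev F x)"
  have a: "cmod a = 1" using False by (simp add: a_def norm_divide)
  have "ev F x = cmod (ev F x) * a" using False by (simp add: a_def)
  then have "cnj a * ev F x = cmod (ev F x) * (cnj a * a)" by simp
  then have "Re (cnj a * ev F x) = cmod (ev F x)" by (simp add: cmod_cnj_self a)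
  then show ?thesis using sr_ge[OF x, of a F] sr_F[OF a] by simp
qed

lemma R_pos: "R > 0"
proof (rule ccontr)
  assume "\<not> ?thesis"
  then have "ev F x = ev 0 x" if "x \<in> sphere 0 1" for x
  proof -
    have "cmod x = 1" using that by simp
    then have "cmod (ev F x) \<le> 0" using cmod_F_le[of x] \<open>\<not> R > 0\<close> by linarith
    then show ?thesis using that by simp
  qed
  then have "F = 0" by (rule sinf_eq_sphere)
  then have "L (lin 0 b) = L 0" by (simp add: F iso(7))
  then show False using b by (auto simp: iso(9))
qed

text \<open>The peak set of \<open>F\<close> in the direction \<open>a\<close>; \<open>A_alt\<close>
  gives its form as a maximum set.\<close>

definition A :: "complex \<Rightarrow> complex set" where
  "A a = {x. cmod x = 1 \<and> ev F x = of_real R * a}"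

lemma A_alt:
  assumes a: "cmod a = 1"
  shows "A a = {x. cmod x = 1 \<and> Re (cnj a * ev F x) = R}"
proof -
  have "Re (cnj a * (of_real R * a)) = R"
  proof -
    have "cnj a * (of_real R * a) = of_real R * (cnj a * a)" by (simp only: mult_ac)
    also have "\<dots> = of_real R" by (simp add: cmod_cnj_self a)
    finally show ?thesis by (simp only: Re_complex_of_real)
  qed
  then have "ev F x = of_real R * a \<longleftrightarrow> Re (cnj a * ev F x) = R" if "cmod x = 1" for x
    using Re_eq_cmod_bound[OF a cmod_F_le[OF that]] by metis
  then show ?thesis unfolding A_def by blast
qed

lemma A_nonempty: "cmod a = 1 \<Longrightarrow> A a \<noteq> {}"
  using sr_attained[of a F] sr_F[of a] by (auto simp: A_alt)

text \<open>The limit of \<open>sr a (g + n F)\<close> after removal of its linear growth, see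
  \<open>sr_add_large_F\<close>.\<close>

definition M :: "complex \<Rightarrow> sinf \<Rightarrow> real" where
  "M a g = (SUP x\<in>A a. Re (cnj a * ev g x))"

lemma M_ge: "x \<in> A a \<Longrightarrow> Re (cnj a * ev g x) \<le> M a g"
  unfolding M_def by (intro cSUP_upper bdd_above_mono[OF sr_bdd]) (auto simp: A_def)

lemma M_le: "cmod a = 1 \<Longrightarrow> (\<And>x. x \<in> A a \<Longrightarrow> Re (cnj a * ev g x) \<le> B) \<Longrightarrow> M a g \<le> B"
  unfolding M_def by (rule cSUP_least[OF A_nonempty])

lemma sr_add_large_F:
  assumes a: "cmod a = 1"
  shows "(\<lambda>n. sr a (g + real n *\<^sub>R F) - real n * R) \<longlonglongrightarrow> M a g"
  unfolding M_def
  by (rule sr_add_large[OF _ A_alt[OF a] A_nonempty[OF a]]) (use sr_ge[of _ a F] sr_F[OF a] in simp)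

lemma M_diff:
  assumes a: "cmod a = 1" and a': "cmod a' = 1"
  shows "M a (L f) - M a' (L f) = Re (cnj a * ev f (a * cnj b)) - Re (cnj a' * ev f (a' * cnj b))"
proof -
  have 1: "(\<lambda>n. (sr a (f + real n *\<^sub>R lin 0 b) - real n) - (sr a' (f + real n *\<^sub>R lin 0 b) - real n))
      \<longlonglongrightarrow> Re (cnj a * ev f (a * cnj b)) - Re (cnj a' * ev f (a' * cnj b))"
    by (intro tendsto_diff sr_add_large_linear a a' b)
  have 2: "(\<lambda>n. (sr a (f + real n *\<^sub>R lin 0 b) - real n) - (sr a' (f + real n *\<^sub>R lin 0 b) - real n))
    = (\<lambda>n. (sr a (L f + real n *\<^sub>R F) - real n * R) - (sr a' (L f + real n *\<^sub>R F) - real n * R))"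
    using sr_diff[OF a a', of "f + real n *\<^sub>R lin 0 b" for n] by (simp add: fun_eq_iff iso(4,6) F)
  have 3: "(\<lambda>n. (sr a (L f + real n *\<^sub>R F) - real n * R) - (sr a' (L f + real n *\<^sub>R F) - real n * R))
      \<longlonglongrightarrow> M a (L f) - M a' (L f)"
    by (intro tendsto_diff sr_add_large_F a a')
  show ?thesis by (rule LIMSEQ_unique[OF 3 1[unfolded 2]])
qed

text \<open>The sum \<open>M a g + M a (- g)\<close> is the oscillation of
  \<open>Re (cnj a * g)\<close> over \<open>A a\<close>. For the preimage the peak sets are single
  points and the oscillation is 0 in every direction; preserved differences then make it independent
  of \<open>a\<close> for the image.\<close>

lemma M_oscillation:
  assumes a: "cmod a = 1" and a': "cmod a' = 1"
  shows "M a g + M a (- g) = M a' g + M a' (- g)"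
proof -
  obtain f where f: "g = L f" using iso(2) by (meson surjE)
  have "cmod (a * cnj b) = 1" "cmod (a' * cnj b) = 1" using a a' b by (simp_all add: norm_mult)
  then show ?thesis
    using M_diff[OF a a', of f] M_diff[OF a a', of "- f"] by (simp add: f iso(8))
qed

lemma A_closed: "compact (A a)"
proof -
  have "A a = sphere 0 1 \<inter> ev F -` {of_real R * a}" by (auto simp: A_def)
  moreover have "closedin (top_of_set (sphere 0 1)) (sphere 0 1 \<inter> ev F -` {of_real R * a})"
    by (rule continuous_closedin_preimage[OF ev_sphere_continuous]) simp
  ultimately show ?thesis using closedin_compact[of "sphere (0::complex) 1"] by simp
qed

text \<open>With two points in \<open>A a\<close>, a function peaking sharply at one of them
  oscillates strongly over \<open>A a\<close> but hardly over \<open>A (- a)\<close>, a compact set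
  that avoids \<open>x1\<close>. This contradicts \<open>M_oscillation\<close>.\<close>

lemma A_unique:
  assumes a: "cmod a = 1" and x1: "x1 \<in> A a" and x2: "x2 \<in> A a"
  shows "x1 = x2"
proof (rule ccontr)
  assume ne: "x1 \<noteq> x2"
  have n: "cmod x1 = 1" "cmod x2 = 1" using x1 x2 by (auto simp: A_def)
  have a': "cmod (- a) = 1" using a by simp
  define u where "u x = cmod ((1 + cnj x1 * x) / 2)" for x
  have "continuous_on (A (- a)) u" unfolding u_def by (intro continuous_intros) auto
  then obtain y where y: "y \<in> A (- a)" "\<And>x. x \<in> A (- a) \<Longrightarrow> u x \<le> u y"
    using continuous_attains_sup[OF A_closed A_nonempty[OF a']] by blast
  have "y \<noteq> x1"
    using y(1) x1 R_pos a by (auto simp: A_def)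
  moreover have "cmod y = 1" using y(1) by (simp add: A_def)
  ultimately have "u y < 1" unfolding u_def using n(1) by (intro cmod_half_sum_less)
  moreover have "u x2 < 1" unfolding u_def using n ne by (intro cmod_half_sum_less) auto
  ultimately have q: "max (u y) (u x2) < 1" "0 \<le> max (u y) (u x2)" by (simp_all add: u_def le_max_iff_disj)
  \<comment> \<open>With 1/4 the oscillations are at least \<open>3/4\<close> and at most
    \<open>1/2\<close>; any bound \<open>q\<close> with \<open>1 - q > 2 * q\<close> separates
    them.\<close>
  obtain m where m: "max (u y) (u x2) ^ m < 1 / 4"
    using real_arch_pow_inv[of "1/4" "max (u y) (u x2)"] q(1) by auto
  define g where "g = cmul a (peak x1 m)"
  have evg: "cnj a * ev g x = ((1 + cnj x1 * x) / 2) ^ m" if "cmod x = 1" for x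
  proof -
    have "cnj a * ev g x = (cnj a * a) * ((1 + cnj x1 * x) / 2) ^ m"
      unfolding g_def using that by (simp add: ev_peak mult.assoc)
    then show ?thesis by (simp add: cmod_cnj_self a)
  qed
  have small: "\<bar>Re (cnj a * ev g x)\<bar> \<le> 1 / 4" if "cmod x = 1" "u x \<le> max (u y) (u x2)" for x
  proof -
    have "\<bar>Re (cnj a * ev g x)\<bar> \<le> u x ^ m"
      unfolding evg[OF that(1)] u_def norm_power[symmetric] by (rule abs_Re_le_cmod)
    also have "\<dots> \<le> max (u y) (u x2) ^ m" using that(2) by (intro power_mono) (simp_all add: u_def)
    finally show ?thesis using m by simp
  qed
  have "Re (cnj a * ev g x1) = 1" unfolding evg[OF n(1)] using n(1) by (simp add: cmod_cnj_self)
  then have "1 \<le> M a g" using M_ge[OF x1, of g] by simp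
  moreover have "- 1 / 4 \<le> M a (- g)"
  proof -
    have "Re (cnj a * ev (- g) x2) = - Re (cnj a * ev g x2)" using n by simp
    moreover have "\<bar>Re (cnj a * ev g x2)\<bar> \<le> 1 / 4" by (rule small[OF n(2)]) simp
    ultimately show ?thesis using M_ge[OF x2, of "- g"] by linarith
  qed
  moreover have "M (- a) g \<le> 1 / 4"
  proof (rule M_le[OF a'])
    fix x assume x: "x \<in> A (- a)"
    then have "cmod x = 1" by (simp add: A_def)
    then have "\<bar>Re (cnj a * ev g x)\<bar> \<le> 1 / 4" using y(2)[OF x] by (intro small) simp_all
    moreover have "Re (cnj (- a) * ev g x) = - Re (cnj a * ev g x)" by simp
    ultimately show "Re (cnj (- a) * ev g x) \<le> 1 / 4" by linarith
  qed
  moreover have "M (- a) (- g) \<le> 1 / 4"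
  proof (rule M_le[OF a'])
    fix x assume x: "x \<in> A (- a)"
    then have "cmod x = 1" by (simp add: A_def)
    then have "\<bar>Re (cnj a * ev g x)\<bar> \<le> 1 / 4" using y(2)[OF x] by (intro small) simp_all
    moreover have "Re (cnj (- a) * ev (- g) x) = Re (cnj a * ev g x)" using \<open>cmod x = 1\<close> by simp
    ultimately show "Re (cnj (- a) * ev (- g) x) \<le> 1 / 4" by linarith
  qed
  ultimately show False using M_oscillation[OF a a', of g] by linarith
qed

text \<open>On the compact set \<open>K\<close> where \<open>F\<close> has modulus \<open>R\<close>,
  the map \<open>F / R\<close> is inverted by \<open>\<tau>\<close>, which sends a direction to its
  unique peak point. So \<open>\<tau>\<close> is a continuous injection of the circle into itself,
  and its image, contained in \<open>K\<close>, is the whole circle.\<close>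

lemma F_unimodular:
  assumes "cmod x = 1"
  shows "cmod (ev F x) = R"
proof -
  define \<tau> where "\<tau> a = (THE x. x \<in> A a)" for a
  have \<tau>A: "\<tau> a \<in> A a" if "cmod a = 1" for a
  proof -
    have "\<exists>!x. x \<in> A a" using A_nonempty[OF that] A_unique[OF that] by blast
    then show ?thesis unfolding \<tau>_def by (rule theI')
  qed
  define K where "K = {x. cmod x = 1 \<and> cmod (ev F x) = R}"
  define \<phi> where "\<phi> x = ev F x / of_real R" for x
  have "compact K"
  proof -
    have "K = sphere 0 1 \<inter> (\<lambda>x. cmod (ev F x)) -` {R}" by (auto simp: K_def)
    moreover have "closedin (top_of_set (sphere 0 1)) (sphere 0 1 \<inter> (\<lambda>x. cmod (ev F x)) -` {R})"
      by (rule continuous_closedin_preimage[OF continuous_on_norm[OF ev_sphere_continuous]]) simp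
    ultimately show ?thesis using closedin_compact[of "sphere (0::complex) 1"] by simp
  qed
  moreover have "continuous_on K \<phi>"
    unfolding \<phi>_def using R_pos
    by (intro continuous_on_divide continuous_on_const continuous_on_subset[OF ev_sphere_continuous]) (auto simp: K_def)
  moreover have unit: "cmod (\<phi> x) = 1" if "x \<in> K" for x
    using that R_pos by (simp add: K_def \<phi>_def norm_divide)
  moreover have "\<tau> (\<phi> x) = x" if "x \<in> K" for x
  proof -
    have "x \<in> A (\<phi> x)" using that R_pos by (simp add: A_def K_def \<phi>_def)
    then show ?thesis using \<tau>A[OF unit[OF that]] A_unique[OF unit[OF that]] by blast
  qed
  ultimately have "continuous_on (\<phi> ` K) \<tau>" by (intro continuous_on_inv) auto
  moreover have AK: "\<tau> a \<in> K" "\<phi> (\<tau> a) = a" if "cmod a = 1" for a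
    using \<tau>A[OF that] that R_pos by (auto simp: A_def K_def \<phi>_def norm_mult)
  then have "sphere 0 1 \<subseteq> \<phi> ` K" by force
  ultimately have "continuous_on (sphere 0 1) \<tau>" by (rule continuous_on_subset)
  moreover have "inj_on \<tau> (sphere 0 1)" by (rule inj_on_inverseI[of _ \<phi>]) (simp add: AK)
  moreover have "\<tau> a \<in> sphere 0 1" if "a \<in> sphere 0 1" for a using AK(1)[of a] that by (simp add: K_def)
  ultimately have "\<tau> ` sphere 0 1 = sphere 0 1" by (rule circle_injection_surj)
  then obtain a where "cmod a = 1" "x = \<tau> a" using assms by (metis imageE mem_sphere_0)
  then show ?thesis using AK(1)[of a] by (simp add: K_def)
qed

lemma F_inj: "cmod x = 1 \<Longrightarrow> cmod y = 1 \<Longrightarrow> ev F x = ev F y \<Longrightarrow> x = y"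
proof -
  assume x: "cmod x = 1" and y: "cmod y = 1" and eq: "ev F x = ev F y"
  define a where "a = ev F x / of_real R"
  have "cmod a = 1" using F_unimodular[OF x] R_pos by (simp add: a_def norm_divide)
  moreover have "x \<in> A a" "y \<in> A a" using x y eq R_pos by (simp_all add: A_def a_def)
  ultimately show ?thesis using A_unique by blast
qed

end

lemma analytic_prod_zero:
  fixes f g :: "complex \<Rightarrow> complex"
  assumes S: "open S" "connected S" and f: "f holomorphic_on S" and g: "g holomorphic_on S"
    and 0: "\<And>z. z \<in> S \<Longrightarrow> f z * g z = 0"
  shows "(\<forall>z\<in>S. f z = 0) \<or> (\<forall>z\<in>S. g z = 0)"
proof (rule ccontr)
  assume "\<not> ?thesis"
  then obtain z0 where z0: "z0 \<in> S" "f z0 \<noteq> 0" and "\<not> (\<forall>z\<in>S. g z = 0)" by blast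
  define V where "V = S \<inter> f -` (- {0})"
  have "open V"
    unfolding V_def using holomorphic_on_imp_continuous_on[OF f] S(1)
    by (intro continuous_open_preimage) auto
  moreover have "z0 \<in> V" using z0 by (simp add: V_def)
  moreover have "g z = 0" if "z \<in> V" for z using 0[of z] that by (simp add: V_def)
  ultimately have "g w = 0" if "w \<in> S" for w
    using analytic_continuation_open[of V S g "\<lambda>_. 0" w] S g that by (auto simp: V_def)
  then show False using \<open>\<not> (\<forall>z\<in>S. g z = 0)\<close> by blast
qed

lemma constant_if_Re_constant:
  assumes f: "f holomorphic_on ball 0 1" and Re: "\<And>z. z \<in> ball 0 1 \<Longrightarrow> Re (f z) = r"
  shows "f constant_on ball 0 1"
proof (rule ccontr)
  assume "\<not> ?thesis"
  then have "open (f ` ball 0 1)"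
    using open_mapping_thm[OF f] by simp
  moreover have "f 0 \<in> f ` ball 0 1" by simp
  ultimately obtain e where e: "e > 0" "ball (f 0) e \<subseteq> f ` ball 0 1" by (meson openE)
  have "f 0 + of_real (e / 2) \<in> ball (f 0) e" using e(1) by (simp add: dist_norm)
  then obtain z where "z \<in> ball 0 1" "f 0 + of_real (e / 2) = f z" using e(2) by blast
  then have "Re (f z) = Re (f 0) + e / 2" by (metis Re_complex_of_real plus_complex.sel(1))
  then show False using Re[of z] Re[of 0] \<open>z \<in> ball 0 1\<close> e(1) by simp
qed

text \<open>Rescaling reduces to a unit coefficient and \<open>F_inj\<close>. The general
  \<open>\<mu>\<close> is required because the affine preimage in \<open>P_infinite\<close> comes
  with an unknown coefficient.\<close>

lemma (in const_iso) image_linear_inj: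
  assumes "\<mu> \<noteq> 0" "cmod x = 1" "cmod y = 1" "ev (L (lin 0 \<mu>)) x = ev (L (lin 0 \<mu>)) y"
  shows "x = y"
proof -
  define b where "b = \<mu> / cmod \<mu>"
  interpret linear_image L b "L (lin 0 b)" "sr 1 (L (lin 0 b))"
    by unfold_locales (use assms(1) in \<open>simp_all add: b_def norm_divide\<close>)
  have "lin 0 \<mu> = cmod \<mu> *\<^sub>R lin 0 b" using assms(1) by (simp add: lin_simps b_def)
  then have "L (lin 0 \<mu>) = cmod \<mu> *\<^sub>R L (lin 0 b)" by (simp add: iso(6))
  then show ?thesis using assms F_inj[of x y] by simp
qed

section \<open>Peak points of the boundary derivative\<close>

context linear_image
begin

lemma F_unimodular': "x \<in> sphere 0 1 \<Longrightarrow> cmod (ev F x) = R"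
  using F_unimodular by simp

lemma dF: "continuous_on (cball 0 1) (dx F)" "\<And>z. z \<in> ball 0 1 \<Longrightarrow> dx F z = dv F z"
  using dx_continuous[OF R_pos F_unimodular'] dx_ball[OF R_pos F_unimodular'] by blast+

lemma R_dn: "R + dn F = 2"
  using sr_dn[of 1 "lin 0 b"] by (simp add: F R sr_linear b)

definition P :: "complex set" where
  "P = {x. cmod x = 1 \<and> cmod (dx F x) = dn F}"

text \<open>The triangle inequality discards the phases. Nothing is lost in the application, where
  \<open>D\<close> vanishes on the set \<open>P\<close> near which the supremum
  concentrates.\<close>

lemma dn_image_le:
  assumes D: "continuous_on (cball 0 1) D" "\<And>z. z \<in> ball 0 1 \<Longrightarrow> D z = dv g z"
  shows "dn (g + real n *\<^sub>R F) \<le> (SUP x\<in>sphere 0 1. cmod (D x) + real n * cmod (dx F x))"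
proof -
  have "continuous_on (cball 0 1) (\<lambda>z. D z + of_real (real n) * dx F z)"
    by (intro continuous_on_add continuous_on_mult continuous_on_const D dF)
  moreover have "D z + of_real (real n) * dx F z = dv (g + real n *\<^sub>R F) z" if "z \<in> ball 0 1" for z
    using D(2)[OF that] dF(2)[OF that] that by (simp add: dv_simps)
  ultimately obtain x where x: "x \<in> sphere 0 1" "cmod (D x + of_real (real n) * dx F x) = dn (g + real n *\<^sub>R F)"
    using dn_extension_attained[of "\<lambda>z. D z + of_real (real n) * dx F z"] by blast
  have "bdd_above ((\<lambda>x. cmod (D x) + real n * cmod (dx F x)) ` sphere 0 1)"
    by (intro bounded_imp_bdd_above compact_imp_bounded compact_continuous_image continuous_intros
        continuous_on_subset[OF D(1)] continuous_on_subset[OF dF(1)]) auto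
  then have "cmod (D x) + real n * cmod (dx F x) \<le> (SUP x\<in>sphere 0 1. cmod (D x) + real n * cmod (dx F x))"
    using x(1) by (rule cSUP_upper[rotated])
  moreover have "cmod (D x + of_real (real n) * dx F x) \<le> cmod (D x) + real n * cmod (dx F x)"
    using norm_triangle_ineq[of "D x" "of_real (real n) * dx F x"] by (simp add: norm_mult)
  ultimately show ?thesis using x(2) by simp
qed

text \<open>Apply \<open>sr_dn\<close> to \<open>f + n b z\<close> and to \<open>- f + n b z\<close>
  and add. The value parts cancel in the limit because their peak sets are single points, and near
  \<open>P\<close> the derivative of \<open>L f\<close> contributes nothing. What remains bounds the
  oscillation of \<open>Re (cnj b * f')\<close> by 0, so \<open>f'\<close> is constant.\<close>

lemma linear_if_derivative_vanishes_on_P: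
  assumes D: "continuous_on (cball 0 1) D" "\<And>z. z \<in> ball 0 1 \<Longrightarrow> D z = dv (L f) z"
    and 0: "\<And>x. x \<in> P \<Longrightarrow> D x = 0"
  shows "\<exists>k \<mu>. f = lin k \<mu>"
proof -
  let ?s = "\<lambda>n. SUP x\<in>sphere 0 1. cmod (D x) + real n * cmod (dx F x)"
  have P: "P = {x\<in>sphere 0 1. cmod (dx F x) = dn F}" by (auto simp: P_def)
  have "P \<noteq> {}" using dn_extension_attained[OF dF] by (auto simp: P_def)
  have "(\<lambda>n. ?s n - real n * dn F) \<longlonglongrightarrow> (SUP x\<in>P. cmod (D x))"
  proof (rule perturbed_sup_limit[OF _ _ _ _ P \<open>P \<noteq> {}\<close>])
    show "continuous_on (sphere 0 1) (\<lambda>x. cmod (dx F x))" "continuous_on (sphere 0 1) (\<lambda>x. cmod (D x))"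
      by (intro continuous_on_norm continuous_on_subset[OF D(1)] continuous_on_subset[OF dF(1)]; force)+
    show "cmod (dx F x) \<le> dn F" if "x \<in> sphere 0 1" for x
      using that by (intro dn_extension_le[OF dF]) auto
  qed simp
  moreover have "(SUP x\<in>P. cmod (D x)) = 0" using 0 \<open>P \<noteq> {}\<close> by simp
  ultimately have lim_s: "(\<lambda>n. ?s n - real n * dn F) \<longlonglongrightarrow> 0" by simp
  have dn_g: "dn (L f + real n *\<^sub>R F) \<le> ?s n" "dn (- L f + real n *\<^sub>R F) \<le> ?s n" for n
  proof -
    show "dn (L f + real n *\<^sub>R F) \<le> ?s n" by (rule dn_image_le[OF D])
    have "continuous_on (cball 0 1) (\<lambda>z. - D z)" by (intro continuous_on_minus D)
    moreover have "- D z = dv (- L f) z" if "z \<in> ball 0 1" for z using D(2)[OF that] that by (simp add: dv_simps)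
    ultimately show "dn (- L f + real n *\<^sub>R F) \<le> ?s n" using dn_image_le[of "\<lambda>z. - D z" "- L f" n] by simp
  qed
  define G where "G f n = sr 1 (f + real n *\<^sub>R lin 0 b) - real n" for f n
  define H where "H g n = sr 1 (g + real n *\<^sub>R F) - real n * R" for g n
  have "G f \<longlonglongrightarrow> Re (ev f (cnj b))" "G (- f) \<longlonglongrightarrow> - Re (ev f (cnj b))"
    using sr_add_large_linear[of 1 b f] sr_add_large_linear[of 1 b "- f"] b unfolding G_def by simp_all
  then have "(\<lambda>n. G f n + G (- f) n) \<longlonglongrightarrow> Re (ev f (cnj b)) + - Re (ev f (cnj b))" by (rule tendsto_add)
  moreover have "(\<lambda>n. H (L f) n + H (- L f) n) \<longlonglongrightarrow> M 1 (L f) + M 1 (- L f)"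
    unfolding H_def by (intro tendsto_add sr_add_large_F) simp_all
  moreover have "M 1 (L f) + M 1 (- L f) = 0"
  proof -
    obtain x where x: "x \<in> A 1" using A_nonempty[of 1] by auto
    then have "A 1 = {x}" using A_unique[of 1] by auto
    moreover have "cmod x = 1" using x by (simp add: A_def)
    ultimately show ?thesis by (simp add: M_def)
  qed
  ultimately have lim: "(\<lambda>n. (H (L f) n + H (- L f) n) - (G f n + G (- f) n) + 2 * (?s n - real n * dn F)) \<longlonglongrightarrow> 0 - 0 + 2 * 0"
    by (intro tendsto_add tendsto_diff tendsto_mult tendsto_const lim_s) simp_all
  have key: "Re (cnj b * dv f z) - Re (cnj b * dv f z') \<le> 0" if z: "z \<in> ball 0 1" "z' \<in> ball 0 1" for z z'
  proof (rule LIMSEQ_le_const)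
    show "(\<lambda>n. (H (L f) n + H (- L f) n) - (G f n + G (- f) n) + 2 * (?s n - real n * dn F)) \<longlonglongrightarrow> 0"
      using lim by simp
    \<comment> \<open>The lower bound uses points inside the disk, because the derivative of
      \<open>f\<close> may lack boundary values.\<close>
    have low: "Re (cnj b * dv h z) + real n \<le> dn (h + real n *\<^sub>R lin 0 b)" if z: "z \<in> ball 0 1" for h z n
    proof -
      have "cnj b * dv (h + real n *\<^sub>R lin 0 b) z = cnj b * dv h z + of_real (real n) * (cnj b * b)"
        using z by (simp add: dv_simps dv_lin algebra_simps)
      then have "Re (cnj b * dv h z) + real n = Re (cnj b * dv (h + real n *\<^sub>R lin 0 b) z)"
        using cmod_cnj_self(1)[OF b] by simp
      also have "\<dots> \<le> cmod (cnj b * dv (h + real n *\<^sub>R lin 0 b) z)" by (rule complex_Re_le_cmod)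
      also have "\<dots> \<le> dn (h + real n *\<^sub>R lin 0 b)" using dn_ge[OF z] b by (simp add: norm_mult)
      finally show ?thesis .
    qed
    have "Re (cnj b * dv f z) - Re (cnj b * dv f z')
        \<le> (H (L f) n + H (- L f) n) - (G f n + G (- f) n) + 2 * (?s n - real n * dn F)" for n
    proof -
      have "G f n + real n + dn (f + real n *\<^sub>R lin 0 b) = H (L f) n + real n * R + dn (L f + real n *\<^sub>R F)"
        using sr_dn[of 1 "f + real n *\<^sub>R lin 0 b"] by (simp add: G_def H_def iso(4,6) F)
      moreover have "G (- f) n + real n + dn (- f + real n *\<^sub>R lin 0 b) = H (- L f) n + real n * R + dn (- L f + real n *\<^sub>R F)"
        using sr_dn[of 1 "- f + real n *\<^sub>R lin 0 b"] by (simp add: G_def H_def iso(4,5,6,8) F)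
      moreover have "Re (cnj b * dv (- f) z') = - Re (cnj b * dv f z')" using z(2) by (simp add: dv_simps)
      \<comment> \<open>By \<open>R_dn\<close> the linear growth is \<open>2 n\<close> on both sides
        and cancels.\<close>
      moreover have "real n * R + real n * dn F = 2 * real n"
        using R_dn by (metis distrib_left mult.commute)
      ultimately show ?thesis
        using low[OF z(1), of f n] low[OF z(2), of "- f" n] dn_g[of n] by (simp add: algebra_simps)
    qed
    then show "\<exists>N. \<forall>n\<ge>N. Re (cnj b * dv f z) - Re (cnj b * dv f z')
        \<le> (H (L f) n + H (- L f) n) - (G f n + G (- f) n) + 2 * (?s n - real n * dn F)" by blast
  qed
  have "(\<lambda>z. cnj b * dv f z) constant_on ball 0 1"
  proof (rule constant_if_Re_constant)
    show "(\<lambda>z. cnj b * dv f z) holomorphic_on ball 0 1" by (intro holomorphic_intros dv_holomorphic)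
    show "Re (cnj b * dv f z) = Re (cnj b * dv f 0)" if "z \<in> ball 0 1" for z
      using key[OF that, of 0] key[of 0, OF _ that] by simp
  qed
  then obtain c where c: "\<And>z. z \<in> ball 0 1 \<Longrightarrow> cnj b * dv f z = c" by (auto simp: constant_on_def)
  have "dv f z = b * c" if "z \<in> ball 0 1" for z
    using c[OF that] cmod_cnj_self(2)[OF b] by (metis mult.assoc mult_1)
  then show ?thesis using lin_if_dv_const by blast
qed

text \<open>If \<open>P\<close> were finite, a nonzero polynomial with critical points on
  \<open>P\<close> would have an affine preimage. Its values would then be a constant plus the image
  of some \<open>\<mu> z\<close>, which is injective on the circle unless
  \<open>\<mu> = 0\<close>.\<close>

lemma P_infinite: "infinite P"
proof
  assume "finite P"
  \<comment> \<open>Squaring gives double zeros, so the derivative of \<open>h\<close> vanishes on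
    \<open>P\<close>. The added roots 1 and \<open>- 1\<close> are two points of the circle with
    equal values, which forces \<open>\<mu> = 0\<close>.\<close>
  define q where "q z = (z - 1) * (z + 1) * (\<Prod>\<xi>\<in>P. z - \<xi>)" for z
  define h where "h z = q z * q z" for z
  have holq: "q holomorphic_on UNIV" unfolding q_def by (intro holomorphic_intros)
  then have holh: "h holomorphic_on UNIV" unfolding h_def by (intro holomorphic_intros)
  have dh: "deriv h z = q z * deriv q z + deriv q z * q z" for z
    unfolding h_def using holq by (intro deriv_mult) (auto simp: holomorphic_on_imp_differentiable_at)
  obtain f where f: "L f = mk h" using iso(2) by (metis surj_def)
  have "\<exists>k \<mu>. f = lin k \<mu>"
  proof (rule linear_if_derivative_vanishes_on_P)
    have "deriv h holomorphic_on UNIV" using holh by (simp add: holomorphic_deriv)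
    then show "continuous_on (cball 0 1) (deriv h)"
      by (intro continuous_on_subset[OF holomorphic_on_imp_continuous_on]) auto
    show "deriv h z = dv (L f) z" if "z \<in> ball 0 1" for z unfolding f using dv_mk[OF holh that] by simp
    show "deriv h x = 0" if "x \<in> P" for x
    proof -
      have "q x = 0" using that \<open>finite P\<close> by (auto simp: q_def)
      then show ?thesis by (simp add: dh)
    qed
  qed
  then obtain k \<mu> where "f = lin k 0 + lin 0 \<mu>" by (auto simp: lin_simps)
  then have g: "mk h = lin k 0 + L (lin 0 \<mu>)" using f by (simp add: iso(4) const)
  have evh: "ev (mk h) x = h x" if "cmod x = 1" for x using that by (simp add: ev_mk[OF holh])
  have z: "ev (mk h) 1 = 0" "ev (mk h) (- 1) = 0" by (simp_all add: evh h_def q_def)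
  have "\<mu> = 0"
  proof (rule ccontr)
    assume "\<mu> \<noteq> 0"
    moreover have "ev (L (lin 0 \<mu>)) 1 = ev (L (lin 0 \<mu>)) (- 1)"
    proof -
      have "k + ev (L (lin 0 \<mu>)) 1 = k + ev (L (lin 0 \<mu>)) (- 1)" using z unfolding g by simp
      then show ?thesis by simp
    qed
    ultimately show False using image_linear_inj[of \<mu> 1 "- 1"] by simp
  qed
  then have "mk h = lin k 0" using g by (simp add: iso(7) lin_simps(5))
  then have "mk h = lin 0 0" using z(1) by simp
  then have "h x = 0" if "cmod x = 1" for x using evh[OF that] that by simp
  then have zero: "x - 1 = 0 \<or> x + 1 = 0 \<or> (\<exists>\<xi>\<in>P. x - \<xi> = 0)" if "cmod x = 1" for x
    using that \<open>finite P\<close> by (simp add: h_def q_def)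
  have "sphere 0 1 \<subseteq> insert 1 (insert (- 1) P)"
  proof
    fix x :: complex assume "x \<in> sphere 0 1"
    then show "x \<in> insert 1 (insert (- 1) P)"
      using zero[of x] by (auto simp: eq_neg_iff_add_eq_0)
  qed
  then have "finite (sphere (0::complex) 1)" using \<open>finite P\<close> finite_subset by blast
  moreover have "connected (sphere (0::complex) 1)" by (rule connected_sphere) simp
  ultimately obtain a where "sphere (0::complex) 1 = {} \<or> sphere (0::complex) 1 = {a}"
    using connected_finite_iff_sing by blast
  moreover have "(1::complex) \<in> sphere 0 1" "(-1::complex) \<in> sphere 0 1" by simp_all
  ultimately show False by (metis empty_iff singletonD one_neq_neg_one)
qed

text \<open>At a point of \<open>P\<close> the real number \<open>e\<close> has modulus
  \<open>dn F / R\<close>, so it is one of two opposite values. Such points accumulate, hence the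
  identity theorem makes \<open>e\<close> constant near a limit point, and the equation spreads over
  the upper half plane.\<close>

lemma log_derivative_constant:
  obtains \<kappa> :: real where "\<And>w. 0 < Im w \<Longrightarrow> dv F (exp (\<i> * w)) * exp (\<i> * w) = \<kappa> * fn F (exp (\<i> * w))"
proof -
  have "P \<subseteq> sphere 0 1" by (auto simp: P_def)
  then obtain x0 where x0: "cmod x0 = 1" "x0 islimpt P"
    using P_infinite compact_eq_Bolzano_Weierstrass[of "sphere (0::complex) 1"] by force
  then obtain t where t: "x0 = cis t" using sphere_cis[of x0] by auto
  obtain \<epsilon> e where e: "\<epsilon> > 0" "e holomorphic_on ball (complex_of_real t) \<epsilon>"
    "\<And>w. w \<in> ball (complex_of_real t) \<epsilon> \<Longrightarrow> 0 < Im w \<Longrightarrow>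
         dv F (exp (\<i> * w)) * exp (\<i> * w) = e w * fn F (exp (\<i> * w))"
    "\<And>s. complex_of_real s \<in> ball (complex_of_real t) \<epsilon> \<Longrightarrow>
         e (complex_of_real s) \<in> \<real> \<and> dx F (cis s) * cis s = e (complex_of_real s) * ev F (cis s)"
    using dx_log_derivative[OF R_pos F_unimodular', of t] by blast
  define c where "c = dn F / R"
  define B where "B = ball (complex_of_real t) \<epsilon>"
  define Z where "Z = {complex_of_real s | s. complex_of_real s \<in> B \<and> cis s \<in> P}"
  have prod0: "(e w - of_real c) * (e w + of_real c) = 0" if "w \<in> Z" for w
  proof -
    obtain s where s: "w = complex_of_real s" "w \<in> B" "cis s \<in> P" using \<open>w \<in> Z\<close> by (auto simp: Z_def)
    then have r: "e w \<in> \<real>" and eq: "dx F (cis s) * cis s = e w * ev F (cis s)" using e(4)[of s] by (simp_all add: B_def)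
    have "cmod (dx F (cis s) * cis s) = cmod (e w * ev F (cis s))" by (simp only: eq)
    then have "dn F = cmod (e w) * R" using s(3) F_unimodular[of "cis s"] by (simp add: norm_mult P_def)
    then have "cmod (e w) = c" using R_pos by (simp add: c_def)
    moreover obtain y where y: "e w = complex_of_real y" using r by (auto elim: Reals_cases)
    ultimately have "y = c \<or> y = - c" by (auto simp: abs_if split: if_splits)
    then show ?thesis by (auto simp: y)
  qed
  have "complex_of_real t islimpt Z"
    unfolding islimpt_approachable
  proof (intro allI impI)
    fix d :: real assume "d > 0"
    \<comment> \<open>A continuous angle near \<open>x0\<close> with value \<open>t\<close> at
      \<open>x0\<close>; it lifts the points of \<open>P\<close> close to \<open>x0\<close> to real
      points close to \<open>t\<close>.\<close>
    define s where "s x = t + Im (Ln (x / x0))" for x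
    have "x0 \<noteq> 0" using x0(1) by auto
    have "isCont s x0" unfolding s_def using \<open>x0 \<noteq> 0\<close> by (intro continuous_intros) auto
    moreover have "s x0 = t" using \<open>x0 \<noteq> 0\<close> by (simp add: s_def)
    ultimately have "\<exists>\<delta>>0. \<forall>x. dist x x0 < \<delta> \<longrightarrow> dist (s x) t < min d \<epsilon>"
      using \<open>d > 0\<close> e(1) unfolding continuous_at_eps_delta by (metis min_less_iff_conj)
    then obtain \<delta> where \<delta>: "\<delta> > 0" "\<And>x. dist x x0 < \<delta> \<Longrightarrow> dist (s x) t < min d \<epsilon>" by blast
    obtain x where x: "x \<in> P" "x \<noteq> x0" "dist x x0 < \<delta>"
      using x0(2) \<delta>(1) unfolding islimpt_approachable by blast
    have "cmod x = 1" using x(1) by (simp add: P_def)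
    then have "x / x0 \<noteq> 0" "cmod (x / x0) = 1" using x0(1) by (auto simp: norm_divide)
    then have "Ln (x / x0) = \<i> * Im (Ln (x / x0))" by (simp add: complex_eq_iff)
    then have "cis (Im (Ln (x / x0))) = x / x0"
      using exp_Ln[OF \<open>x / x0 \<noteq> 0\<close>] by (simp add: cis_conv_exp)
    then have cs: "cis (s x) = x" using \<open>x0 \<noteq> 0\<close> by (simp add: s_def cis_mult[symmetric] t[symmetric])
    have ds: "dist (complex_of_real (s x)) (complex_of_real t) = dist (s x) t"
      by (simp add: dist_norm flip: of_real_diff)
    have "complex_of_real (s x) \<in> Z"
      using cs x(1) \<delta>(2)[OF x(3)] ds by (auto simp: Z_def B_def dist_commute)
    moreover have "s x \<noteq> t" using cs x(2) t by auto
    ultimately show "\<exists>x'\<in>Z. x' \<noteq> complex_of_real t \<and> dist x' (complex_of_real t) < d"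
      using \<delta>(2)[OF x(3)] ds by (intro bexI[of _ "complex_of_real (s x)"]) auto
  qed
  note limpt = this
  have B: "open B" "connected B" "e holomorphic_on B" using e(2) by (simp_all add: B_def)
  have "(e w - of_real c) * (e w + of_real c) = 0" if "w \<in> B" for w
  proof (rule analytic_continuation[OF _ B(1,2) _ _ limpt, of "\<lambda>w. (e w - of_real c) * (e w + of_real c)"])
    show "(\<lambda>w. (e w - of_real c) * (e w + of_real c)) holomorphic_on B" by (intro holomorphic_intros B)
    show "Z \<subseteq> B" by (auto simp: Z_def)
    show "complex_of_real t \<in> B" using e(1) by (simp add: B_def)
  qed (use prod0 that in simp_all)
  moreover have "(\<lambda>w. e w - of_real c) holomorphic_on B" "(\<lambda>w. e w + of_real c) holomorphic_on B"
    by (intro holomorphic_intros B)+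
  ultimately have "(\<forall>w\<in>B. e w - of_real c = 0) \<or> (\<forall>w\<in>B. e w + of_real c = 0)"
    using analytic_prod_zero[OF B(1,2)] by blast
  then obtain \<kappa> :: real where \<kappa>: "\<And>w. w \<in> B \<Longrightarrow> e w = \<kappa>"
    by (metis eq_iff_diff_eq_0 add_eq_0_iff of_real_minus add.commute)
  \<comment> \<open>Only the half plane is covered, not the real line: there \<open>F\<close> is
    controlled by continuity, not by analyticity of the global equation.\<close>
  have "dv F (exp (\<i> * w)) * exp (\<i> * w) - \<kappa> * fn F (exp (\<i> * w)) = 0" if w: "0 < Im w" for w
  proof (rule analytic_continuation_open[where s' = "{w. 0 < Im w}" and s = "B \<inter> {w. 0 < Im w}"
        and f = "\<lambda>w. dv F (exp (\<i> * w)) * exp (\<i> * w) - \<kappa> * fn F (exp (\<i> * w))" and g = "\<lambda>_. 0"])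
    show "open (B \<inter> {w. 0 < Im w})" by (simp add: B_def open_halfspace_Im_gt open_Int)
    show "open {w. 0 < Im w}" by (rule open_halfspace_Im_gt)
    have "complex_of_real t + \<i> * of_real (\<epsilon> / 2) \<in> B \<inter> {w. 0 < Im w}"
      using e(1) by (simp add: B_def dist_norm norm_mult)
    then show "B \<inter> {w. 0 < Im w} \<noteq> {}" by blast
    show "connected {w. 0 < Im w}" by (intro convex_connected convex_halfspace_Im_gt)
    have 1: "(\<lambda>w. exp (\<i> * w)) holomorphic_on {w. 0 < Im w}" by (intro holomorphic_intros)
    have 2: "(\<lambda>w. exp (\<i> * w)) ` {w. 0 < Im w} \<subseteq> ball 0 1" using exp_i_ball by blast
    have "(\<lambda>w. dv F (exp (\<i> * w))) holomorphic_on {w. 0 < Im w}"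
      using holomorphic_on_compose_gen[OF 1 dv_holomorphic 2] by (simp add: o_def)
    moreover have "(\<lambda>w. fn F (exp (\<i> * w))) holomorphic_on {w. 0 < Im w}"
      using holomorphic_on_compose_gen[OF 1 fn_holomorphic 2] by (simp add: o_def)
    ultimately show "(\<lambda>w. dv F (exp (\<i> * w)) * exp (\<i> * w) - \<kappa> * fn F (exp (\<i> * w))) holomorphic_on {w. 0 < Im w}"
      by (intro holomorphic_intros)
    show "dv F (exp (\<i> * z)) * exp (\<i> * z) - \<kappa> * fn F (exp (\<i> * z)) = 0" if "z \<in> B \<inter> {w. 0 < Im w}" for z
      using e(3)[of z] \<kappa>[of z] that by (simp add: B_def)
  qed (use w in auto)
  then show thesis by (intro that[of \<kappa>]) (simp only: right_minus_eq)
qed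

text \<open>The equation \<open>z F' = \<kappa> F\<close> integrates to
  \<open>F = C * exp (\<i> * \<kappa> * w)\<close>. Boundedness gives
  \<open>\<kappa> \<ge> 0\<close>, single-valuedness makes it an integer, and injectivity on the
  circle leaves only 1.\<close>

theorem F_rotation: "\<exists>C. cmod C = 1 \<and> F = lin 0 C"
proof -
  obtain \<kappa> :: real where \<kappa>: "\<And>w. 0 < Im w \<Longrightarrow> dv F (exp (\<i> * w)) * exp (\<i> * w) = \<kappa> * fn F (exp (\<i> * w))"
    using log_derivative_constant by metis
  \<comment> \<open>The exponential is the inverse of a solution of the equation, so the product is
    constant; \<open>ev\<close> instead of \<open>fn\<close> extends it continuously to real
    \<open>w\<close>.\<close>
  define \<Phi> where "\<Phi> w = ev F (exp (\<i> * w)) * exp (- (\<i> * \<kappa> * w))" for w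
  have "\<exists>C. \<forall>w\<in>{w. 0 < Im w}. fn F (exp (\<i> * w)) * exp (- (\<i> * \<kappa> * w)) = C"
  proof (rule has_field_derivative_zero_constant)
    show "convex {w. 0 < Im w}" by (rule convex_halfspace_Im_gt)
    fix w assume "w \<in> {w. 0 < Im w}"
    then have w: "0 < Im w" by simp
    have d1: "((\<lambda>w. fn F (exp (\<i> * w))) has_field_derivative dv F (exp (\<i> * w)) * (exp (\<i> * w) * \<i>)) (at w)"
    proof (rule DERIV_chain2[where f = "fn F" and g = "\<lambda>w. exp (\<i> * w)"])
      show "(fn F has_field_derivative dv F (exp (\<i> * w))) (at (exp (\<i> * w)))"
        by (rule has_dv[OF exp_i_ball[OF w]])
      show "((\<lambda>w. exp (\<i> * w)) has_field_derivative exp (\<i> * w) * \<i>) (at w)"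
        by (auto intro!: derivative_eq_intros)
    qed
    have d2: "((\<lambda>w. exp (- (\<i> * \<kappa> * w))) has_field_derivative exp (- (\<i> * \<kappa> * w)) * (- (\<i> * \<kappa>))) (at w)"
      by (auto intro!: derivative_eq_intros)
    have "dv F (exp (\<i> * w)) * (exp (\<i> * w) * \<i>) * exp (- (\<i> * \<kappa> * w))
        + exp (- (\<i> * \<kappa> * w)) * (- (\<i> * \<kappa>)) * fn F (exp (\<i> * w))
      = (dv F (exp (\<i> * w)) * exp (\<i> * w) - \<kappa> * fn F (exp (\<i> * w))) * \<i> * exp (- (\<i> * \<kappa> * w))"
      by (simp add: algebra_simps)
    also have "\<dots> = 0" using \<kappa>[OF w] by simp
    finally have "((\<lambda>w. fn F (exp (\<i> * w)) * exp (- (\<i> * \<kappa> * w))) has_field_derivative 0) (at w)"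
      by (rule DERIV_cong[OF DERIV_mult[OF d1 d2]])
    then show "((\<lambda>w. fn F (exp (\<i> * w)) * exp (- (\<i> * \<kappa> * w))) has_field_derivative 0) (at w within {w. 0 < Im w})"
      by (rule has_field_derivative_at_within)
  qed
  then obtain C where C: "\<And>w. 0 < Im w \<Longrightarrow> fn F (exp (\<i> * w)) * exp (- (\<i> * \<kappa> * w)) = C" by auto
  have C': "\<Phi> (complex_of_real s) = C" for s
  proof -
    have "continuous_on {w. 0 \<le> Im w} \<Phi>"
      unfolding \<Phi>_def
      by (intro continuous_intros continuous_on_compose2[OF ev_continuous]) (auto simp: norm_exp_eq_Re)
    moreover have "(\<lambda>n. complex_of_real s + \<i> * of_real (inverse (real (Suc n)))) \<longlonglongrightarrow> complex_of_real s + \<i> * of_real 0"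
      by (intro tendsto_intros LIMSEQ_inverse_real_of_nat)
    ultimately have "(\<lambda>n. \<Phi> (complex_of_real s + \<i> * of_real (inverse (real (Suc n))))) \<longlonglongrightarrow> \<Phi> (complex_of_real s)"
      unfolding continuous_on_sequentially by (auto simp: o_def)
    moreover have "\<Phi> (complex_of_real s + \<i> * of_real (inverse (real (Suc n)))) = C" for n
    proof -
      let ?w = "complex_of_real s + \<i> * of_real (inverse (real (Suc n)))"
      have im: "0 < Im ?w" by simp
      show ?thesis unfolding \<Phi>_def ev_ball[OF exp_i_ball[OF im]] by (rule C[OF im])
    qed
    ultimately show ?thesis by (simp add: LIMSEQ_const_iff)
  qed
  have circ: "ev F (cis s) = C * exp (\<i> * \<kappa> * complex_of_real s)" for s
  proof -
    have "ev F (cis s) = \<Phi> (complex_of_real s) * exp (\<i> * \<kappa> * complex_of_real s)"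
      by (simp add: \<Phi>_def cis_conv_exp mult.assoc flip: exp_add)
    then show ?thesis by (simp add: C')
  qed
  have CR: "cmod C = R"
    using F_unimodular[of "cis 0"] circ[of 0] by simp
  then have "C \<noteq> 0" using R_pos by auto
  \<comment> \<open>A negative exponent would make \<open>F\<close> unbounded near the origin, which
    corresponds to \<open>w\<close> high on the imaginary axis.\<close>
  have "\<kappa> \<ge> 0"
  proof (rule ccontr)
    assume "\<not> ?thesis"
    then have "\<kappa> < 0" by simp
    have bound: "R * exp (- \<kappa> * y) \<le> sn F" if "y > 0" for y :: real
    proof -
      let ?w = "\<i> * complex_of_real y"
      have im: "0 < Im ?w" using that by simp
      have "fn F (exp (\<i> * ?w)) = C * exp (\<i> * \<kappa> * ?w)"
        using C[OF im] by (simp add: exp_minus field_simps)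
      then have "cmod (fn F (exp (\<i> * ?w))) = R * exp (- \<kappa> * y)"
        by (simp add: norm_mult CR norm_exp_eq_Re)
      then show ?thesis using sn_ge[OF exp_i_ball[OF im], of F] by simp
    qed
    \<comment> \<open>Chosen so that the exponent is \<open>sn F / R + 1\<close>; the bound
      \<open>1 + x \<le> exp x\<close> then already exceeds \<open>sn F / R\<close>.\<close>
    define y where "y = (sn F / R + 1) / (- \<kappa>)"
    have "sn F / R \<ge> 0" using R_pos sn_nonneg by simp
    then have "y > 0" unfolding y_def using \<open>\<kappa> < 0\<close> by (intro divide_pos_pos) simp_all
    have "1 + (sn F / R + 1) \<le> exp (sn F / R + 1)" by (rule exp_ge_add_one_self)
    moreover have "- \<kappa> * y = sn F / R + 1" using \<open>\<kappa> < 0\<close> by (simp add: y_def)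
    ultimately have "R * (sn F / R + 2) \<le> R * exp (- \<kappa> * y)"
      using R_pos by (intro mult_left_mono) simp_all
    also have "\<dots> \<le> sn F" by (rule bound[OF \<open>y > 0\<close>])
    finally have "sn F + 2 * R \<le> sn F" using R_pos by (simp add: distrib_left)
    then show False using R_pos by simp
  qed
  have eq1: "cis s = 1" if "exp (\<i> * \<kappa> * complex_of_real s) = 1" for s
    using F_inj[of "cis s" "cis 0"] circ[of s] circ[of 0] that by simp
  have "exp (\<i> * \<kappa> * complex_of_real (2 * pi)) = 1"
    using circ[of "2 * pi"] circ[of 0] \<open>C \<noteq> 0\<close> by simp
  then have "\<kappa> \<in> \<int>"
  proof -
    have "cis (2 * pi * \<kappa>) = 1"
      using \<open>exp (\<i> * \<kappa> * complex_of_real (2 * pi)) = 1\<close> by (simp add: cis_conv_exp mult_ac)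
    then have "cos (2 * pi * \<kappa>) = 1" by (metis cis.sel(1) one_complex.sel(1))
    then obtain n :: int where "2 * pi * \<kappa> = of_int n * 2 * pi" by (auto simp: cos_one_2pi_int)
    then show ?thesis by simp
  qed
  then obtain m :: int where m: "\<kappa> = of_int m" by (auto elim: Ints_cases)
  have "m \<noteq> 0"
  proof
    assume "m = 0"
    then show False using eq1[of pi] m by simp
  qed
  moreover have "m < 2"
  proof (rule ccontr)
    assume "\<not> m < 2"
    then have k: "\<kappa> \<ge> 2" by (simp add: m)
    \<comment> \<open>At this angle, which is at most \<open>pi\<close>, the exponential has
      returned to 1 too early for an injective \<open>F\<close>.\<close>
    define s where "s = 2 * pi / \<kappa>"
    have "\<kappa> * s = 2 * pi" using k by (simp add: s_def)
    then have "cis (\<kappa> * s) = 1" by (simp add: cis_2pi)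
    then have "exp (\<i> * \<kappa> * complex_of_real s) = 1" by (simp add: cis_conv_exp mult.assoc)
    then have "cos s = 1" using eq1[of s] by (metis cis.sel(1) one_complex.sel(1))
    moreover have "0 < s" "s \<le> pi" using k by (simp_all add: s_def field_simps)
    ultimately show False using cos_monotone_0_pi[of 0 s] by simp
  qed
  ultimately have "\<kappa> = 1" using \<open>\<kappa> \<ge> 0\<close> m by simp
  have "F = lin 0 C"
  proof (rule sinf_eq_sphere)
    fix x :: complex assume "x \<in> sphere 0 1"
    then have "cmod x = 1" by simp
    obtain s where "x = cis s" using sphere_cis[OF \<open>x \<in> sphere 0 1\<close>] .
    then have "ev F x = C * x" using circ[of s] \<open>\<kappa> = 1\<close> by (simp add: cis_conv_exp)
    then show "ev F x = ev (lin 0 C) x" using \<open>cmod x = 1\<close> by simp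
  qed
  \<comment> \<open>For \<open>F = lin 0 C\<close> the derivative norm is \<open>cmod C = R\<close>,
    and \<open>R + dn F = 2\<close>.\<close>
  moreover from this have "cmod C = 1" using R_dn CR by simp
  ultimately show ?thesis by blast
qed

end

section \<open>Classification of the isometries and pointwise 2-local maps\<close>

lemma fn_Abs: "f \<in> S_inf \<Longrightarrow> fn (Abs_sinf f) = f"
  by (rule Abs_sinf_inverse)

text \<open>For unimodular \<open>l\<close> the points \<open>z\<close> and \<open>l * z\<close>
  leave the disk together, so the zero value off the disk is inherited without a case
  distinction.\<close>

definition rot :: "complex \<Rightarrow> sinf \<Rightarrow> sinf" where
  "rot l f = Abs_sinf (\<lambda>z. fn f (l * z))"

definition cj :: "sinf \<Rightarrow> sinf" where
  "cj f = Abs_sinf (\<lambda>z. cnj (fn f (cnj z)))"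

lemma rot:
  assumes l: "cmod l = 1"
  shows fn_rot: "fn (rot l f) z = fn f (l * z)"
    and dv_rot: "z \<in> ball 0 1 \<Longrightarrow> dv (rot l f) z = l * dv f (l * z)"
proof -
  have d: "((\<lambda>z. fn f (l * z)) has_field_derivative dv f (l * z) * l) (at z)" if "z \<in> ball 0 1" for z
  proof (rule DERIV_chain2[where f = "fn f" and g = "\<lambda>z. l * z"])
    show "(fn f has_field_derivative dv f (l * z)) (at (l * z))"
      using that l by (intro has_dv) (simp add: norm_mult)
    show "((\<lambda>z. l * z) has_field_derivative l) (at z)"
      by (auto intro!: derivative_eq_intros)
  qed
  have S: "(\<lambda>z. fn f (l * z)) \<in> S_inf"
  proof (rule S_infI[OF d])
    show "cmod (dv f (l * z) * l) \<le> dn f" if "z \<in> ball 0 1" for z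
      using dn_ge[of "l * z" f] that l by (simp add: norm_mult)
    show "fn f (l * z) = 0" if "z \<notin> ball 0 1" for z
      using that l by (intro S_inf_zero_off[OF fn]) (simp add: norm_mult)
  qed
  have eq: "fn (rot l f) = (\<lambda>z. fn f (l * z))" unfolding rot_def by (rule fn_Abs[OF S])
  show "fn (rot l f) z = fn f (l * z)" by (simp add: eq)
  show "dv (rot l f) z = l * dv f (l * z)" if "z \<in> ball 0 1"
    by (rule dvI) (use d[OF that] in \<open>simp add: eq mult.commute\<close>)
qed

lemma cj:
  shows fn_cj: "fn (cj f) z = cnj (fn f (cnj z))"
    and dv_cj: "z \<in> ball 0 1 \<Longrightarrow> dv (cj f) z = cnj (dv f (cnj z))"
proof -
  have d: "((\<lambda>z. cnj (fn f (cnj z))) has_field_derivative cnj (dv f (cnj z))) (at z)" if "z \<in> ball 0 1" for z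
    using has_field_derivative_cnj_cnj[OF has_dv[of "cnj z" f]] that by (simp add: o_def)
  have S: "(\<lambda>z. cnj (fn f (cnj z))) \<in> S_inf"
  proof (rule S_infI[OF d])
    show "cmod (cnj (dv f (cnj z))) \<le> dn f" if "z \<in> ball 0 1" for z
      using dn_ge[of "cnj z" f] that by simp
    show "cnj (fn f (cnj z)) = 0" if "z \<notin> ball 0 1" for z
      using S_inf_zero_off[OF fn, of "cnj z" f] that by simp
  qed
  have eq: "fn (cj f) = (\<lambda>z. cnj (fn f (cnj z)))" unfolding cj_def by (rule fn_Abs[OF S])
  show "fn (cj f) z = cnj (fn f (cnj z))" by (simp add: eq)
  show "dv (cj f) z = cnj (dv f (cnj z))" if "z \<in> ball 0 1"
    by (rule dvI) (use d[OF that] in \<open>simp add: eq\<close>)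
qed

lemma cmul_inverse: "cmod c = 1 \<Longrightarrow> cmul (cnj c) (cmul c f) = f" "cmod c = 1 \<Longrightarrow> cmul c (cmul (cnj c) f) = f"
  by (rule sinf_eqI; simp add: mult.assoc[symmetric] cmod_cnj_self)+

lemma rot_inverse: "cmod l = 1 \<Longrightarrow> rot (cnj l) (rot l f) = f" "cmod l = 1 \<Longrightarrow> rot l (rot (cnj l) f) = f"
  by (rule sinf_eqI; simp add: fn_rot mult.assoc[symmetric] cmod_cnj_self)+

lemma cj_inverse: "cj (cj f) = f"
  by (rule sinf_eqI) (simp add: fn_cj)

lemma lin_images:
  "cmod l = 1 \<Longrightarrow> rot l (lin a b) = lin a (l * b)" "cj (lin a b) = lin (cnj a) (cnj b)"
  by (rule sinf_eqI; simp add: fn_rot fn_cj fn_lin norm_mult mult_ac)+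

lemma lin_isoI:
  assumes "linear L" "\<And>f. L (K f) = f" "\<And>f. K (L f) = f"
    and "\<And>f. norm (L f) \<le> norm f" "\<And>f. norm (K f) \<le> norm f"
  shows "lin_iso L"
  unfolding lin_iso_def
proof (intro conjI allI)
  show "surj L" using assms(2) by (metis surj_def)
  show "norm (L f) = norm f" for f
    using assms(4)[of f] assms(5)[of "L f"] assms(3)[of f] by simp
qed (rule assms(1))

lemma lin_iso_cmul:
  assumes "cmod c = 1"
  shows "lin_iso (cmul c)"
proof (rule lin_isoI[where K = "cmul (cnj c)"])
  show "linear (cmul c)" by (rule linearI; rule sinf_eqI; simp add: algebra_simps)
qed (use assms in \<open>simp_all add: cmul_inverse norm_sinf sn_cmul dn_cmul\<close>)

lemma lin_iso_rot:
  assumes l: "cmod l = 1"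
  shows "lin_iso (rot l)"
proof (rule lin_isoI[where K = "rot (cnj l)"])
  show "linear (rot l)" by (rule linearI; rule sinf_eqI; simp add: fn_rot l)
  have le: "norm (rot k f) \<le> norm f" if k: "cmod k = 1" for k f
  proof -
    have "sn (rot k f) \<le> sn f"
      by (rule sn_le) (use k in \<open>simp add: fn_rot sn_ge norm_mult\<close>)
    moreover have "dn (rot k f) \<le> dn f"
      by (rule dn_le) (use k in \<open>simp add: dv_rot dn_ge norm_mult\<close>)
    ultimately show ?thesis by (simp add: norm_sinf)
  qed
  show "norm (rot l f) \<le> norm f" "norm (rot (cnj l) f) \<le> norm f" for f
    using le l by simp_all
  show "rot l (rot (cnj l) f) = f" "rot (cnj l) (rot l f) = f" for f
    using l by (simp_all add: rot_inverse)
qed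

lemma lin_iso_cj: "lin_iso cj"
proof (rule lin_isoI[where K = cj])
  show "linear cj" by (rule linearI; rule sinf_eqI; simp add: fn_cj)
  show le: "norm (cj f) \<le> norm f" for f
  proof -
    have "sn (cj f) \<le> sn f" by (rule sn_le) (simp add: fn_cj sn_ge)
    moreover have "dn (cj f) \<le> dn f" by (rule dn_le) (simp add: dv_cj dn_ge)
    ultimately show ?thesis by (simp add: norm_sinf)
  qed
  show "norm (cj f) \<le> norm f" for f by (rule le)
qed (simp_all add: cj_inverse)

lemma lin_iso_comp:
  assumes "lin_iso K" "lin_iso L"
  shows "lin_iso (\<lambda>f. K (L f))"
  using assms linear_compose[of L K] comp_surj[of L K] by (simp add: lin_iso_def o_def)

text \<open>Both exclusions of conjugation would force a cubic term in \<open>cnj \<beta>\<close> to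
  behave like a real-linear function of \<open>\<beta>\<close>. The values at 1 and
  \<open>\<i>\<close> fix that function, and \<open>cis (pi / 4)\<close>, where the cube is
  \<open>- \<beta>\<close>, contradicts it.\<close>

lemma eighth_root:
  obtains \<beta> where "cmod \<beta> = 1" "cnj \<beta> ^ 3 = - \<beta>" "Re \<beta> \<noteq> 0"
proof -
  define \<beta> where "\<beta> = cis (pi / 4)"
  have "cnj \<beta> ^ 3 = cis (- (pi / 4)) ^ 3" by (simp add: \<beta>_def cis_cnj)
  also have "\<dots> = cis (real 3 * - (pi / 4))" by (rule Complex.DeMoivre)
  also have "\<dots> = cis (pi / 4 - pi)" by (rule arg_cong[where f = cis]) simp
  also have "\<dots> = cis (pi / 4) / cis pi" by (simp only: cis_divide)
  also have "\<dots> = - \<beta>" by (simp add: \<beta>_def)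
  finally have "cnj \<beta> ^ 3 = - \<beta>" .
  moreover have "Re \<beta> \<noteq> 0" by (simp add: \<beta>_def cos_45)
  moreover have "cmod \<beta> = 1" by (simp add: \<beta>_def)
  ultimately show thesis using that by blast
qed

lemma sn_lin_linear [simp]: "sn (lin 0 b) = cmod b"
proof (rule antisym)
  show "sn (lin 0 b) \<le> cmod b" by (rule sn_le_sphere) (simp add: norm_mult)
  show "cmod b \<le> sn (lin 0 b)" using ev_le_sn[of 1 "lin 0 b"] by simp
qed

section \<open>Isometries fixing the constants are rotations\<close>

context const_iso
begin

lemma image_linear:
  obtains l where "cmod l = 1" "\<And>b. L (lin 0 b) = lin 0 (l * b)"
    | l where "cmod l = 1" "\<And>b. L (lin 0 b) = lin 0 (l * cnj b)"
proof -
  define \<phi> where "\<phi> b = dv (L (lin 0 b)) 0" for b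
  have all: "L (lin 0 b) = lin 0 (\<phi> b)" for b
  proof (cases "b = 0")
    case True
    then show ?thesis using iso(7) by (simp add: \<phi>_def lin_simps dv_simps)
  next
    case False
    define u where "u = b / cmod b"
    interpret linear_image L u "L (lin 0 u)" "sr 1 (L (lin 0 u))"
      by unfold_locales (use False in \<open>simp_all add: u_def norm_divide\<close>)
    obtain C where "L (lin 0 u) = lin 0 C" using F_rotation by blast
    moreover have eq: "lin 0 b = cmod b *\<^sub>R lin 0 u" using False by (simp add: lin_simps u_def)
    moreover have "L (lin 0 b) = cmod b *\<^sub>R L (lin 0 u)" unfolding eq by (rule iso(6))
    ultimately have "L (lin 0 b) = lin 0 (of_real (cmod b) * C)" by (simp only: lin_simps) simp
    then show ?thesis by (simp add: \<phi>_def dv_lin)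
  qed
  have "cmod (\<phi> a - \<phi> b) = cmod (a - b)" for a b
  proof -
    have "norm (L (lin 0 a - lin 0 b)) = norm (lin 0 a - lin 0 b)" by (rule iso(3))
    then show ?thesis unfolding iso(5) all by (simp add: lin_simps norm_sinf)
  qed
  moreover have "\<phi> 0 = 0" using iso(7) by (simp add: \<phi>_def lin_simps dv_simps)
  ultimately show thesis using plane_isometry[of \<phi>] that all by metis
qed

text \<open>The limit argument of \<open>M_diff\<close>, now with single peak points on both sides:
  it compares individual boundary values of \<open>f\<close> and \<open>L f\<close>.\<close>

lemma boundary_relation:
  assumes b: "cmod b = 1" and d: "cmod d = 1" "L (lin 0 b) = lin 0 d"
    and a: "cmod a = 1" "cmod a' = 1"
  shows "Re (cnj a * ev f (a * cnj b)) - Re (cnj a' * ev f (a' * cnj b))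
    = Re (cnj a * ev (L f) (a * cnj d)) - Re (cnj a' * ev (L f) (a' * cnj d))"
proof -
  have 1: "(\<lambda>n. (sr a (f + real n *\<^sub>R lin 0 b) - real n) - (sr a' (f + real n *\<^sub>R lin 0 b) - real n))
      \<longlonglongrightarrow> Re (cnj a * ev f (a * cnj b)) - Re (cnj a' * ev f (a' * cnj b))"
    by (intro tendsto_diff sr_add_large_linear a b)
  have 2: "(\<lambda>n. (sr a (f + real n *\<^sub>R lin 0 b) - real n) - (sr a' (f + real n *\<^sub>R lin 0 b) - real n))
    = (\<lambda>n. (sr a (L f + real n *\<^sub>R lin 0 d) - real n) - (sr a' (L f + real n *\<^sub>R lin 0 d) - real n))"
    using sr_diff[OF a, of "f + real n *\<^sub>R lin 0 b" for n] by (simp add: fun_eq_iff iso(4,6) d)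
  have 3: "(\<lambda>n. (sr a (L f + real n *\<^sub>R lin 0 d) - real n) - (sr a' (L f + real n *\<^sub>R lin 0 d) - real n))
      \<longlonglongrightarrow> Re (cnj a * ev (L f) (a * cnj d)) - Re (cnj a' * ev (L f) (a' * cnj d))"
    by (intro tendsto_diff sr_add_large_linear a d)
  show ?thesis by (rule LIMSEQ_unique[OF 1[unfolded 2] 3])
qed

text \<open>With \<open>a = x * b\<close> the boundary relation says that
  \<open>Re (cnj b * h x)\<close> does not depend on \<open>x\<close>. Differences between
  directions thus determine \<open>L f - f\<close> only up to a multiple of \<open>z\<close>, and a
  second argument must remove that multiple.\<close>

lemma identity_if_linear_fixed:
  assumes fixed: "\<And>b. L (lin 0 b) = lin 0 b"
  shows "L f = f"
proof -
  define H where "H = L f - f"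
  define h where "h x = cnj x * ev H x" for x
  have rel: "Re (cnj b * h x) = Re (cnj b * h 1)" if x: "cmod x = 1" and b: "cmod b = 1" for x b
  proof -
    have n: "cmod (x * b) = 1" "cmod (1 * b) = 1" using x b by (simp_all add: norm_mult)
    have "cnj (y * b) * ev H (y * b * cnj b) = cnj b * h y" for y
      using b by (simp add: h_def mult.assoc cmod_cnj_self)
    moreover have "cmod (y * b * cnj b) = 1" if "cmod y = 1" for y using that b by (simp add: norm_mult)
    then have "ev H (y * b * cnj b) = ev (L f) (y * b * cnj b) - ev f (y * b * cnj b)" if "cmod y = 1" for y
      using that unfolding H_def by simp
    ultimately have "Re (cnj b * h y) = Re (cnj (y * b) * ev (L f) (y * b * cnj b)) - Re (cnj (y * b) * ev f (y * b * cnj b))"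
      if "cmod y = 1" for y using that by (metis minus_complex.sel(1) right_diff_distrib)
    from this[OF x] this[of 1] show ?thesis
      using boundary_relation[OF b b fixed n, of f] by (simp del: complex_cnj_mult times_complex.sel)
  qed
  have "h x = h 1" if "cmod x = 1" for x
    using rel[OF that, of 1] rel[OF that, of \<i>] by (simp add: complex_eq_iff)
  then have "ev H x = x * h 1" if "cmod x = 1" for x
    using that by (metis cmod_cnj_self(2) h_def mult.assoc mult_1)
  then have "H = lin 0 (h 1)" by (intro sinf_eq_sphere) (simp add: mult.commute)
  then have Lf: "L f = f + lin 0 (h 1)" by (simp add: H_def algebra_simps)
  \<comment> \<open>The \<open>n\<close>-th iterate of \<open>L\<close> sends \<open>f\<close> to
    \<open>f + n * h 1 * z\<close> and keeps its norm, which for large \<open>n\<close> forces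
    \<open>h 1 = 0\<close>.\<close>
  have "norm (f + real n *\<^sub>R lin 0 (h 1)) = norm f" for n
  proof (induction n)
    case (Suc n)
    have "norm (L (f + real n *\<^sub>R lin 0 (h 1))) = norm f" using Suc iso(3) by simp
    moreover have "L (f + real n *\<^sub>R lin 0 (h 1)) = f + real (Suc n) *\<^sub>R lin 0 (h 1)"
      by (simp add: iso(4,6) fixed Lf scaleR_left_distrib add_ac)
    ultimately show ?case by simp
  qed simp
  then have bound: "real n * norm (lin 0 (h 1)) \<le> 2 * norm f" for n
    using norm_triangle_ineq4[of "f + real n *\<^sub>R lin 0 (h 1)" f] by simp
  have "norm (lin 0 (h 1)) = 0"
  proof (rule ccontr)
    assume "norm (lin 0 (h 1)) \<noteq> 0"
    then have "norm (lin 0 (h 1)) > 0" by simp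
    then obtain n where "2 * norm f < real n * norm (lin 0 (h 1))" using reals_Archimedean3 by blast
    then show False using bound[of n] by simp
  qed
  then show ?thesis using Lf by simp
qed

text \<open>Tested on \<open>z^2\<close>, the relations for \<open>b = 1\<close> and
  \<open>b = \<i>\<close> determine \<open>L f\<close> on the circle up to a multiple of
  \<open>z\<close>, and the relation for an eighth root of unity contradicts the result.\<close>

lemma not_conjugating:
  assumes conj: "\<And>b. L (lin 0 b) = lin 0 (cnj b)"
  shows False
proof -
  define f where "f = mk (\<lambda>z. z ^ 2)"
  have evf: "ev f x = x ^ 2" if "cmod x = 1" for x
    unfolding f_def using that by (intro ev_mk) (auto intro!: holomorphic_intros)
  define h where "h y = cnj y * ev (L f) y" for y
  have rel: "Re (cnj b ^ 3 * y - b * h y) = Re (cnj b ^ 3 - b * h 1)" if y: "cmod y = 1" and b: "cmod b = 1" for y b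
  proof -
    \<comment> \<open>With \<open>a = x * cnj b\<close> the image side is evaluated at
      \<open>x\<close> for every \<open>b\<close>, while \<open>z^2\<close> is evaluated at
      \<open>x * cnj b ^ 2\<close>.\<close>
    have n: "cmod (x * cnj b) = 1" if "cmod x = 1" for x using that b by (simp add: norm_mult)
    have 1: "cnj (x * cnj b) * ev f (x * cnj b * cnj b) = cnj b ^ 3 * x" if "cmod x = 1" for x
    proof -
      have "ev f (x * cnj b * cnj b) = (x * cnj b * cnj b) ^ 2" using that b by (intro evf) (simp add: norm_mult)
      then have "cnj (x * cnj b) * ev f (x * cnj b * cnj b) = (cnj x * x) * (b * cnj b) * (cnj b ^ 3 * x)"
        by (simp add: power2_eq_square power3_eq_cube mult_ac)
      then show ?thesis using that b by (simp add: cmod_cnj_self)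
    qed
    have 2: "cnj (x * cnj b) * ev (L f) (x * cnj b * cnj (cnj b)) = b * h x" for x
      using b by (simp add: h_def mult.assoc cmod_cnj_self)
    have "Re (cnj b ^ 3 * y) - Re (cnj b ^ 3 * 1) = Re (b * h y) - Re (b * h 1)"
      using boundary_relation[OF b _ conj n[OF y] n[of 1], of f] b
      unfolding 2 1[OF y] 1[OF norm_one] by simp
    then show ?thesis by (simp del: times_complex.sel)
  qed
  have hy: "h y = y + (h 1 - 1)" if y: "cmod y = 1" for y
    using rel[OF y, of 1] rel[OF y, of \<i>] by (simp add: complex_eq_iff power3_eq_cube)
  obtain \<beta> where \<beta>: "cmod \<beta> = 1" "cnj \<beta> ^ 3 = - \<beta>" "Re \<beta> \<noteq> 0" by (rule eighth_root)
  have "Re (- \<beta> * y - \<beta> * (y + (h 1 - 1))) = Re (- \<beta> - \<beta> * h 1)" if "cmod y = 1" for y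
    using rel[OF that \<beta>(1)] unfolding hy[OF that] \<beta>(2) .
  \<comment> \<open>The left side varies with \<open>y\<close> through
    \<open>Re (- 2 * \<beta> * y)\<close>, so \<open>y = - 1\<close> forces
    \<open>Re \<beta> = 0\<close>.\<close>
  from this[of "- 1"] show False using \<beta>(3) by (simp add: algebra_simps)
qed

theorem const_iso_rot:
  obtains l where "cmod l = 1" "\<And>f. L f = rot l f"
proof (cases rule: image_linear)
  case (1 l)
  interpret K: const_iso "\<lambda>f. rot (cnj l) (L f)"
    by unfold_locales (use 1 const lin_iso_comp[OF lin_iso_rot L, of "cnj l"] in \<open>simp_all add: lin_images\<close>)
  have "rot (cnj l) (L f) = f" for f
    by (rule K.identity_if_linear_fixed) (use 1 in \<open>simp add: lin_images mult.assoc[symmetric] cmod_cnj_self\<close>)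
  then show thesis using that[of l] 1 rot_inverse(2)[of l] by metis
next
  case (2 l)
  interpret K: const_iso "\<lambda>f. rot (cnj l) (L f)"
    by unfold_locales (use 2 const lin_iso_comp[OF lin_iso_rot L, of "cnj l"] in \<open>simp_all add: lin_images\<close>)
  have False
    by (rule K.not_conjugating) (use 2 in \<open>simp add: lin_images mult.assoc[symmetric] cmod_cnj_self\<close>)
  then show thesis ..
qed

end

text \<open>After division by \<open>c\<close>, and composition with \<open>cj\<close> if constants
  are conjugated, the map fixes the constants and is a rotation.\<close>

theorem lin_iso_form:
  assumes L: "lin_iso L"
  obtains c l where "cmod c = 1" "cmod l = 1" "(\<forall>f. L f = cmul c (rot l f)) \<or> (\<forall>f. L f = cmul c (cj (rot l f)))"
proof (cases rule: lin_iso_constants[OF L])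
  case (1 c)
  interpret const_iso "\<lambda>f. cmul (cnj c) (L f)"
    by unfold_locales
      (use 1 lin_iso_comp[OF lin_iso_cmul L, of "cnj c"] in \<open>simp_all add: lin_simps mult.assoc[symmetric] cmod_cnj_self\<close>)
  obtain l where "cmod l = 1" "\<And>f. cmul (cnj c) (L f) = rot l f" using const_iso_rot by blast
  then show thesis using that[of c l] 1 cmul_inverse(2)[of c] by metis
next
  case (2 c)
  interpret const_iso "\<lambda>f. cj (cmul (cnj c) (L f))"
    by unfold_locales
      (use 2 lin_iso_comp[OF lin_iso_cj lin_iso_comp[OF lin_iso_cmul L, of "cnj c"]]
        in \<open>simp_all add: lin_images lin_simps mult.assoc[symmetric] cmod_cnj_self\<close>)
  obtain l where "cmod l = 1" "\<And>f. cj (cmul (cnj c) (L f)) = rot l f" using const_iso_rot by blast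
  then show thesis using that[of c l] 2 cmul_inverse(2)[of c] cj_inverse by metis
qed

section \<open>The modulus condition on concentric circles\<close>

definition circle_modulus :: "(sinf \<Rightarrow> sinf) \<Rightarrow> bool" where
  "circle_modulus t \<longleftrightarrow> (\<forall>f g. \<forall>x\<in>ball 0 1. \<exists>y. cmod y = cmod x \<and>
     cmod (fn (t f) x - fn (t g) x) = cmod (fn f y - fn g y))"

lemma circle_modulusD:
  assumes "circle_modulus t" "x \<in> ball 0 1"
  obtains y where "y \<in> ball 0 1" "cmod y = cmod x" "cmod (fn (t f) x - fn (t g) x) = cmod (fn f y - fn g y)"
  using assms unfolding circle_modulus_def by (metis mem_ball_0)

lemma circle_modulus_comp:
  assumes "circle_modulus s" "circle_modulus t"
  shows "circle_modulus (\<lambda>f. s (t f))"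
  unfolding circle_modulus_def
proof (intro allI ballI)
  fix f g and x :: complex assume "x \<in> ball 0 1"
  then obtain y where "y \<in> ball 0 1" "cmod y = cmod x"
    "cmod (fn (s (t f)) x - fn (s (t g)) x) = cmod (fn (t f) y - fn (t g) y)"
    by (rule circle_modulusD[OF assms(1)])
  moreover obtain z where "z \<in> ball 0 1" "cmod z = cmod y"
    "cmod (fn (t f) y - fn (t g) y) = cmod (fn f z - fn g z)"
    by (rule circle_modulusD[OF assms(2) \<open>y \<in> ball 0 1\<close>])
  ultimately show "\<exists>y. cmod y = cmod x \<and> cmod (fn (s (t f)) x - fn (s (t g)) x) = cmod (fn f y - fn g y)"
    by metis
qed

lemma circle_modulus_cmul:
  assumes "cmod c = 1"
  shows "circle_modulus (cmul c)"
  unfolding circle_modulus_def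
proof (intro allI ballI exI conjI)
  show "cmod (fn (cmul c f) x - fn (cmul c g) x) = cmod (fn f x - fn g x)" for f g x
    using assms by (simp add: norm_mult flip: right_diff_distrib)
qed simp

lemma circle_modulus_rot:
  assumes "cmod l = 1"
  shows "circle_modulus (rot l)"
  unfolding circle_modulus_def
proof (intro allI ballI exI conjI)
  show "cmod (l * x) = cmod x" for x using assms by (simp add: norm_mult)
  show "cmod (fn (rot l f) x - fn (rot l g) x) = cmod (fn f (l * x) - fn g (l * x))" for f g x
    using assms by (simp add: fn_rot)
qed

lemma circle_modulus_cj: "circle_modulus cj"
  unfolding circle_modulus_def
proof (intro allI ballI exI conjI)
  show "cmod (cnj x) = cmod x" for x by simp
  show "cmod (fn (cj f) x - fn (cj g) x) = cmod (fn f (cnj x) - fn g (cnj x))" for f g x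
    unfolding fn_cj complex_cnj_diff[symmetric] complex_mod_cnj ..
qed

text \<open>A unimodular factor and conjugation of the value preserve the modulus of a difference;
  rotation and conjugation of the argument move \<open>x\<close> along its circle.\<close>

lemma circle_modulus_lin_iso:
  assumes "lin_iso L"
  shows "circle_modulus L"
proof -
  obtain c l where c: "cmod c = 1" "cmod l = 1"
    "(\<forall>f. L f = cmul c (rot l f)) \<or> (\<forall>f. L f = cmul c (cj (rot l f)))"
    by (rule lin_iso_form[OF assms])
  have "circle_modulus (\<lambda>f. cmul c (rot l f))"
    by (rule circle_modulus_comp[OF circle_modulus_cmul[OF c(1)] circle_modulus_rot[OF c(2)]])
  moreover have "circle_modulus (\<lambda>f. cmul c (cj (rot l f)))"
    by (rule circle_modulus_comp[OF circle_modulus_cmul[OF c(1)]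
          circle_modulus_comp[OF circle_modulus_cj circle_modulus_rot[OF c(2)]]])
  ultimately show ?thesis using c(3) by (auto simp: circle_modulus_def)
qed

lemma constant_if_modulus_constant:
  assumes "\<And>z. z \<in> ball 0 1 \<Longrightarrow> cmod (fn f z) = r"
  shows "f = lin (fn f 0) 0"
proof -
  have "fn f constant_on ball 0 1"
    by (rule maximum_modulus_principle[where U = "ball 0 1" and \<xi> = 0]) (use assms fn_holomorphic in auto)
  then obtain c where "\<And>z. z \<in> ball 0 1 \<Longrightarrow> fn f z = c" by (auto simp: constant_on_def)
  then show ?thesis by (intro sinf_eqI) (simp add: fn_lin)
qed

text \<open>For \<open>r > 0\<close> this is the equality case of the Schwarz lemma for
  \<open>f / r\<close>, with 1/2 as a point where equality holds.\<close>

lemma linear_if_modulus_linear: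
  assumes "\<And>z. z \<in> ball 0 1 \<Longrightarrow> cmod (fn f z) = r * cmod z"
  shows "f = lin 0 (dv f 0)"
proof -
  have "\<exists>\<beta>. f = lin 0 \<beta>"
  proof (cases "r > 0")
    case False
    have "fn f z = fn (lin 0 0) z" if "z \<in> ball 0 1" for z
    proof -
      have "r * cmod z \<le> 0" using False by (simp add: mult_nonpos_nonneg)
      then have "cmod (fn f z) \<le> 0" using assms[OF that] by linarith
      then show ?thesis by (simp only: fn_lin[OF that]) simp
    qed
    then show ?thesis using sinf_eqI by metis
  next
    case True
    have n: "cmod (fn f z / of_real r) = cmod z" if "cmod z < 1" for z
      using assms[of z] that True by (simp add: norm_divide)
    have "\<exists>\<alpha>. (\<forall>z. norm z < 1 \<longrightarrow> fn f z / of_real r = \<alpha> * z) \<and> norm \<alpha> = 1"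
    proof (rule Schwarz_Lemma(3)[of "\<lambda>z. fn f z / of_real r" 0])
      show "(\<lambda>z. fn f z / of_real r) holomorphic_on ball 0 1"
        using True by (intro holomorphic_intros fn_holomorphic) auto
      show "fn f 0 / of_real r = 0" using n[of 0] by simp
      have "cmod (1 / 2) < 1 \<and> (1 / 2 :: complex) \<noteq> 0 \<and> cmod (fn f (1 / 2) / of_real r) = cmod (1 / 2)"
        using n[of "1 / 2"] by simp
      then show "(\<exists>z. cmod z < 1 \<and> z \<noteq> 0 \<and> cmod (fn f z / of_real r) = cmod z)
          \<or> cmod (deriv (\<lambda>z. fn f z / of_real r) 0) = 1" by blast
    qed (simp_all only: n norm_zero zero_less_one)
    then obtain \<alpha> where "\<And>z. cmod z < 1 \<Longrightarrow> fn f z / of_real r = \<alpha> * z" by blast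
    then have "f = lin 0 (of_real r * \<alpha>)"
      using True by (intro sinf_eqI) (simp add: fn_lin field_simps)
    then show ?thesis by blast
  qed
  then show ?thesis by (metis dv_lin centre_in_ball zero_less_one)
qed

text \<open>As \<open>s\<close> grows, \<open>u * y - w * x\<close> must tend to 0, so
  \<open>y\<close> approaches \<open>y0\<close> along the circle of radius \<open>cmod x\<close>.
  Since \<open>cnj u * (fn f y - A)\<close> is \<open>s * (y - y0)\<close> and short chords are
  nearly tangent, its component in the radial direction of \<open>y0\<close> vanishes in the
  limit.\<close>

lemma tangential_limit:
  assumes u: "cmod u = 1" and w: "cmod w = 1" and x: "x \<in> ball 0 1"
    and ex: "\<And>s::real. s > 0 \<Longrightarrow> \<exists>y. cmod y = cmod x \<and> fn f y - A = of_real s * (u * y - w * x)"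
  defines "y0 \<equiv> cnj u * w * x"
  shows "Re (cnj y0 * cnj u * (fn f y0 - A)) = 0"
proof -
  have "\<exists>y. \<forall>n. cmod (y n) = cmod x \<and> fn f (y n) - A = of_real (real (Suc n)) * (u * y n - w * x)"
    by (intro choice allI ex) simp
  then obtain y where y: "\<And>n. cmod (y n) = cmod x" "\<And>n. fn f (y n) - A = of_real (real (Suc n)) * (u * y n - w * x)"
    by blast
  have uy0: "u * y0 = w * x" using cmod_cnj_self(2)[OF u] by (simp add: y0_def mult.assoc[symmetric])
  have y0: "cmod y0 = cmod x" using u w by (simp add: y0_def norm_mult)
  then have y0b: "y0 \<in> ball 0 1" using x by simp
  define e where "e n = y n - y0" for n
  have e: "fn f (y n) - A = of_real (real (Suc n)) * u * e n" for n
    unfolding y(2) uy0[symmetric] e_def by (simp add: algebra_simps)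
  define C where "C = sn f + cmod A"
  have eC: "real (Suc n) * cmod (e n) \<le> C" for n
  proof -
    have "real (Suc n) * cmod (e n) = cmod (fn f (y n) - A)" unfolding e using u by (simp only: norm_mult norm_of_real)
    also have "\<dots> \<le> cmod (fn f (y n)) + cmod A" by (rule norm_triangle_ineq4)
    also have "\<dots> \<le> C" using sn_ge[of "y n" f] x y(1)[of n] by (simp add: C_def)
    finally show ?thesis .
  qed
  have "C \<ge> 0" by (simp add: C_def sn_nonneg)
  have inv0: "(\<lambda>n. C * inverse (real (Suc n))) \<longlonglongrightarrow> C * 0"
    by (intro tendsto_mult tendsto_const LIMSEQ_inverse_real_of_nat)
  have eC': "cmod (e n) \<le> C * inverse (real (Suc n))" for n
    using eC[of n] by (simp add: field_simps)
  have "e \<longlonglongrightarrow> 0"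
    by (rule Lim_null_comparison[OF always_eventually[OF allI[OF eC']]]) (use inv0 in simp)
  then have "(\<lambda>n. e n + y0) \<longlonglongrightarrow> 0 + y0" by (intro tendsto_intros)
  then have "y \<longlonglongrightarrow> y0" by (simp add: e_def)
  moreover have "isCont (fn f) y0" using has_dv[OF y0b, of f] by (rule DERIV_isCont)
  ultimately have "(\<lambda>n. fn f (y n)) \<longlonglongrightarrow> fn f y0" by (rule isCont_tendsto_compose[rotated])
  then have lim: "(\<lambda>n. Re (cnj y0 * cnj u * (fn f (y n) - A))) \<longlonglongrightarrow> Re (cnj y0 * cnj u * (fn f y0 - A))"
    by (intro tendsto_intros)
  \<comment> \<open>The radial component of a chord is quadratic in its length, while
    \<open>eC\<close> only lets the factor \<open>n + 1\<close> compensate one of the two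
    powers.\<close>
  have tang: "Re (cnj y0 * e n) = - (cmod (e n))\<^sup>2 / 2" for n
  proof -
    have "(cmod (y0 + e n))\<^sup>2 = (cmod y0)\<^sup>2" using y(1)[of n] y0 by (simp add: e_def)
    then show ?thesis unfolding cmod_power2 by (simp add: power2_eq_square algebra_simps)
  qed
  have "norm (Re (cnj y0 * cnj u * (fn f (y n) - A))) \<le> C * (C * inverse (real (Suc n)))" for n
  proof -
    have "cnj y0 * cnj u * (fn f (y n) - A) = of_real (real (Suc n)) * (cnj u * u) * (cnj y0 * e n)"
      unfolding e by (simp only: mult_ac)
    also have "\<dots> = of_real (real (Suc n)) * (cnj y0 * e n)" by (simp add: cmod_cnj_self u)
    finally have "Re (cnj y0 * cnj u * (fn f (y n) - A)) = real (Suc n) * Re (cnj y0 * e n)"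
      by (simp only: Re_complex_of_real times_complex.sel Im_complex_of_real)
    also have "\<dots> = - (real (Suc n) * cmod (e n)) * cmod (e n) / 2" unfolding tang by (simp add: power2_eq_square)
    finally have "norm (Re (cnj y0 * cnj u * (fn f (y n) - A))) = (real (Suc n) * cmod (e n)) * cmod (e n) / 2"
      by (simp add: abs_mult)
    also have "\<dots> \<le> (real (Suc n) * cmod (e n)) * cmod (e n)" by simp
    also have "\<dots> \<le> C * (C * inverse (real (Suc n)))" by (intro mult_mono eC eC' \<open>C \<ge> 0\<close>) simp_all
    finally show ?thesis .
  qed
  note bound = this
  have "(\<lambda>n. C * (C * inverse (real (Suc n)))) \<longlonglongrightarrow> 0"
    using tendsto_mult[OF tendsto_const inv0, of C] by simp
  with always_eventually[OF allI[OF bound]]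
  have "(\<lambda>n. Re (cnj y0 * cnj u * (fn f (y n) - A))) \<longlonglongrightarrow> 0"
    by (rule Lim_null_comparison)
  then show ?thesis using LIMSEQ_unique lim by blast
qed

section \<open>Maps with the modulus condition that fix the constants\<close>

locale circle_map =
  fixes t :: "sinf \<Rightarrow> sinf"
  assumes modulus: "circle_modulus t" and const: "\<And>a. t (lin a 0) = lin a 0"
begin

lemma t0: "t 0 = 0" using const[of 0] by (simp add: lin_simps)

text \<open>Comparison with \<open>t 0 = 0\<close> yields the modulus of the image and hence its
  linear form. Comparing two images at the point 1/2 shows that the coefficient map is
  isometric.\<close>

lemma image_linear:
  obtains l where "cmod l = 1" "\<And>b. t (lin 0 b) = lin 0 (l * b)"
    | l where "cmod l = 1" "\<And>b. t (lin 0 b) = lin 0 (l * cnj b)"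
proof -
  define \<phi> where "\<phi> b = dv (t (lin 0 b)) 0" for b
  have all: "t (lin 0 b) = lin 0 (\<phi> b)" for b
    unfolding \<phi>_def
  proof (rule linear_if_modulus_linear)
    fix z :: complex assume "z \<in> ball 0 1"
    then obtain y where "y \<in> ball 0 1" "cmod y = cmod z" "cmod (fn (t (lin 0 b)) z - fn (t 0) z) = cmod (fn (lin 0 b) y - fn 0 y)"
      by (rule circle_modulusD[OF modulus])
    then show "cmod (fn (t (lin 0 b)) z) = cmod b * cmod z" by (simp add: t0 fn_lin norm_mult)
  qed
  have half: "(1 / 2 :: complex) \<in> ball 0 1" by simp
  have "cmod (\<phi> a - \<phi> b) = cmod (a - b)" for a b
  proof -
    obtain y where y: "y \<in> ball 0 1" "cmod y = cmod (1 / 2)"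
      "cmod (fn (t (lin 0 a)) (1 / 2) - fn (t (lin 0 b)) (1 / 2)) = cmod (fn (lin 0 a) y - fn (lin 0 b) y)"
      by (rule circle_modulusD[OF modulus half])
    then have "cmod ((\<phi> a - \<phi> b) * (1 / 2)) = cmod ((a - b) * y)"
      unfolding all fn_lin[OF half] fn_lin[OF y(1)] by (simp add: left_diff_distrib diff_divide_distrib)
    then show ?thesis using y(2) by (simp only: norm_mult) simp
  qed
  moreover have "\<phi> 0 = 0" by (simp add: \<phi>_def lin_simps t0 dv_simps)
  ultimately show thesis using plane_isometry[of \<phi>] that all by metis
qed

text \<open>In place of additivity two comparisons are made: with the constant \<open>a\<close>,
  which shows \<open>t (lin a b) = lin a k\<close>, and with \<open>lin 0 b\<close>, which gives
  \<open>a + (k - d) * z\<close> constant modulus and so \<open>k = d\<close>.\<close>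

lemma image_affine:
  assumes "t (lin 0 b) = lin 0 d"
  shows "t (lin a b) = lin a d"
proof -
  let ?g = "t (lin a b) - lin a 0"
  have "?g = lin 0 (dv ?g 0)"
  proof (rule linear_if_modulus_linear)
    fix z :: complex assume z: "z \<in> ball 0 1"
    then obtain y where "y \<in> ball 0 1" "cmod y = cmod z"
      "cmod (fn (t (lin a b)) z - fn (t (lin a 0)) z) = cmod (fn (lin a b) y - fn (lin a 0) y)"
      by (rule circle_modulusD[OF modulus])
    then show "cmod (fn ?g z) = cmod b * cmod z" by (simp add: const fn_lin norm_mult)
  qed
  then obtain k where "?g = lin 0 k" by blast
  then have k: "t (lin a b) = lin a k" by (simp add: lin_simps diff_eq_eq)
  have "lin a (k - d) = lin (fn (lin a (k - d)) 0) 0"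
  proof (rule constant_if_modulus_constant)
    fix z :: complex assume z: "z \<in> ball 0 1"
    then obtain y where "y \<in> ball 0 1" "cmod y = cmod z"
      "cmod (fn (t (lin a b)) z - fn (t (lin 0 b)) z) = cmod (fn (lin a b) y - fn (lin 0 b) y)"
      by (rule circle_modulusD[OF modulus])
    then show "cmod (fn (lin a (k - d)) z) = cmod a"
      unfolding k assms using z by (simp add: fn_lin algebra_simps)
  qed
  then have "k = d" by simp
  then show ?thesis using k by simp
qed

text \<open>The constant term \<open>?a\<close> is chosen so that \<open>t (lin ?a b)\<close> and
  \<open>t f\<close> agree at \<open>x\<close>. The modulus condition then becomes an exact equation
  between \<open>f\<close> and \<open>lin ?a b\<close> at some \<open>y\<close>.\<close>

lemma line_intersection:
  assumes "t (lin 0 b) = lin 0 d" and x: "x \<in> ball 0 1"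
  obtains y where "cmod y = cmod x" "fn f y - fn (t f) x = b * y - d * x"
proof -
  let ?a = "fn (t f) x - d * x"
  obtain y where y: "y \<in> ball 0 1" "cmod y = cmod x"
    "cmod (fn (t f) x - fn (t (lin ?a b)) x) = cmod (fn f y - fn (lin ?a b) y)"
    by (rule circle_modulusD[OF modulus x])
  then have "fn f y = ?a + b * y"
    unfolding image_affine[OF assms(1)] fn_lin[OF x] fn_lin[OF y(1)] by simp
  then have "fn f y - fn (t f) x = b * y - d * x" by (simp add: algebra_simps)
  then show thesis using that y(2) by blast
qed

text \<open>With \<open>b = s * u\<close> and \<open>s\<close> large, the intersection points
  converge to \<open>x\<close> itself. The tangential limit makes \<open>Re (cnj u * D)\<close>
  vanish for every direction \<open>u\<close>, hence \<open>D = 0\<close>.\<close>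

lemma identity_if_linear_fixed:
  assumes fixed: "\<And>b. t (lin 0 b) = lin 0 b"
  shows "t f = f"
proof (rule sinf_eqI)
  fix x :: complex assume x: "x \<in> ball 0 1"
  show "fn (t f) x = fn f x"
  proof (cases "x = 0")
    case True
    obtain y where "cmod y = cmod x" "fn f y - fn (t f) x = 0 * y - 0 * x"
      by (rule line_intersection[OF fixed x])
    then show ?thesis using True by simp
  next
    case False
    \<comment> \<open>The factor \<open>cnj x\<close> records the radial direction at
      \<open>x\<close>; at the origin it would destroy all information, so that point is treated
      separately.\<close>
    define D where "D = cnj x * (fn f x - fn (t f) x)"
    have "Re (cnj u * D) = 0" if u: "cmod u = 1" for u
    proof -
      have "\<exists>y. cmod y = cmod x \<and> fn f y - fn (t f) x = of_real s * (u * y - u * x)" for s :: real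
      proof -
        obtain y where "cmod y = cmod x" "fn f y - fn (t f) x = of_real s * u * y - of_real s * u * x"
          by (rule line_intersection[OF fixed x])
        then show ?thesis by (metis mult.assoc right_diff_distrib)
      qed
      from tangential_limit[OF u u x this] show ?thesis
        using u by (simp add: D_def cmod_cnj_self mult_ac del: times_complex.sel)
    qed
    from this[of 1] this[of \<i>] have "D = 0" by (simp add: complex_eq_iff)
    then show ?thesis using False by (simp add: D_def)
  qed
qed

text \<open>For \<open>z^2\<close> at the point 1/2 the tangential limit equates
  \<open>Re (cnj u ^ 3)\<close> with a real-linear function of the unit number \<open>u\<close>. For
  \<open>u = cis \<theta>\<close> this would express the cosine of \<open>3 \<theta>\<close> by the
  cosine and sine of \<open>\<theta>\<close>.\<close>

lemma not_conjugating:
  assumes conj: "\<And>b. t (lin 0 b) = lin 0 (cnj b)"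
  shows False
proof -
  define f where "f = mk (\<lambda>z. z ^ 2)"
  have fnf: "fn f z = z ^ 2" if "z \<in> ball 0 1" for z
    unfolding f_def using that by (intro fn_mk) (auto intro!: holomorphic_intros)
  have half: "(1 / 2 :: complex) \<in> ball 0 1" by simp
  define A where "A = fn (t f) (1 / 2)"
  have key: "Re (cnj u ^ 3) = 4 * Re (u * A)" if u: "cmod u = 1" for u
  proof -
    have "\<exists>y. cmod y = cmod (1 / 2) \<and> fn f y - A = of_real s * (u * y - cnj u * (1 / 2))" for s :: real
    proof -
      obtain y where "cmod y = cmod (1 / 2)" "fn f y - A = of_real s * u * y - cnj (of_real s * u) * (1 / 2)"
        unfolding A_def by (rule line_intersection[OF conj half])
      then show ?thesis by (metis complex_cnj_complex_of_real complex_cnj_mult mult.assoc right_diff_distrib)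
    qed
    then have "Re (cnj (cnj u * cnj u * (1 / 2)) * cnj u * (fn f (cnj u * cnj u * (1 / 2)) - A)) = 0"
      by (intro tangential_limit[OF u _ half]) (simp_all only: complex_mod_cnj u)
    moreover define y0 where "y0 = cnj u * cnj u * (1 / 2)"
    ultimately have "Re (cnj y0 * cnj u * (fn f y0 - A)) = 0" by (simp only:)
    moreover have "fn f y0 = y0 ^ 2" by (rule fnf) (use u in \<open>simp add: y0_def norm_mult\<close>)
    moreover have "cnj y0 * cnj u * (y0 ^ 2 - A) = (u * cnj u) * ((u * cnj u) * cnj u ^ 3 / 8 - u * A / 2)"
      by (simp add: y0_def power2_eq_square power3_eq_cube algebra_simps)
    ultimately have "Re (cnj u ^ 3 / 8 - u * A / 2) = 0" by (simp add: cmod_cnj_self(2)[OF u] del: times_complex.sel)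
    then show ?thesis by (simp del: times_complex.sel)
  qed
  have "A = 1 / 4" using key[of 1] key[of \<i>] by (simp add: complex_eq_iff power3_eq_cube)
  obtain \<beta> where \<beta>: "cmod \<beta> = 1" "cnj \<beta> ^ 3 = - \<beta>" "Re \<beta> \<noteq> 0" by (rule eighth_root)
  show False using key[OF \<beta>(1)] \<beta>(3) unfolding \<beta>(2) \<open>A = 1 / 4\<close> by simp
qed

theorem circle_map_rot:
  obtains l where "cmod l = 1" "\<And>f. t f = rot l f"
proof (cases rule: image_linear)
  case (1 l)
  interpret K: circle_map "\<lambda>f. rot (cnj l) (t f)"
    by unfold_locales (use 1 const circle_modulus_comp[OF circle_modulus_rot modulus, of "cnj l"] in \<open>simp_all add: lin_images\<close>)
  have "rot (cnj l) (t f) = f" for f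
    by (rule K.identity_if_linear_fixed) (use 1 in \<open>simp add: lin_images mult.assoc[symmetric] cmod_cnj_self\<close>)
  then show thesis using that[of l] 1 rot_inverse(2)[of l] by metis
next
  case (2 l)
  interpret K: circle_map "\<lambda>f. rot (cnj l) (t f)"
    by unfold_locales (use 2 const circle_modulus_comp[OF circle_modulus_rot modulus, of "cnj l"] in \<open>simp_all add: lin_images\<close>)
  have False
    by (rule K.not_conjugating) (use 2 in \<open>simp add: lin_images mult.assoc[symmetric] cmod_cnj_self\<close>)
  then show thesis ..
qed

end

text \<open>The normalisation is that of \<open>lin_iso_form\<close>, but with pointwise comparisons
  instead of linearity. Linearity and surjectivity emerge together from the explicit formula for
  \<open>t\<close>.\<close>

theorem circle_modulus_imp_lin_iso:
  assumes t: "circle_modulus t" and t0: "t 0 = 0"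
  shows "lin_iso t"
proof -
  define \<phi> where "\<phi> a = fn (t (lin a 0)) 0" for a
  have all: "t (lin a 0) = lin (\<phi> a) 0" for a
    unfolding \<phi>_def
  proof (rule constant_if_modulus_constant)
    fix z :: complex assume z: "z \<in> ball 0 1"
    then obtain y where "y \<in> ball 0 1" "cmod (fn (t (lin a 0)) z - fn (t 0) z) = cmod (fn (lin a 0) y - fn 0 y)"
      by (rule circle_modulusD[OF t])
    then show "cmod (fn (t (lin a 0)) z) = cmod a" by (simp add: t0 fn_lin)
  qed
  have zero: "(0 :: complex) \<in> ball 0 1" by simp
  have "cmod (\<phi> a - \<phi> b) = cmod (a - b)" for a b
  proof -
    obtain y where "y \<in> ball 0 1" "cmod (fn (t (lin a 0)) 0 - fn (t (lin b 0)) 0) = cmod (fn (lin a 0) y - fn (lin b 0) y)"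
      by (rule circle_modulusD[OF t zero])
    then show ?thesis by (simp add: \<phi>_def fn_lin)
  qed
  moreover have "\<phi> 0 = 0" by (simp add: \<phi>_def lin_simps t0)
  ultimately consider c where "cmod c = 1" "\<And>a. \<phi> a = c * a" | c where "cmod c = 1" "\<And>a. \<phi> a = c * cnj a"
    using plane_isometry[of \<phi>] by metis
  then show ?thesis
  proof cases
    case (1 c)
    interpret circle_map "\<lambda>f. cmul (cnj c) (t f)"
      by unfold_locales
        (use 1 circle_modulus_comp[OF circle_modulus_cmul t, of "cnj c"] all in \<open>simp_all add: lin_simps mult.assoc[symmetric] cmod_cnj_self\<close>)
    obtain l where l: "cmod l = 1" "\<And>f. cmul (cnj c) (t f) = rot l f" using circle_map_rot by blast
    then have "t = (\<lambda>f. cmul c (rot l f))" using 1 cmul_inverse(2)[of c] by metis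
    then show ?thesis using lin_iso_comp[OF lin_iso_cmul lin_iso_rot] 1(1) l(1) by metis
  next
    case (2 c)
    interpret circle_map "\<lambda>f. cj (cmul (cnj c) (t f))"
      by unfold_locales
        (use 2 circle_modulus_comp[OF circle_modulus_cj circle_modulus_comp[OF circle_modulus_cmul t, of "cnj c"]] all
          in \<open>simp_all add: lin_images lin_simps mult.assoc[symmetric] cmod_cnj_self\<close>)
    obtain l where l: "cmod l = 1" "\<And>f. cj (cmul (cnj c) (t f)) = rot l f" using circle_map_rot by blast
    then have "t = (\<lambda>f. cmul c (cj (rot l f)))" using 2 cmul_inverse(2)[of c] cj_inverse by metis
    then show ?thesis
      using lin_iso_comp[OF lin_iso_cmul lin_iso_comp[OF lin_iso_cj lin_iso_rot]] 2(1) l(1) by metis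
  qed
qed

section \<open>From isometries and pointwise 2-local maps to the modulus condition\<close>

lemma Iso_S_inf_circle_modulus:
  assumes "U \<in> Iso_S_inf"
  shows "circle_modulus (\<lambda>f. Abs_sinf (U (fn f)))"
proof -
  have im: "U ` S_inf = S_inf" and iso: "\<And>f g. f \<in> S_inf \<Longrightarrow> g \<in> S_inf \<Longrightarrow>
      norm_Sigma (\<lambda>z. U f z - U g z) = norm_Sigma (\<lambda>z. f z - g z)"
    using assms by (auto simp: Iso_S_inf_def)
  define u where "u f = Abs_sinf (U (fn f))" for f
  have fnu: "fn (u f) = U (fn f)" for f
    unfolding u_def using im fn[of f] by (intro fn_Abs) blast
  have norm_diff: "norm (f - g) = norm_Sigma (\<lambda>z. fn f z - fn g z)" for f g :: sinf
    by (simp add: norm_sinf.rep_eq minus_sinf.rep_eq)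
  have isou: "norm (u f - u g) = norm (f - g)" for f g
    unfolding norm_diff fnu by (intro iso fn)
  have "surj u"
  proof -
    have "\<exists>f. g = u f" for g
    proof -
      obtain f where f: "f \<in> S_inf" "U f = fn g" using im fn[of g] by (metis imageE)
      then have "u (Abs_sinf f) = g" by (simp add: u_def fn_Abs fn_inverse)
      then show ?thesis by blast
    qed
    then show ?thesis by (simp add: surj_def)
  qed
  \<comment> \<open>Mazur--Ulam applies after the translation by \<open>u 0\<close>, which cancels
    again in every difference that the modulus condition looks at.\<close>
  define L where "L f = u f - u 0" for f
  have isoL: "norm (L f - L g) = norm (f - g)" for f g using isou by (simp add: L_def)
  have "inj L" using isoL by (intro injI) (metis eq_iff_diff_eq_0 norm_eq_zero)
  moreover have surjL: "surj L"
  proof -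
    have "\<exists>f. g = L f" for g using \<open>surj u\<close> by (metis L_def add_diff_cancel surjD)
    then show ?thesis by (simp add: surj_def)
  qed
  moreover have "L 0 = 0" by (simp add: L_def)
  ultimately have "linear L" using isoL by (intro mazur_ulam) (auto simp: bij_def)
  moreover have "norm (L f) = norm f" for f using isoL[of f 0] \<open>L 0 = 0\<close> by simp
  ultimately have "circle_modulus L" using surjL by (intro circle_modulus_lin_iso) (simp add: lin_iso_def)
  then show ?thesis by (simp add: circle_modulus_def L_def u_def)
qed

theorem corollary19:
  fixes T :: "(complex \<Rightarrow> complex) \<Rightarrow> (complex \<Rightarrow> complex)"
  assumes "T ` S_inf \<subseteq> S_inf"
    and "pointwise_2_local T Iso_S_inf"
  shows "T \<in> Iso_S_inf"
proof -
  define t where "t f = Abs_sinf (T (fn f))" for f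
  have fnt: "fn (t f) = T (fn f)" for f
    unfolding t_def using assms(1) fn[of f] by (intro fn_Abs) blast
  have "circle_modulus t"
    unfolding circle_modulus_def
  proof (intro allI ballI)
    \<comment> \<open>One isometry \<open>U\<close> serves both functions at \<open>x\<close>, so
      its modulus condition for this triple is exactly the one required of \<open>t\<close>.\<close>
    fix f g and x :: complex assume x: "x \<in> ball 0 1"
    then have "x \<in> cball 0 1" by simp
    then obtain U where U: "U \<in> Iso_S_inf" "disk_ext (T (fn f)) x = disk_ext (U (fn f)) x"
      "disk_ext (T (fn g)) x = disk_ext (U (fn g)) x"
      using assms(2) fn[of f] fn[of g] unfolding pointwise_2_local_def by blast
    have US: "U (fn h) \<in> S_inf" for h using U(1) fn[of h] by (auto simp: Iso_S_inf_def)
    have "fn (t h) x = disk_ext (T (fn h)) x" for h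
      using disk_ext_eq[OF fn[of "t h"] x] by (simp add: fnt)
    moreover have "fn (Abs_sinf (U (fn h))) x = disk_ext (U (fn h)) x" for h
      using disk_ext_eq[OF US x] by (simp add: fn_Abs[OF US])
    ultimately show "\<exists>y. cmod y = cmod x \<and> cmod (fn (t f) x - fn (t g) x) = cmod (fn f y - fn g y)"
      using Iso_S_inf_circle_modulus[OF U(1)] x U(2,3) unfolding circle_modulus_def by metis
  qed
  \<comment> \<open>Subtracting \<open>t 0\<close> changes neither the modulus condition nor
    distances and surjectivity.\<close>
  then have "circle_modulus (\<lambda>f. t f - t 0)" by (simp add: circle_modulus_def)
  then have L: "lin_iso (\<lambda>f. t f - t 0)" by (rule circle_modulus_imp_lin_iso) simp
  have iso: "norm (t f - t g) = norm (f - g)" for f g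
    using lin_isoD(3,5)[OF L, of "f - g"] lin_isoD(5)[OF L, of f g] by simp
  have surj: "\<exists>f. t f = g" for g
  proof -
    obtain f where "g - t 0 = t f - t 0" using surjD[OF lin_isoD(2)[OF L], of "g - t 0"] by blast
    then have "t f = g" by simp
    then show ?thesis by blast
  qed
  show ?thesis
    unfolding Iso_S_inf_def
  proof (intro CollectI conjI ballI)
    have "g \<in> T ` S_inf" if "g \<in> S_inf" for g
    proof -
      obtain f where "t f = Abs_sinf g" using surj by blast
      then have "T (fn f) = g" using fnt[of f] fn_Abs[OF that] by simp
      then show ?thesis using fn[of f] by blast
    qed
    then show "T ` S_inf = S_inf" using assms(1) by blast
    show "norm_Sigma (\<lambda>z. T f z - T g z) = norm_Sigma (\<lambda>z. f z - g z)" if "f \<in> S_inf" "g \<in> S_inf" for f g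
      using iso[of "Abs_sinf f" "Abs_sinf g"]
      by (simp add: norm_sinf.rep_eq minus_sinf.rep_eq fnt fn_Abs that)
  qed
qed

end
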